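(* Let $\Omega\subset\mathbb{R}^2$ be a connected, bounded, open set with polygonal boundary, and let $\{u_j\}$ be a sequence of eigenfunctions on $\Omega$ satisfying $$-\Delta u_j=\lambda_j^2u_j \ \text{ in }\Omega,\qquad Bu_j=0\ \text{ on }\partial\Omega,\qquad \|u_j\|_{L^2(\Omega)}=1,$$ with $\lambda_j\to\infty$, where $B$ is a boundary operator imposing, on each boundary segment, either the Dirichlet or the Neumann condition. Let $p_0\in\overline{\Omega}$ be any point (including on the boundary), and let $d=\operatorname{dist}(p_0,F')>0$, where $F'\subset\partial\Omega$ is the nearest boundary face not adjacent to $p_0$. Then for each $0<\alpha<1$, $$\limsup_{\lambda_j\to\infty}\ \|u_j\|^2_{L^2(D(p_0,\alpha d)\cap\Omega)}\ \leq\ \frac{1}{2-\alpha}.$$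
   Context: Polygonal boundary: $\partial\Omega=\Gamma=\bigcup_{j=1}^N\Gamma_j$ is a finite union of disjoint closed simple polygonal curves, $\Omega$ is the bounded connected open domain enclosed by $\Gamma$, and each $\Gamma_j=\bigcup_{k_j=1}^{M_j}\Gamma_{k_j}$ is a union of finitely many linear segments (the faces, also called edges or sides). Each corner makes an interior angle $\theta$ (measured from inside $\Omega$) with $0<\theta<2\pi$; concave corners ($\pi<\theta<2\pi$) are allowed. Boundary operator: to each segment $\Gamma_{k_j}$, with outward unit normal $\nu_{k_j}$, a fixed choice of condition is assigned, either Dirichlet, $B_{k_j}u=u|_{\Gamma_{k_j}}$, or Neumann, $B_{k_j}u=\partial_{\nu_{k_j}}u|_{\Gamma_{k_j}}$. Different segments may carry different types (mixed conditions). $Bu=0$ on $\partial\Omega$ means $B_{k_j}u=0$ on every segment. Eigenfunctions are understood in the standard (variational, $H^1$) sense for the Laplacian with these boundary conditions. A face is adjacent to $p_0$ if $p_0$ lies on the (closed) face. Thus if $p_0\in\Omega$, no face is adjacent and $d=\operatorname{dist}(p_0,\partial\Omega)$; if $p_0$ is in the interior of a face, only that face is adjacent; if $p_0$ is a corner, the two faces meeting there are adjacent. $D(p_0,r)$ is the disc of radius $r$ centered at $p_0$. *)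

theory Defs
  imports "HOL-Analysis.Analysis"
begin

section \<open>Polygonal domains\<close>

fun polyline :: "(real^2) list \<Rightarrow> real \<Rightarrow> real^2" where
  "polyline [] = linepath 0 0"
| "polyline [a] = linepath a a"
| "polyline [a, b] = linepath a b"
| "polyline (a # b # c # vs) = linepath a b +++ polyline (b # c # vs)"

text \<open>The list of vertices of a closed polygonal curve repeats its first vertex at the end.
  Simplicity forces at least three edges, none of them degenerate, and it excludes the
  interior angles \<open>0\<close> and \<open>2\<pi>\<close>. An angle \<open>\<pi>\<close> is allowed, so that a straight side may be
  subdivided where the boundary condition changes.\<close>

definition closed_simple_polygon :: "(real^2) list \<Rightarrow> bool" where
  "closed_simple_polygon vs \<longleftrightarrow>
     simple_path (polyline vs) \<and> pathfinish (polyline vs) = pathstart (polyline vs)"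

definition edges :: "(real^2) list \<Rightarrow> ((real^2) \<times> (real^2)) set" where
  "edges vs = set (zip vs (tl vs))"

definition faces :: "(real^2) list set \<Rightarrow> ((real^2) \<times> (real^2)) set" where
  "faces \<C> = (\<Union>vs\<in>\<C>. edges vs)"

definition face_set :: "(real^2) \<times> (real^2) \<Rightarrow> (real^2) set" where
  "face_set e = closed_segment (fst e) (snd e)"

text \<open>As \<open>\<Omega>\<close> is connected, open and bounded, and its whole boundary is the union of the disjoint
  curves, \<open>\<Omega>\<close> is a bounded component of the complement of that union. By the Jordan curve
  theorem it lies on only one side of every curve (no slits).\<close>

definition polygonal_domain :: "(real^2) set \<Rightarrow> (real^2) list set \<Rightarrow> bool" where
  "polygonal_domain \<Omega> \<C> \<longleftrightarrow>
     \<Omega> \<noteq> {} \<and> open \<Omega> \<and> connected \<Omega> \<and> bounded \<Omega> \<and>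
     finite \<C> \<and> (\<forall>vs\<in>\<C>. closed_simple_polygon vs) \<and>
     pairwise (\<lambda>vs ws. disjnt (path_image (polyline vs)) (path_image (polyline ws))) \<C> \<and>
     frontier \<Omega> = (\<Union>vs\<in>\<C>. path_image (polyline vs))"


section \<open>Sobolev space and traces\<close>

definition square_integrable :: "(real^2) set \<Rightarrow> (real^2 \<Rightarrow> complex) \<Rightarrow> bool" where
  "square_integrable S f \<longleftrightarrow>
     f \<in> borel_measurable (lebesgue_on S) \<and> integrable (lebesgue_on S) (\<lambda>x. (cmod (f x))\<^sup>2)"

definition L2_norm_on :: "(real^2) set \<Rightarrow> (real^2 \<Rightarrow> complex) \<Rightarrow> real" where
  "L2_norm_on S f = sqrt (LINT x|lebesgue_on S. (cmod (f x))\<^sup>2)"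

definition pd :: "2 \<Rightarrow> (real^2 \<Rightarrow> complex) \<Rightarrow> real^2 \<Rightarrow> complex" where
  "pd i f = (\<lambda>x. frechet_derivative f (at x) (axis i 1))"

definition smooth :: "(real^2 \<Rightarrow> complex) \<Rightarrow> bool" where
  "smooth f \<longleftrightarrow> (\<forall>is x. foldr pd is f differentiable (at x))"

definition test_function :: "(real^2) set \<Rightarrow> (real^2 \<Rightarrow> complex) \<Rightarrow> bool" where
  "test_function \<Omega> \<phi> \<longleftrightarrow>
     smooth \<phi> \<and> compact (closure {x. \<phi> x \<noteq> 0}) \<and> closure {x. \<phi> x \<noteq> 0} \<subseteq> \<Omega>"

text \<open>\<open>H1 \<Omega> u G\<close>: \<open>u\<close> belongs to \<open>H\<^sup>1(\<Omega>)\<close> and \<open>G\<close> is its weak gradient. The gradient is an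
  explicit argument because it is determined only almost everywhere.\<close>

definition H1 :: "(real^2) set \<Rightarrow> (real^2 \<Rightarrow> complex) \<Rightarrow> (real^2 \<Rightarrow> complex^2) \<Rightarrow> bool" where
  "H1 \<Omega> u G \<longleftrightarrow>
     square_integrable \<Omega> u \<and>
     (\<forall>i. square_integrable \<Omega> (\<lambda>x. G x $ i) \<and>
       (\<forall>\<phi>. test_function \<Omega> \<phi> \<longrightarrow>
         (LINT x|lebesgue_on \<Omega>. u x * pd i \<phi> x) = - (LINT x|lebesgue_on \<Omega>. G x $ i * \<phi> x)))"

text \<open>The trace operator from \<open>H\<^sup>1(\<Omega>)\<close> to \<open>L\<^sup>2\<close> of a face is the continuous extension of the
  restriction map on functions smooth up to the boundary. Hence the trace of \<open>u\<close> vanishes iff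
  some smooth functions converge to \<open>u\<close> in \<open>H\<^sup>1(\<Omega>)\<close> and to \<open>0\<close> in \<open>L\<^sup>2\<close> of the face with respect
  to arc length.\<close>

definition zero_trace ::
  "(real^2) set \<Rightarrow> (real^2 \<Rightarrow> complex) \<Rightarrow> (real^2 \<Rightarrow> complex^2) \<Rightarrow> (real^2) \<times> (real^2) \<Rightarrow> bool" where
  "zero_trace \<Omega> u G e \<longleftrightarrow>
     (\<exists>\<phi>. (\<forall>n. smooth (\<phi> n)) \<and>
        (\<lambda>n::nat. L2_norm_on \<Omega> (\<lambda>x. \<phi> n x - u x)) \<longlonglongrightarrow> 0 \<and>
        (\<forall>i. (\<lambda>n. L2_norm_on \<Omega> (\<lambda>x. pd i (\<phi> n) x - G x $ i)) \<longlonglongrightarrow> 0) \<and>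
        (\<lambda>n. dist (fst e) (snd e) *
           integral {0..1} (\<lambda>t. (cmod (\<phi> n (linepath (fst e) (snd e) t)))\<^sup>2)) \<longlonglongrightarrow> 0)"


section \<open>Eigenfunctions of the mixed boundary value problem\<close>

datatype boundary_condition = Dirichlet | Neumann

definition form_domain ::
  "(real^2) set \<Rightarrow> (real^2) list set \<Rightarrow> ((real^2) \<times> (real^2) \<Rightarrow> boundary_condition) \<Rightarrow>
   (real^2 \<Rightarrow> complex) \<Rightarrow> (real^2 \<Rightarrow> complex^2) \<Rightarrow> bool" where
  "form_domain \<Omega> \<C> B u G \<longleftrightarrow>
     H1 \<Omega> u G \<and> (\<forall>e\<in>faces \<C>. B e = Dirichlet \<longrightarrow> zero_trace \<Omega> u G e)"

text \<open>Variational solutions of \<open>-\<Delta>u = \<mu>u\<close>, \<open>Bu = 0\<close>. The Neumann condition is the natural boundary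
  condition of the weak equation, whose test functions are unconstrained on the Neumann faces.\<close>

definition eigen_solution ::
  "(real^2) set \<Rightarrow> (real^2) list set \<Rightarrow> ((real^2) \<times> (real^2) \<Rightarrow> boundary_condition) \<Rightarrow>
   real \<Rightarrow> (real^2 \<Rightarrow> complex) \<Rightarrow> bool" where
  "eigen_solution \<Omega> \<C> B \<mu> u \<longleftrightarrow>
     (\<exists>G. form_domain \<Omega> \<C> B u G \<and>
        (\<forall>v H. form_domain \<Omega> \<C> B v H \<longrightarrow>
           (LINT x|lebesgue_on \<Omega>. (\<Sum>i\<in>UNIV. G x $ i * cnj (H x $ i))) =
           complex_of_real \<mu> * (LINT x|lebesgue_on \<Omega>. u x * cnj (v x))))"

end

theory Submission imports Defs "HOL-Computational_Algebra.Polynomial" begin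

text \<open>
  Why the theorem holds. No two adjacent edges of a simple closed polygon meet outside their common
  vertex. Hence, apart from \<open>p0\<close> itself, the part of the domain in \<open>D(p0, d)\<close> is a union of open radii: a disc, a half disc
  or a sector (\<open>polygonal_domain_conic\<close>). A dilation \<open>\<delta>\<^sub>c x = p0 + c (x - p0)\<close> with \<open>0 < c < 1\<close>
  therefore maps this part of the domain into the domain, and each face through \<open>p0\<close> into itself.
  Consequently, if \<open>u\<close> lies in the form domain and \<open>m\<close> is a smooth cutoff supported in \<open>D(p0, d)\<close>,
  then so does \<open>m (u \<circ> \<delta>\<^sub>c)\<close>, whatever mixture of boundary conditions is imposed
  (\<open>form_domain_cut\<close>).

  These test functions replace the commutator with the radial vector field. That commutator would
  need second derivatives of \<open>u\<close>, which may fail to be square integrable at concave corners.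
  Write \<open>u\<^sub>c = u \<circ> \<delta>\<^sub>c\<close> and expand
  \<open>0 \<le> \<integral> m |\<nabla>u\<^sub>c - \<nabla>u|\<^sup>2\<close>
  by testing the equation with \<open>m u\<close>, with the dilate of \<open>m\<close> times \<open>u\<close>, and with \<open>m u\<^sub>c\<close>
  (\<open>dilation_inequality\<close>). The only information on \<open>u\<^sub>c - u\<close> that enters is its pairing with
  \<open>L\<^sup>2\<close> functions, which the fundamental theorem of calculus along dilations controls
  (\<open>difference_quotient\<close>). For a radial nonincreasing \<open>m\<close>, dividing by \<open>1 - c\<close> and letting
  \<open>c \<rightarrow> 1\<close> gives, with \<open>r = |x - p0|\<close> and \<open>\<mu> = \<lambda>\<^sup>2\<close>,
  \<open>\<mu> \<integral> m |u|\<^sup>2 \<le> \<integral> (- r \<partial>\<^sub>r m) |\<partial>\<^sub>r u|\<^sup>2 + O(\<lambda>)\<close>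
  (\<open>virial_inequality\<close>). Bounding the radial derivative by the full gradient and testing with
  \<open>(- r \<partial>\<^sub>r m) u\<close> turns the right-hand side into
  \<open>\<mu> \<integral> (- r \<partial>\<^sub>r m) |u|\<^sup>2 + O(\<lambda>)\<close>
  (\<open>radial_energy_le\<close>), so that \<open>\<integral> (m + r \<partial>\<^sub>r m) |u|\<^sup>2 \<le> O(1 / \<lambda>)\<close>.

  It remains to choose \<open>m\<close>. It should equal \<open>1\<close> on \<open>D(p0, \<alpha> d)\<close>, vanish near the boundary of
  \<open>D(p0, d)\<close> and satisfy \<open>- r \<partial>\<^sub>r m \<le> 1 / (1 - \<alpha>)\<close>. As a function of \<open>ln r\<close> it descends from
  \<open>1\<close> to \<open>0\<close> over a length \<open>ln (1 / \<alpha>) > 1 - \<alpha>\<close>, so there is room for a smooth one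
  (\<open>radial_cutoff\<close>). If \<open>M\<close> denotes the mass of \<open>u\<close> in \<open>D(p0, \<alpha> d)\<close>, then
  \<open>M - (1 - M) / (1 - \<alpha>) \<le> O(1 / \<lambda>)\<close>, that is, \<open>M \<le> 1 / (2 - \<alpha>) + O(1 / \<lambda>)\<close>.
\<close>

section \<open>Calculus of smooth functions\<close>

lemma smooth_differentiable: "smooth f \<Longrightarrow> f differentiable (at x)"
  unfolding smooth_def by (metis foldr.simps(1) id_apply)

lemma smooth_pd: "smooth f \<Longrightarrow> smooth (pd i f)"
  unfolding smooth_def
proof (intro allI)
  fix js x
  assume *: "\<forall>js x. foldr pd js f differentiable at x"
  have "foldr pd (js @ [i]) f differentiable at x" using * by blast
  then show "foldr pd js (pd i f) differentiable at x" by simp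
qed

lemma smooth_coinduct:
  assumes "P f" and diff: "\<And>g x. P g \<Longrightarrow> g differentiable (at x)" and pd: "\<And>g i. P g \<Longrightarrow> P (pd i g)"
  shows "smooth f"
proof -
  have "P (foldr pd js f)" for js
    by (induction js) (use assms in auto)
  then show ?thesis unfolding smooth_def using diff by blast
qed

lemma pd_eq: "(f has_derivative D) (at x) \<Longrightarrow> pd i f x = D (axis i 1)"
  unfolding pd_def by (metis frechet_derivative_at)

lemma has_derivative_frechet:
  "f differentiable (at x) \<Longrightarrow> (f has_derivative frechet_derivative f (at x)) (at x)"
  by (simp add: frechet_derivative_works)

lemma pd_add:
  assumes "f differentiable (at x)" "g differentiable (at x)"
  shows "pd i (\<lambda>x. f x + g x) x = pd i f x + pd i g x"
  using pd_eq[OF has_derivative_add[OF assms[THEN has_derivative_frechet]]]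
  by (simp add: pd_def)

lemma pd_mult:
  assumes "f differentiable (at x)" "g differentiable (at x)"
  shows "pd i (\<lambda>x. f x * g x) x = f x * pd i g x + pd i f x * g x"
  using pd_eq[OF has_derivative_mult[OF assms[THEN has_derivative_frechet]]]
  by (simp add: pd_def)

lemma pd_const: "pd i (\<lambda>x. c) = (\<lambda>x. 0)"
  unfolding fun_eq_iff using pd_eq[OF has_derivative_const] by blast

text \<open>Smoothness of a class of functions that is not itself closed under differentiation is proved up to
  algebraic combinations: the derivatives only need to lie in the algebra that the class generates over
  the smooth functions.\<close>

inductive generated_by :: "((real^2 \<Rightarrow> complex) \<Rightarrow> bool) \<Rightarrow> (real^2 \<Rightarrow> complex) \<Rightarrow> bool"
  for P where
  base: "P f \<Longrightarrow> generated_by P f"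
| smooth: "smooth f \<Longrightarrow> generated_by P f"
| add: "generated_by P f \<Longrightarrow> generated_by P g \<Longrightarrow> generated_by P (\<lambda>x. f x + g x)"
| mult: "generated_by P f \<Longrightarrow> generated_by P g \<Longrightarrow> generated_by P (\<lambda>x. f x * g x)"

text \<open>The sum and product rules propagate differentiability and stability under \<open>pd\<close> from the generators
  to the whole algebra, which is then closed under \<open>pd\<close>, so coinduction applies.\<close>

lemma smooth_generated:
  assumes "generated_by P f"
    and diff: "\<And>g x. P g \<Longrightarrow> g differentiable (at x)"
    and pd: "\<And>g i. P g \<Longrightarrow> generated_by P (pd i g)"
  shows "smooth f"
  using assms(1)
proof (rule smooth_coinduct)
  fix g i x assume "generated_by P g"
  then have "(\<forall>x. g differentiable (at x)) \<and> generated_by P (pd i g)"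
  proof (induction)
    case (base f)
    then show ?case using diff pd by blast
  next
    case (smooth f)
    then show ?case by (auto intro: smooth_differentiable generated_by.smooth smooth_pd)
  next
    case (add f g)
    then have "pd i (\<lambda>x. f x + g x) = (\<lambda>x. pd i f x + pd i g x)"
      by (auto simp: fun_eq_iff pd_add)
    then show ?case using add by (auto intro!: generated_by.add differentiable_add)
  next
    case (mult f g)
    then have "pd i (\<lambda>x. f x * g x) = (\<lambda>x. f x * pd i g x + pd i f x * g x)"
      by (auto simp: fun_eq_iff pd_mult)
    then show ?case using mult by (auto intro!: generated_by.add generated_by.mult differentiable_mult)
  qed
  then show "g differentiable (at x)" "generated_by P (pd i g)" by blast+
qed

lemma smooth_const [simp, intro]: "smooth (\<lambda>x. c)"
  by (rule smooth_coinduct[of "\<lambda>f. \<exists>c. f = (\<lambda>_. c)"]) (auto simp: pd_const)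

lemma smooth_add [intro]: "smooth f \<Longrightarrow> smooth g \<Longrightarrow> smooth (\<lambda>x. f x + g x)"
  by (rule smooth_generated[of "\<lambda>_. False"]) (auto intro: generated_by.intros)

lemma smooth_mult [intro]: "smooth f \<Longrightarrow> smooth g \<Longrightarrow> smooth (\<lambda>x. f x * g x)"
  by (rule smooth_generated[of "\<lambda>_. False"]) (auto intro: generated_by.intros)

lemma smooth_diff [intro]:
  assumes "smooth f" "smooth g" shows "smooth (\<lambda>x. f x - g x)"
proof -
  have "smooth (\<lambda>x. f x + (-1) * g x)" using assms by (intro smooth_add smooth_mult) auto
  then show ?thesis by simp
qed

lemma smooth_sum [intro]:
  assumes "\<And>k. k \<in> A \<Longrightarrow> smooth (f k)"
  shows "smooth (\<lambda>x. \<Sum>k\<in>A. f k x)"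
  using assms by (induction A rule: infinite_finite_induct) auto

lemma smooth_power [intro]: "smooth f \<Longrightarrow> smooth (\<lambda>x. f x ^ n)"
  by (induction n) auto

lemma has_derivative_coord:
  "((\<lambda>x. complex_of_real (x $ k)) has_derivative (\<lambda>h. complex_of_real (h $ k))) (at x)"
  by (intro has_derivative_of_real bounded_linear.has_derivative[OF bounded_linear_vec_nth] has_derivative_ident)

lemma pd_coord: "pd i (\<lambda>x. complex_of_real (x $ k)) x = (if i = k then 1 else 0)"
  by (subst pd_eq[OF has_derivative_coord]) (auto simp: axis_def)

lemma smooth_coord [simp, intro]: "smooth (\<lambda>x. complex_of_real (x $ k))"
proof (rule smooth_generated[of "\<lambda>f. \<exists>k. f = (\<lambda>x. complex_of_real (x $ k))"])
  fix g x assume "\<exists>k. g = (\<lambda>x. complex_of_real (x $ k))"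
  then show "g differentiable at x" using has_derivative_coord differentiableI by blast
next
  fix g :: "real^2 \<Rightarrow> complex" and i assume "\<exists>k. g = (\<lambda>x. complex_of_real (x $ k))"
  then obtain k where g: "g = (\<lambda>x. complex_of_real (x $ k))" by blast
  have "pd i (\<lambda>x. complex_of_real (x $ k)) = (\<lambda>x. if i = k then 1 else 0)"
    unfolding fun_eq_iff pd_coord by blast
  with g have "pd i g = (\<lambda>x. if i = k then 1 else 0)" by simp
  then show "generated_by (\<lambda>f. \<exists>k. f = (\<lambda>x. complex_of_real (x $ k))) (pd i g)"
    by (auto intro: generated_by.smooth)
qed (auto intro: generated_by.base)

definition dil :: "real^2 \<Rightarrow> real \<Rightarrow> real^2 \<Rightarrow> real^2" where
  "dil p s x = p + s *\<^sub>R (x - p)"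

lemma has_derivative_dil: "(dil p s has_derivative (\<lambda>h. s *\<^sub>R h)) (at x)"
  unfolding dil_def [abs_def] by (auto intro!: derivative_eq_intros)

lemma differentiable_dil:
  "f differentiable (at (dil p s x)) \<Longrightarrow> (\<lambda>x. f (dil p s x)) differentiable (at x)"
  using has_derivative_compose[OF has_derivative_dil] unfolding differentiable_def by blast

lemma pd_dil:
  assumes "f differentiable (at (dil p s x))"
  shows "pd i (\<lambda>x. f (dil p s x)) x = of_real s * pd i f (dil p s x)"
proof -
  have f: "(f has_derivative frechet_derivative f (at (dil p s x))) (at (dil p s x))"
    using assms by (rule has_derivative_frechet)
  have "pd i (\<lambda>x. f (dil p s x)) x = frechet_derivative f (at (dil p s x)) (s *\<^sub>R axis i 1)"
    by (rule pd_eq[OF has_derivative_compose[OF has_derivative_dil f]])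
  also have "\<dots> = s *\<^sub>R frechet_derivative f (at (dil p s x)) (axis i 1)"
    by (rule linear_scale[OF has_derivative_linear[OF f]])
  finally show ?thesis by (simp add: pd_def scaleR_conv_of_real)
qed

lemma smooth_dil:
  assumes "smooth f" shows "smooth (\<lambda>x. f (dil p s x))"
proof (rule smooth_generated[of "\<lambda>g. \<exists>f. smooth f \<and> g = (\<lambda>x. f (dil p s x))"])
  fix g :: "real^2 \<Rightarrow> complex" and i assume "\<exists>f. smooth f \<and> g = (\<lambda>x. f (dil p s x))"
  then obtain f where f: "smooth f" "g = (\<lambda>x. f (dil p s x))" by blast
  then have "pd i g = (\<lambda>x. of_real s * pd i f (dil p s x))"
    by (auto simp: pd_dil smooth_differentiable)
  then show "generated_by (\<lambda>g. \<exists>f. smooth f \<and> g = (\<lambda>x. f (dil p s x))) (pd i g)"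
    using f smooth_pd by (auto intro!: generated_by.mult intro: generated_by.smooth[OF smooth_const] generated_by.base)
next
  show "generated_by (\<lambda>g. \<exists>f. smooth f \<and> g = (\<lambda>x. f (dil p s x))) (\<lambda>x. f (dil p s x))"
    using assms by (auto intro: generated_by.base)
qed (use differentiable_dil smooth_differentiable in blast)

text \<open>A real function composed with a real-valued function; the inner derivative is real because its
  embedding into the complex numbers has only one derivative.\<close>

lemma chain_of_real:
  assumes "(h has_real_derivative h') (at (l x))"
    and "(\<lambda>x. complex_of_real (l x)) differentiable (at x)"
  shows "(\<lambda>x. complex_of_real (h (l x))) differentiable (at x)"
    and "pd i (\<lambda>x. complex_of_real (h (l x))) x = of_real h' * pd i (\<lambda>x. complex_of_real (l x)) x"
proof -
  obtain D where D: "((\<lambda>x. complex_of_real (l x)) has_derivative D) (at x)"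
    using assms(2) unfolding differentiable_def by blast
  have R: "(l has_derivative (\<lambda>v. Re (D v))) (at x)"
    using bounded_linear.has_derivative[OF bounded_linear_Re D] by simp
  have "((\<lambda>x. complex_of_real (l x)) has_derivative (\<lambda>v. complex_of_real (Re (D v)))) (at x)"
    by (rule has_derivative_of_real[OF R])
  then have Deq: "D = (\<lambda>v. complex_of_real (Re (D v)))"
    using D has_derivative_unique by blast
  have "((\<lambda>x. h (l x)) has_derivative (\<lambda>v. h' * Re (D v))) (at x)"
    using has_derivative_compose[OF R assms(1)[unfolded has_field_derivative_def]] by simp
  then have H: "((\<lambda>x. complex_of_real (h (l x))) has_derivative (\<lambda>v. complex_of_real (h' * Re (D v)))) (at x)"
    by (rule has_derivative_of_real)
  then show "(\<lambda>x. complex_of_real (h (l x))) differentiable (at x)"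
    by (rule differentiableI)
  show "pd i (\<lambda>x. complex_of_real (h (l x))) x = of_real h' * pd i (\<lambda>x. complex_of_real (l x)) x"
    unfolding pd_eq[OF H] pd_eq[OF D] by (subst (2) Deq) simp
qed

text \<open>The derivative of \<open>exp (- 1 / t)\<close> is the same function times a polynomial in \<open>1 / t\<close>. Carrying that
  polynomial along gives a family that is closed under differentiation.\<close>

definition flat_exp :: "real poly \<Rightarrow> real \<Rightarrow> real" where
  "flat_exp p t = (if t > 0 then poly p (1 / t) * exp (- 1 / t) else 0)"

lemma flat_exp_tendsto_0: "((\<lambda>t::real. poly p (1 / t) * exp (- 1 / t)) \<longlongrightarrow> 0) (at_right 0)"
proof -
  have "((\<lambda>x. \<Sum>i\<le>degree p. coeff p i * (x ^ i / exp x)) \<longlongrightarrow> (\<Sum>i\<le>degree p. coeff p i * 0)) at_top"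
    by (intro tendsto_intros tendsto_power_div_exp_0)
  moreover have "(\<Sum>i\<le>degree p. coeff p i * (x ^ i / exp x)) = poly p x * exp (- x)" for x
    by (simp add: poly_altdef sum_distrib_right exp_minus divide_inverse mult.assoc)
  ultimately have lim: "((\<lambda>x. poly p x * exp (- x)) \<longlongrightarrow> 0) at_top"
    by (simp only: mult_zero_right sum.neutral_const)
  have "filterlim (\<lambda>t::real. 1 / t) at_top (at_right 0)"
    using filterlim_inverse_at_top_right by (simp only: inverse_eq_divide)
  from filterlim_compose[OF lim this] show ?thesis
    by (simp only: minus_divide_left)
qed

text \<open>The only delicate point is \<open>t = 0\<close>: the difference quotient from the right is the member of the
  family with polynomial \<open>X p\<close>, which tends to \<open>0\<close>.\<close>

lemma flat_exp_deriv:
  "(flat_exp p has_real_derivative flat_exp ([:0, 0, 1:] * (p - pderiv p)) t) (at t)"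
proof -
  consider "t > 0" | "t < 0" | "t = 0" by linarith
  then show ?thesis
  proof cases
    case 1
    have inv: "((\<lambda>t. 1 / t) has_real_derivative - (1 / t * (1 / t))) (at t)"
      using DERIV_inverse[of t] 1 by (simp add: inverse_eq_divide power2_eq_square)
    have "((\<lambda>t. poly p (1 / t) * exp (- (1 / t))) has_real_derivative
        poly (pderiv p) (1 / t) * - (1 / t * (1 / t)) * exp (- (1 / t)) +
        exp (- (1 / t)) * - (- (1 / t * (1 / t))) * poly p (1 / t)) (at t)"
      by (rule DERIV_mult[OF DERIV_chain2[OF poly_DERIV inv] DERIV_fun_exp[OF DERIV_minus[OF inv]]])
    moreover have "poly (pderiv p) (1 / t) * - (1 / t * (1 / t)) * exp (- (1 / t)) +
        exp (- (1 / t)) * - (- (1 / t * (1 / t))) * poly p (1 / t) =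
        flat_exp ([:0, 0, 1:] * (p - pderiv p)) t"
      using 1 by (simp add: flat_exp_def algebra_simps)
    ultimately have "((\<lambda>t. poly p (1 / t) * exp (- 1 / t)) has_real_derivative
        flat_exp ([:0, 0, 1:] * (p - pderiv p)) t) (at t)"
      by simp
    then show ?thesis
      by (rule has_field_derivative_transform_within_open[of _ _ _ "{0<..}"])
         (use 1 in \<open>auto simp: flat_exp_def\<close>)
  next
    case 2
    have "((\<lambda>t. 0) has_real_derivative flat_exp ([:0, 0, 1:] * (p - pderiv p)) t) (at t)"
      using 2 by (auto simp: flat_exp_def)
    then show ?thesis
      by (rule has_field_derivative_transform_within_open[of _ _ _ "{..<0}"])
         (use 2 in \<open>auto simp: flat_exp_def\<close>)
  next
    case 3
    have "((\<lambda>h. flat_exp p h / h) \<longlongrightarrow> 0) (at_right 0)"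
    proof (rule Lim_transform_eventually[OF flat_exp_tendsto_0[of "[:0, 1:] * p"]])
      show "\<forall>\<^sub>F t in at_right 0. poly ([:0, 1:] * p) (1 / t) * exp (- 1 / t) = flat_exp p t / t"
        by (auto simp: eventually_at_filter flat_exp_def)
    qed
    moreover have "((\<lambda>h. flat_exp p h / h) \<longlongrightarrow> 0) (at_left 0)"
      by (rule Lim_transform_eventually[OF tendsto_const])
         (auto simp: eventually_at_filter flat_exp_def)
    ultimately have "((\<lambda>h. flat_exp p h / h) \<longlongrightarrow> 0) (at 0)"
      by (simp add: filterlim_split_at_real)
    then show ?thesis unfolding 3 DERIV_def by (simp add: flat_exp_def)
  qed
qed

lemma smooth_flat_exp:
  assumes l: "smooth (\<lambda>x. complex_of_real (l x))"
  shows "smooth (\<lambda>x. complex_of_real (flat_exp p (l x)))"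
proof (rule smooth_generated[of "\<lambda>g. \<exists>p. g = (\<lambda>x. complex_of_real (flat_exp p (l x)))"])
  fix g :: "real^2 \<Rightarrow> complex" and i assume "\<exists>p. g = (\<lambda>x. complex_of_real (flat_exp p (l x)))"
  then obtain p where g: "g = (\<lambda>x. complex_of_real (flat_exp p (l x)))" by blast
  have "pd i g = (\<lambda>x. of_real (flat_exp ([:0, 0, 1:] * (p - pderiv p)) (l x)) * pd i (\<lambda>x. complex_of_real (l x)) x)"
    unfolding g fun_eq_iff
    by (intro allI chain_of_real(2) flat_exp_deriv smooth_differentiable[OF l])
  then show "generated_by (\<lambda>g. \<exists>p. g = (\<lambda>x. complex_of_real (flat_exp p (l x)))) (pd i g)"
    by (simp only:) (rule generated_by.mult[OF generated_by.base generated_by.smooth[OF smooth_pd[OF l]]], blast)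
next
  fix g x assume "\<exists>p. g = (\<lambda>x. complex_of_real (flat_exp p (l x)))"
  then show "g differentiable at x"
    using chain_of_real(1)[OF flat_exp_deriv smooth_differentiable[OF l]] by blast
qed (auto intro: generated_by.base)

definition sqdist :: "real^2 \<Rightarrow> real^2 \<Rightarrow> real" where
  "sqdist p x = (norm (x - p))\<^sup>2"

lemma sqdist_coord: "complex_of_real (sqdist p x) = (\<Sum>k\<in>UNIV. (of_real (x $ k) - of_real (p $ k))\<^sup>2)"
  by (simp add: sqdist_def norm_vec_def L2_set_def sum_2)

lemma smooth_sqdist: "smooth (\<lambda>x. complex_of_real (sqdist p x))"
  unfolding sqdist_coord by (intro smooth_sum smooth_power smooth_diff smooth_coord smooth_const)

lemma has_derivative_sqdist: "(sqdist p has_derivative (\<lambda>h. 2 * ((x - p) \<bullet> h))) (at x)"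
  unfolding sqdist_def [abs_def] power2_norm_eq_inner
  by (auto intro!: derivative_eq_intros simp: inner_commute)

lemma pd_sqdist: "pd i (\<lambda>x. complex_of_real (sqdist p x)) x = 2 * of_real (x $ i - p $ i)"
  by (subst pd_eq[OF has_derivative_of_real[OF has_derivative_sqdist]]) (simp add: inner_axis)

lemma smooth_continuous_on: "smooth f \<Longrightarrow> continuous_on S f"
  by (meson differentiable_imp_continuous_within continuous_at_imp_continuous_on smooth_differentiable)

section \<open>Square integrable functions\<close>

text \<open>The square of the norm is used throughout instead of the norm: with \<open>|a + b|\<^sup>2 \<le> 2 |a|\<^sup>2 + 2 |b|\<^sup>2\<close>
  in place of the triangle inequality no square roots occur.\<close>

abbreviation mass :: "(real^2) set \<Rightarrow> (real^2 \<Rightarrow> complex) \<Rightarrow> real" where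
  "mass S f \<equiv> LINT x|lebesgue_on S. (cmod (f x))\<^sup>2"

lemma square_integrableD:
  assumes "square_integrable S f"
  shows "f \<in> borel_measurable (lebesgue_on S)" "integrable (lebesgue_on S) (\<lambda>x. (cmod (f x))\<^sup>2)"
  using assms by (auto simp: square_integrable_def)

lemma square_integrable_dominated:
  assumes f: "square_integrable S f" and g: "g \<in> borel_measurable (lebesgue_on S)"
    and le: "\<And>x. x \<in> S \<Longrightarrow> cmod (g x) \<le> C * cmod (f x)"
  shows "square_integrable S g" "mass S g \<le> C\<^sup>2 * mass S f"
proof -
  have sq: "(cmod (g x))\<^sup>2 \<le> C\<^sup>2 * (cmod (f x))\<^sup>2" if "x \<in> S" for x
    using power_mono[OF le[OF that], of 2] by (simp add: power_mult_distrib)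
  have i: "integrable (lebesgue_on S) (\<lambda>x. C\<^sup>2 * (cmod (f x))\<^sup>2)"
    using square_integrableD[OF f] by simp
  show "square_integrable S g" unfolding square_integrable_def
    using g by (auto intro!: Bochner_Integration.integrable_bound[OF i] sq)
  then show "mass S g \<le> C\<^sup>2 * mass S f"
    using square_integrableD(2) integral_mono[of "lebesgue_on S" "\<lambda>x. (cmod (g x))\<^sup>2" "\<lambda>x. C\<^sup>2 * (cmod (f x))\<^sup>2"] i sq
    by simp
qed

lemma square_integrable_add:
  assumes f: "square_integrable S f" and g: "square_integrable S g"
  shows "square_integrable S (\<lambda>x. f x + g x)"
    "mass S (\<lambda>x. f x + g x) \<le> 2 * mass S f + 2 * mass S g"
proof -
  have sq: "(cmod (f x + g x))\<^sup>2 \<le> 2 * (cmod (f x))\<^sup>2 + 2 * (cmod (g x))\<^sup>2" for x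
  proof -
    have "(cmod (f x + g x))\<^sup>2 \<le> (cmod (f x) + cmod (g x))\<^sup>2"
      by (intro power_mono norm_triangle_ineq) auto
    also have "\<dots> \<le> 2 * (cmod (f x))\<^sup>2 + 2 * (cmod (g x))\<^sup>2"
      using zero_le_power2[of "cmod (f x) - cmod (g x)"] by (simp add: power2_eq_square algebra_simps)
    finally show ?thesis .
  qed
  have i: "integrable (lebesgue_on S) (\<lambda>x. 2 * (cmod (f x))\<^sup>2 + 2 * (cmod (g x))\<^sup>2)"
    using square_integrableD f g by (intro Bochner_Integration.integrable_add integrable_mult_right) auto
  show *: "square_integrable S (\<lambda>x. f x + g x)" unfolding square_integrable_def
    using square_integrableD(1)[OF f] square_integrableD(1)[OF g]
    by (auto intro!: Bochner_Integration.integrable_bound[OF i] order_trans[OF sq] borel_measurable_add)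
  have "mass S (\<lambda>x. f x + g x) \<le> (LINT x|lebesgue_on S. 2 * (cmod (f x))\<^sup>2 + 2 * (cmod (g x))\<^sup>2)"
    using square_integrableD(2)[OF *] i sq by (intro integral_mono) auto
  also have "\<dots> = 2 * mass S f + 2 * mass S g"
    using square_integrableD(2) f g by (subst Bochner_Integration.integral_add) auto
  finally show "mass S (\<lambda>x. f x + g x) \<le> 2 * mass S f + 2 * mass S g" .
qed

lemma square_integrable_cmult:
  "square_integrable S f \<Longrightarrow> square_integrable S (\<lambda>x. c * f x)"
  by (rule square_integrable_dominated[where C = "cmod c" and f = f])
     (auto simp: norm_mult square_integrable_def)

lemma square_integrable_diff:
  assumes "square_integrable S f" "square_integrable S g"
  shows "square_integrable S (\<lambda>x. f x - g x)"
  using square_integrable_add(1)[OF assms(1) square_integrable_cmult[OF assms(2), of "-1"]] by simp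

lemma square_integrable_zero: "square_integrable S (\<lambda>x. 0)"
  by (simp add: square_integrable_def)

lemma square_integrable_sum:
  assumes "\<And>k. k \<in> A \<Longrightarrow> square_integrable S (f k)"
  shows "square_integrable S (\<lambda>x. \<Sum>k\<in>A. f k x)"
  using assms by (induction A rule: infinite_finite_induct)
    (auto intro: square_integrable_add square_integrable_zero)

lemma square_integrable_cnj:
  "square_integrable S f \<Longrightarrow> square_integrable S (\<lambda>x. cnj (f x))"
  by (rule square_integrable_dominated[where C = 1 and f = f])
     (auto simp: square_integrable_def intro!: measurable_compose[OF _ borel_measurable_continuous_onI[of cnj]] continuous_on_cnj continuous_on_id)

lemma square_integrable_mult_integrable:
  assumes f: "square_integrable S f" and g: "square_integrable S g"
  shows "integrable (lebesgue_on S) (\<lambda>x. f x * g x)"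
proof -
  have i: "integrable (lebesgue_on S) (\<lambda>x. (cmod (f x))\<^sup>2 + (cmod (g x))\<^sup>2)"
    using square_integrableD f g by (intro Bochner_Integration.integrable_add) auto
  show ?thesis
  proof (rule Bochner_Integration.integrable_bound[OF i])
    show "AE x in lebesgue_on S. norm (f x * g x) \<le> norm ((cmod (f x))\<^sup>2 + (cmod (g x))\<^sup>2)"
    proof (rule AE_I2)
      fix x
      have "0 \<le> cmod (f x) * cmod (g x)" by simp
      then have "cmod (f x) * cmod (g x) \<le> (cmod (f x))\<^sup>2 + (cmod (g x))\<^sup>2"
        using zero_le_power2[of "cmod (f x) - cmod (g x)"] unfolding power2_diff by linarith
      then show "norm (f x * g x) \<le> norm ((cmod (f x))\<^sup>2 + (cmod (g x))\<^sup>2)"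
        by (simp add: norm_mult)
    qed
  qed (use square_integrableD(1)[OF f] square_integrableD(1)[OF g] in auto)
qed

text \<open>The weighted form of the Cauchy-Schwarz inequality. The weight \<open>t\<close> is chosen in each application so
  that both terms have the same size.\<close>

lemma young_integral:
  assumes f: "square_integrable S f" and g: "square_integrable S g" and t: "t > 0"
  shows "2 * cmod (LINT x|lebesgue_on S. f x * g x) \<le> t * mass S f + mass S g / t"
proof -
  have i: "integrable (lebesgue_on S) (\<lambda>x. t * (cmod (f x))\<^sup>2 + (cmod (g x))\<^sup>2 / t)"
    using square_integrableD f g by (intro Bochner_Integration.integrable_add) auto
  have fg: "integrable (lebesgue_on S) (\<lambda>x. f x * g x)"
    using square_integrable_mult_integrable[OF f g] .
  have "2 * cmod (LINT x|lebesgue_on S. f x * g x) \<le> 2 * (LINT x|lebesgue_on S. cmod (f x * g x))"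
    by (simp add: integral_norm_bound)
  also have "\<dots> = (LINT x|lebesgue_on S. 2 * cmod (f x * g x))" by simp
  also have "\<dots> \<le> (LINT x|lebesgue_on S. t * (cmod (f x))\<^sup>2 + (cmod (g x))\<^sup>2 / t)"
  proof (rule integral_mono[OF _ i])
    show "integrable (lebesgue_on S) (\<lambda>x. 2 * cmod (f x * g x))" using fg by simp
    fix x
    have "0 \<le> (t * cmod (f x) - cmod (g x))\<^sup>2 / t" using t by simp
    also have "\<dots> = t * (cmod (f x))\<^sup>2 + (cmod (g x))\<^sup>2 / t - 2 * (cmod (f x) * cmod (g x))"
      using t by (simp add: field_simps power2_eq_square)
    finally show "2 * cmod (f x * g x) \<le> t * (cmod (f x))\<^sup>2 + (cmod (g x))\<^sup>2 / t"
      by (simp add: norm_mult)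
  qed
  also have "\<dots> = t * mass S f + mass S g / t"
    using square_integrableD(2) f g by (subst Bochner_Integration.integral_add) auto
  finally show ?thesis .
qed

lemma finite_measure_bounded_open:
  fixes S :: "(real^2) set" assumes "open S" "bounded S" shows "S \<in> lmeasurable"
  by (rule lmeasurable_open[OF assms(2,1)])

lemma square_integrable_continuous:
  fixes f :: "real^2 \<Rightarrow> complex"
  assumes S: "open S" "bounded S" and f: "continuous_on UNIV f"
  shows "square_integrable S f"
proof -
  have "compact (closure S)" using S by (simp add: compact_closure)
  then have "bounded (f ` closure S)"
    by (intro compact_imp_bounded compact_continuous_image continuous_on_subset[OF f subset_UNIV])
  then obtain C where C: "\<And>x. x \<in> closure S \<Longrightarrow> cmod (f x) \<le> C"
    unfolding bounded_iff by auto
  have m: "f \<in> borel_measurable (lebesgue_on S)"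
    by (rule continuous_imp_measurable_on_sets_lebesgue[OF continuous_on_subset[OF f subset_UNIV]
          fmeasurableD[OF finite_measure_bounded_open[OF S]]])
  have one: "square_integrable S (\<lambda>x. 1)"
    unfolding square_integrable_def
    using finite_measure.integrable_const[OF finite_measure_lebesgue_on[OF finite_measure_bounded_open[OF S]], of "1::real"]
    by simp
  show ?thesis
    by (rule square_integrable_dominated(1)[OF one m, of C]) (use C closure_subset in fastforce)
qed

section \<open>Dilations and conical domains\<close>

lemma dil_inverse: "s \<noteq> 0 \<Longrightarrow> dil p s (dil p (1 / s) x) = x" "s \<noteq> 0 \<Longrightarrow> dil p (1 / s) (dil p s x) = x"
  by (auto simp: dil_def)

text \<open>Change of variables in the plane: the Jacobian of a dilation is the square of its ratio.\<close>

lemma lebesgue_dil: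
  assumes "s \<noteq> 0"
  shows "lebesgue = density (distr lebesgue lebesgue (dil p s)) (\<lambda>_. ennreal (s\<^sup>2))"
    and measurable_dil: "dil p s \<in> lebesgue \<rightarrow>\<^sub>M lebesgue"
proof -
  have eq: "(\<lambda>x. (p - s *\<^sub>R p) + (\<Sum>j\<in>Basis. (s * (x \<bullet> j)) *\<^sub>R j)) = dil p s"
    by (auto simp: fun_eq_iff dil_def algebra_simps simp flip: scaleR_scaleR scaleR_sum_right
        simp: euclidean_representation)
  have "(\<Prod>j\<in>(Basis :: (real^2) set). \<bar>s\<bar>) = s\<^sup>2" by simp
  then show "lebesgue = density (distr lebesgue lebesgue (dil p s)) (\<lambda>_. ennreal (s\<^sup>2))"
    using lebesgue_affine_euclidean[of "\<lambda>_. s" "p - s *\<^sub>R p"] assms unfolding eq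
    by (simp add: ennreal_power)
  show "dil p s \<in> lebesgue \<rightarrow>\<^sub>M lebesgue"
    using lebesgue_affine_measurable[of "\<lambda>_. s" "p - s *\<^sub>R p"] assms unfolding eq by simp
qed

lemma measurable_compose_dil:
  assumes "s \<noteq> 0"
  shows "(\<lambda>x. f (dil p s x)) \<in> borel_measurable lebesgue \<longleftrightarrow> f \<in> borel_measurable lebesgue"
proof
  assume "(\<lambda>x. f (dil p s x)) \<in> borel_measurable lebesgue"
  from measurable_compose[OF measurable_dil[of "1/s" p] this]
  show "f \<in> borel_measurable lebesgue" using assms by (simp add: dil_inverse)
qed (use measurable_compose[OF measurable_dil[OF assms]] in blast)

lemma integral_dil:
  fixes f :: "real^2 \<Rightarrow> 'b::{banach, second_countable_topology}"
  assumes s: "s \<noteq> 0"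
  shows "integrable lebesgue (\<lambda>x. f (dil p s x)) \<longleftrightarrow> integrable lebesgue f" (is ?A)
    and "integral\<^sup>L lebesgue (\<lambda>x. f (dil p s x)) = (1 / s\<^sup>2) *\<^sub>R integral\<^sup>L lebesgue f"
proof -
  have s2: "s\<^sup>2 > 0" using s by simp
  show A: ?A
  proof (cases "f \<in> borel_measurable lebesgue")
    case True
    have "integrable lebesgue f \<longleftrightarrow> integrable (distr lebesgue lebesgue (dil p s)) (\<lambda>x. s\<^sup>2 *\<^sub>R f x)"
      by (subst lebesgue_dil[OF s, of p], subst integrable_density) (use True in auto)
    also have "\<dots> \<longleftrightarrow> integrable lebesgue (\<lambda>x. s\<^sup>2 *\<^sub>R f (dil p s x))"
      by (rule integrable_distr_eq[OF measurable_dil[OF s]]) (use True in auto)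
    also have "\<dots> \<longleftrightarrow> integrable lebesgue (\<lambda>x. f (dil p s x))"
    proof
      assume "integrable lebesgue (\<lambda>x. s\<^sup>2 *\<^sub>R f (dil p s x))"
      then have "integrable lebesgue (\<lambda>x. (1 / s\<^sup>2) *\<^sub>R s\<^sup>2 *\<^sub>R f (dil p s x))"
        by (rule integrable_scaleR_right)
      then show "integrable lebesgue (\<lambda>x. f (dil p s x))" using s2 by simp
    qed (rule integrable_scaleR_right)
    finally show ?thesis ..
  next
    case False
    then show ?thesis using measurable_compose_dil[OF s, of f p] by (auto dest: borel_measurable_integrable)
  qed
  show "integral\<^sup>L lebesgue (\<lambda>x. f (dil p s x)) = (1 / s\<^sup>2) *\<^sub>R integral\<^sup>L lebesgue f"
  proof (cases "integrable lebesgue f")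
    case True
    have m: "f \<in> borel_measurable lebesgue" using True by (rule borel_measurable_integrable)
    have "integral\<^sup>L lebesgue f = integral\<^sup>L (distr lebesgue lebesgue (dil p s)) (\<lambda>x. s\<^sup>2 *\<^sub>R f x)"
      by (subst lebesgue_dil[OF s, of p], subst integral_density) (use m in auto)
    also have "\<dots> = integral\<^sup>L lebesgue (\<lambda>x. s\<^sup>2 *\<^sub>R f (dil p s x))"
      by (rule integral_distr[OF measurable_dil[OF s]]) (use m in auto)
    finally show ?thesis using s2 by simp
  next
    case False
    then show ?thesis using A by (simp add: not_integrable_integral_eq)
  qed
qed

text \<open>Membership in the domain is invariant under contraction towards \<open>p\<close> within the disc of radius \<open>d\<close>.
  This single property covers interior points, points inside a face, and corners of any angle.\<close>

locale conic_at =
  fixes \<Omega> :: "(real^2) set" and p :: "real^2" and d :: real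
  assumes open_dom: "open \<Omega>" and bounded_dom: "bounded \<Omega>" and d_pos: "d > 0"
    and cone: "\<And>x s. x \<in> ball p d \<Longrightarrow> 0 < s \<Longrightarrow> s \<le> 1 \<Longrightarrow> dil p s x \<in> \<Omega> \<longleftrightarrow> x \<in> \<Omega>"
begin

abbreviation area :: "(real^2) measure" where "area \<equiv> lebesgue_on \<Omega>"

lemma sets_dom [simp]: "\<Omega> \<in> sets lebesgue"
  using open_dom by (simp add: borel_open sets_completionI_sets)

text \<open>Invariance of the domain lets a dilation be applied to functions on the domain that are supported in
  the disc, as if they lived on the whole plane.\<close>

lemma restrict_dil:
  assumes P: "\<And>x. x \<notin> ball p d \<Longrightarrow> P x = 0" and s: "0 < s" "s \<le> 1"
  shows "(\<lambda>x. if x \<in> \<Omega> then P x else 0) = (\<lambda>x. if dil p s x \<in> \<Omega> then P (dil p (1 / s) (dil p s x)) else 0)"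
proof
  fix x
  show "(if x \<in> \<Omega> then P x else 0) = (if dil p s x \<in> \<Omega> then P (dil p (1 / s) (dil p s x)) else 0)"
    using P[of x] cone[of x s] s by (cases "x \<in> ball p d") (simp_all add: dil_inverse)
qed

lemma integrable_dil_iff:
  fixes P :: "real^2 \<Rightarrow> 'b::{banach, second_countable_topology}"
  assumes P: "\<And>x. x \<notin> ball p d \<Longrightarrow> P x = 0" and s: "0 < s" "s \<le> 1"
  shows "integrable area P \<longleftrightarrow> integrable area (\<lambda>y. P (dil p (1 / s) y))"
proof -
  have "s \<noteq> 0" using s by simp
  from integral_dil(1)[OF this, of "\<lambda>y. if y \<in> \<Omega> then P (dil p (1 / s) y) else 0" p]
  show ?thesis
    unfolding Lebesgue_Measure.integrable_restrict_UNIV[OF sets_dom, symmetric] by (subst restrict_dil[OF P s])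
qed

lemma integral_dil_eq:
  fixes P :: "real^2 \<Rightarrow> 'b::euclidean_space"
  assumes P: "\<And>x. x \<notin> ball p d \<Longrightarrow> P x = 0" and s: "0 < s" "s \<le> 1"
  shows "integral\<^sup>L area P = (1 / s\<^sup>2) *\<^sub>R (LINT y|area. P (dil p (1 / s) y))"
proof -
  have "s \<noteq> 0" using s by simp
  from integral_dil(2)[OF this, of "\<lambda>y. if y \<in> \<Omega> then P (dil p (1 / s) y) else 0" p]
  show ?thesis
    unfolding Lebesgue_Measure.integral_restrict_UNIV[OF sets_dom, symmetric] by (subst restrict_dil[OF P s])
qed

lemma measurable_dil_iff:
  fixes P :: "real^2 \<Rightarrow> 'b::euclidean_space"
  assumes P: "\<And>x. x \<notin> ball p d \<Longrightarrow> P x = 0" and s: "0 < s" "s \<le> 1"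
  shows "P \<in> borel_measurable area \<longleftrightarrow>
    (\<lambda>y. P (dil p (1 / s) y)) \<in> borel_measurable area"
proof -
  have "s \<noteq> 0" using s by simp
  from measurable_compose_dil[OF this, of "\<lambda>y. if y \<in> \<Omega> then P (dil p (1 / s) y) else 0" p]
  show ?thesis
    unfolding borel_measurable_if[OF sets_dom, symmetric] by (subst restrict_dil[OF P s])
qed

end

section \<open>Density of test functions\<close>

definition bump :: "real^2 \<Rightarrow> real \<Rightarrow> real^2 \<Rightarrow> real" where
  "bump y r x = flat_exp 1 (r\<^sup>2 - sqdist y x)"

lemma smooth_bump: "smooth (\<lambda>x. complex_of_real (bump y r x))"
proof -
  have "smooth (\<lambda>x. complex_of_real (r\<^sup>2 - sqdist y x))"
    unfolding of_real_diff by (intro smooth_diff smooth_const smooth_sqdist)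
  from smooth_flat_exp[OF this, of 1] show ?thesis by (simp only: bump_def)
qed

lemma bump_bounds: "0 \<le> bump y r x" "bump y r x \<le> 1"
  by (auto simp: bump_def flat_exp_def)

lemma bump_pos: "r > 0 \<Longrightarrow> x \<in> ball y r \<Longrightarrow> bump y r x > 0"
  by (auto simp: bump_def flat_exp_def sqdist_def dist_norm norm_minus_commute power_strict_mono)

lemma bump_zero:
  assumes "r > 0" "x \<notin> cball y r" shows "bump y r x = 0"
proof -
  have "r\<^sup>2 \<le> (norm (x - y))\<^sup>2"
    using assms by (intro power_mono) (auto simp: dist_norm norm_minus_commute)
  then show ?thesis by (simp add: bump_def flat_exp_def sqdist_def)
qed

text \<open>A normalised sum \<open>\<Phi>\<close> of finitely many bumps is positive on the compact set and takes values in
  \<open>[0, 1]\<close>. Powers of \<open>1 - \<Phi>\<close> tend to \<open>0\<close> uniformly there, so \<open>1 - (1 - \<Phi>) ^ n\<close> is as close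
  to \<open>1\<close> as desired while keeping the support of \<open>\<Phi>\<close>.\<close>

lemma smooth_urysohn:
  fixes K U :: "(real^2) set"
  assumes K: "compact K" and U: "open U" "K \<subseteq> U" and \<epsilon>: "\<epsilon> > 0"
  obtains \<psi> L where "smooth (\<lambda>x. complex_of_real (\<psi> x))" "\<And>x. 0 \<le> \<psi> x" "\<And>x. \<psi> x \<le> 1"
    "\<And>x. x \<in> K \<Longrightarrow> 1 - \<psi> x \<le> \<epsilon>" "compact L" "L \<subseteq> U" "\<And>x. x \<notin> L \<Longrightarrow> \<psi> x = 0"
proof -
  have "\<forall>x\<in>K. \<exists>r>0. cball x r \<subseteq> U"
    using U open_contains_cball by blast
  then obtain r where r: "\<And>x. x \<in> K \<Longrightarrow> r x > 0" "\<And>x. x \<in> K \<Longrightarrow> cball x (r x) \<subseteq> U"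
    by metis
  have "K \<subseteq> (\<Union>x\<in>K. ball x (r x))" using r(1) by auto
  then obtain C where C: "C \<subseteq> K" "finite C" "K \<subseteq> (\<Union>x\<in>C. ball x (r x))"
    using compactE_image[OF K, of K "\<lambda>x. ball x (r x)"] by auto
  define \<Phi> where "\<Phi> x = (1 / (real (card C) + 1)) * (\<Sum>y\<in>C. bump y (r y) x)" for x
  have \<Phi>0: "0 \<le> \<Phi> x" for x unfolding \<Phi>_def by (intro mult_nonneg_nonneg sum_nonneg bump_bounds) auto
  have \<Phi>1: "\<Phi> x \<le> 1" for x
  proof -
    have "(\<Sum>y\<in>C. bump y (r y) x) \<le> (\<Sum>y\<in>C. 1)" by (intro sum_mono bump_bounds)
    also have "\<dots> \<le> real (card C) + 1" by simp
    finally show ?thesis by (simp add: \<Phi>_def divide_simps)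
  qed
  have sm: "smooth (\<lambda>x. complex_of_real (\<Phi> x))"
    unfolding \<Phi>_def of_real_mult of_real_sum by (intro smooth_mult smooth_sum smooth_bump smooth_const)
  have pos: "\<Phi> x > 0" if x: "x \<in> K" for x
  proof -
    obtain y where y: "y \<in> C" "x \<in> ball y (r y)" using C(3) x by auto
    have "0 < bump y (r y) x" using bump_pos y r(1) C(1) by blast
    also have "\<dots> \<le> (\<Sum>y\<in>C. bump y (r y) x)"
      using y C(2) by (intro member_le_sum bump_bounds) auto
    finally show ?thesis by (simp add: \<Phi>_def)
  qed
  have cont: "continuous_on K \<Phi>"
    using continuous_on_Re[OF smooth_continuous_on[OF sm, of K]] by simp
  obtain m where m: "0 < m" "\<And>x. x \<in> K \<Longrightarrow> m \<le> \<Phi> x"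
  proof (cases "K = {}")
    case True
    then show ?thesis using that[of 1] by simp
  next
    case False
    then obtain x where "x \<in> K" "\<And>y. y \<in> K \<Longrightarrow> \<Phi> x \<le> \<Phi> y"
      using continuous_attains_inf[OF K _ cont] by blast
    then show ?thesis using that[of "\<Phi> x"] pos by blast
  qed
  have "\<bar>1 - min m 1\<bar> < 1" using m(1) by auto
  then have "(\<lambda>n. (1 - min m 1) ^ n) \<longlonglongrightarrow> 0" using LIMSEQ_abs_realpow_zero2 by blast
  then obtain n where n: "(1 - min m 1) ^ n \<le> \<epsilon>"
    using order_tendstoD(2)[OF _ \<epsilon>] eventually_happens' sequentially_bot less_imp_le
    by (metis (no_types, lifting) trivial_limit_sequentially)
  let ?\<psi> = "\<lambda>x. 1 - (1 - \<Phi> x) ^ n"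
  let ?L = "\<Union>y\<in>C. cball y (r y)"
  show ?thesis
  proof (rule that[of ?\<psi> ?L])
    show "smooth (\<lambda>x. complex_of_real (1 - (1 - \<Phi> x) ^ n))"
      unfolding of_real_diff of_real_power by (intro smooth_diff smooth_power smooth_const sm)
    show "0 \<le> ?\<psi> x" for x using power_le_one[of "1 - \<Phi> x" n] \<Phi>0[of x] \<Phi>1[of x] by simp
    show "?\<psi> x \<le> 1" for x using zero_le_power[of "1 - \<Phi> x" n] \<Phi>1[of x] by simp
    show "1 - ?\<psi> x \<le> \<epsilon>" if "x \<in> K" for x
      using power_mono[of "1 - \<Phi> x" "1 - min m 1" n] m(2)[OF that] \<Phi>1[of x] n by simp
    show "compact ?L" using C(2) by (intro compact_UN) auto
    show "?L \<subseteq> U" using r(2) C(1) by blast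
    show "?\<psi> x = 0" if "x \<notin> ?L" for x
    proof -
      have "(\<Sum>y\<in>C. bump y (r y) x) = 0"
        using that C(1) r(1) by (intro sum.neutral) (auto intro!: bump_zero)
      then show ?thesis by (simp add: \<Phi>_def)
    qed
  qed
qed

lemma test_functionI:
  assumes "smooth \<phi>" "compact K" "K \<subseteq> S" "\<And>x. x \<notin> K \<Longrightarrow> \<phi> x = 0"
  shows "test_function S \<phi>"
proof -
  have sub: "closure {x. \<phi> x \<noteq> 0} \<subseteq> K"
    using assms(2,4) by (intro closure_minimal compact_imp_closed) auto
  have "compact (K \<inter> closure {x. \<phi> x \<noteq> 0})"
    by (rule compact_Int_closed[OF assms(2) closed_closure])
  then have "compact (closure {x. \<phi> x \<noteq> 0})" using sub by (simp add: Int_absorb1)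
  then show ?thesis unfolding test_function_def
    using assms(1,3) sub by simp
qed

lemma test_function_smooth: "test_function S \<phi> \<Longrightarrow> smooth \<phi>"
  by (simp add: test_function_def)

lemma test_function_support:
  assumes "test_function S \<phi>"
  shows "\<exists>K. compact K \<and> K \<subseteq> S \<and> (\<forall>x. x \<notin> K \<longrightarrow> \<phi> x = 0)"
  by (rule exI[of _ "closure {x. \<phi> x \<noteq> 0}"])
     (use assms closure_subset[of "{x. \<phi> x \<noteq> 0}"] in \<open>auto simp: test_function_def\<close>)

lemma test_function_add:
  assumes "test_function S f" "test_function S g"
  shows "test_function S (\<lambda>x. f x + g x)"
proof -
  obtain K L where "compact K" "K \<subseteq> S" "\<forall>x. x \<notin> K \<longrightarrow> f x = 0"
    and "compact L" "L \<subseteq> S" "\<forall>x. x \<notin> L \<longrightarrow> g x = 0"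
    using assms[THEN test_function_support] by auto
  then show ?thesis
    using assms[THEN test_function_smooth] by (intro test_functionI[of _ "K \<union> L"]) auto
qed

lemma test_function_mult:
  assumes "smooth f" "test_function S g"
  shows "test_function S (\<lambda>x. f x * g x)"
proof -
  obtain L where "compact L" "L \<subseteq> S" "\<forall>x. x \<notin> L \<longrightarrow> g x = 0"
    using test_function_support[OF assms(2)] by auto
  then show ?thesis
    using assms(1) test_function_smooth[OF assms(2)] by (intro test_functionI[of _ L]) auto
qed

lemma smooth_square_integrable:
  "open S \<Longrightarrow> bounded S \<Longrightarrow> smooth f \<Longrightarrow> square_integrable S f"
  by (rule square_integrable_continuous) (auto intro: smooth_continuous_on)

definition test_approximable :: "(real^2) set \<Rightarrow> (real^2 \<Rightarrow> complex) \<Rightarrow> bool" where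
  "test_approximable S f \<longleftrightarrow> square_integrable S f \<and>
     (\<forall>\<epsilon>>0. \<exists>\<psi>. test_function S \<psi> \<and> mass S (\<lambda>x. f x - \<psi> x) < \<epsilon>)"

context
  fixes S :: "(real^2) set"
  assumes S: "open S" "bounded S"
begin

lemma test_function_square_integrable: "test_function S \<psi> \<Longrightarrow> square_integrable S \<psi>"
  using S by (auto simp: test_function_def intro: smooth_square_integrable)

lemma test_approximable_add:
  assumes f: "test_approximable S f" and g: "test_approximable S g"
  shows "test_approximable S (\<lambda>x. f x + g x)"
  unfolding test_approximable_def
proof (intro conjI allI impI)
  show "square_integrable S (\<lambda>x. f x + g x)"
    using f g by (auto simp: test_approximable_def intro: square_integrable_add)
  fix \<epsilon> :: real assume "\<epsilon> > 0"
  then have e: "\<epsilon> / 4 > 0" by simp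
  obtain \<phi> \<psi> where \<phi>: "test_function S \<phi>" "mass S (\<lambda>x. f x - \<phi> x) < \<epsilon> / 4"
    and \<psi>: "test_function S \<psi>" "mass S (\<lambda>x. g x - \<psi> x) < \<epsilon> / 4"
    using f g e unfolding test_approximable_def by meson
  have "mass S (\<lambda>x. (f x - \<phi> x) + (g x - \<psi> x)) \<le> 2 * mass S (\<lambda>x. f x - \<phi> x) + 2 * mass S (\<lambda>x. g x - \<psi> x)"
    using f g test_function_square_integrable[OF \<phi>(1)] test_function_square_integrable[OF \<psi>(1)]
    by (intro square_integrable_add square_integrable_diff) (auto simp: test_approximable_def)
  also have "\<dots> < \<epsilon>" using \<phi> \<psi> by simp
  also have "(\<lambda>x. (f x - \<phi> x) + (g x - \<psi> x)) = (\<lambda>x. f x + g x - (\<phi> x + \<psi> x))" by auto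
  finally show "\<exists>\<psi>. test_function S \<psi> \<and> mass S (\<lambda>x. f x + g x - \<psi> x) < \<epsilon>"
    using test_function_add \<phi> \<psi> by blast
qed

lemma test_approximable_cmult:
  assumes f: "test_approximable S f"
  shows "test_approximable S (\<lambda>x. c * f x)"
  unfolding test_approximable_def
proof (intro conjI allI impI)
  show "square_integrable S (\<lambda>x. c * f x)"
    using f by (auto simp: test_approximable_def intro: square_integrable_cmult)
  fix \<epsilon> :: real assume "\<epsilon> > 0"
  then have e: "\<epsilon> / ((cmod c)\<^sup>2 + 1) > 0" by (simp add: add_nonneg_pos)
  obtain \<phi> where \<phi>: "test_function S \<phi>" "mass S (\<lambda>x. f x - \<phi> x) < \<epsilon> / ((cmod c)\<^sup>2 + 1)"
    using f e unfolding test_approximable_def by meson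
  have "mass S (\<lambda>x. c * f x - c * \<phi> x) = (cmod c)\<^sup>2 * mass S (\<lambda>x. f x - \<phi> x)"
    by (simp flip: right_diff_distrib add: norm_mult power_mult_distrib)
  also have "\<dots> \<le> ((cmod c)\<^sup>2 + 1) * mass S (\<lambda>x. f x - \<phi> x)"
    by (intro mult_right_mono) auto
  also have "\<dots> < \<epsilon>" using \<phi>(2) by (simp add: less_divide_eq mult.commute add_nonneg_pos)
  finally show "\<exists>\<psi>. test_function S \<psi> \<and> mass S (\<lambda>x. c * f x - \<psi> x) < \<epsilon>"
    using test_function_mult[OF smooth_const \<phi>(1)] by blast
qed

text \<open>Lebesgue measure is inner and outer regular: the set lies between a compact and an open set whose
  difference has small measure, and a smooth Urysohn function of this pair approximates the indicator.\<close>

lemma test_approximable_indicator: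
  assumes A: "A \<in> sets lebesgue" "A \<subseteq> S"
  shows "test_approximable S (\<lambda>x. complex_of_real (indicator A x))"
proof -
  have Sm: "S \<in> lmeasurable" by (rule finite_measure_bounded_open[OF S])
  have one: "square_integrable S (\<lambda>x. 1)" by (intro smooth_square_integrable S smooth_const)
  have si: "square_integrable S (\<lambda>x. complex_of_real (indicator A x))"
  proof (rule square_integrable_dominated(1)[OF one, of _ 1])
    show "(\<lambda>x. complex_of_real (indicator A x)) \<in> borel_measurable (lebesgue_on S)"
      by (rule measurable_restrict_space1[OF measurable_compose[OF borel_measurable_indicator[OF A(1)] borel_measurable_of_real]])
  qed (simp add: indicator_def)
  have "\<exists>\<psi>. test_function S \<psi> \<and> mass S (\<lambda>x. complex_of_real (indicator A x) - \<psi> x) < \<epsilon>"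
    if \<epsilon>: "\<epsilon> > 0" for \<epsilon> :: real
  proof -
    have e3: "\<epsilon> / 3 > 0" using \<epsilon> by simp
    obtain K where K: "closed K" "K \<subseteq> A" "A - K \<in> lmeasurable" "emeasure lebesgue (A - K) < ennreal (\<epsilon> / 3)"
      using sets_lebesgue_inner_closed[OF A(1) e3] .
    obtain T where T: "open T" "A \<subseteq> T" "T - A \<in> lmeasurable" "emeasure lebesgue (T - A) < ennreal (\<epsilon> / 3)"
      using sets_lebesgue_outer_open[OF A(1) e3] .
    have mK: "measure lebesgue (A - K) < \<epsilon> / 3" and mT: "measure lebesgue (T - A) < \<epsilon> / 3"
      using K(4) T(4) unfolding emeasure_eq_measure2[OF K(3)] emeasure_eq_measure2[OF T(3)]
      by (simp_all only: ennreal_less_iff measure_nonneg)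
    have cK: "compact K" using K A S by (meson bounded_subset compact_eq_bounded_closed)
    define m where "m = measure lebesgue S"
    have m0: "m \<ge> 0" by (simp add: m_def)
    \<comment> \<open>The error on \<open>K\<close> contributes at most \<open>\<delta>\<^sup>2\<close> times the measure of \<open>S\<close>.\<close>
    define \<delta> where "\<delta> = min 1 (\<epsilon> / (3 * (m + 1)))"
    have \<delta>: "\<delta> > 0" "\<delta> \<le> 1" using \<epsilon> m0 by (auto simp: \<delta>_def)
    have dm: "\<delta>\<^sup>2 * m \<le> \<epsilon> / 3"
    proof -
      have "\<delta>\<^sup>2 * m \<le> \<delta> * (m + 1)"
        using \<delta> m0 by (intro mult_mono) (auto simp: power2_eq_square mult_left_le_one_le)
      also have "\<dots> \<le> \<epsilon> / 3 / (m + 1) * (m + 1)"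
        using m0 by (intro mult_right_mono) (auto simp: \<delta>_def)
      also have "\<dots> = \<epsilon> / 3"
      proof -
        have n: "m + 1 \<noteq> 0" using m0 by simp
        show ?thesis
          by (rule trans[OF times_divide_eq_left nonzero_mult_div_cancel_right[OF n]])
      qed
      finally show ?thesis .
    qed
    obtain \<psi> L where \<psi>: "smooth (\<lambda>x. complex_of_real (\<psi> x))" "\<And>x. 0 \<le> \<psi> x" "\<And>x. \<psi> x \<le> 1"
      "\<And>x. x \<in> K \<Longrightarrow> 1 - \<psi> x \<le> \<delta>" "compact L" "L \<subseteq> T \<inter> S" "\<And>x. x \<notin> L \<Longrightarrow> \<psi> x = 0"
      by (rule smooth_urysohn[OF cK, of "T \<inter> S" \<delta>]) (use T S K A \<delta> in auto)
    have tf: "test_function S (\<lambda>x. complex_of_real (\<psi> x))"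
      using \<psi> by (intro test_functionI[of _ L]) auto
    let ?E = "(A - K) \<union> (T - A)"
    have E: "?E \<in> lmeasurable" using K T by blast
    have "measure lebesgue ?E \<le> measure lebesgue (A - K) + measure lebesgue (T - A)"
      using K T by (intro measure_Un_le) auto
    then have mE: "measure lebesgue ?E < 2 * \<epsilon> / 3" using mK mT by simp
    have iE: "integrable (lebesgue_on S) (\<lambda>x. indicator ?E x :: real)"
    proof (rule Bochner_Integration.integrable_bound)
      show "integrable (lebesgue_on S) (\<lambda>x. 1 :: real)"
        by (rule finite_measure.integrable_const[OF finite_measure_lebesgue_on[OF Sm]])
      show "(\<lambda>x. indicator ?E x :: real) \<in> borel_measurable (lebesgue_on S)"
        by (rule measurable_restrict_space1[OF borel_measurable_indicator[OF fmeasurableD[OF E]]])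
    qed (simp add: indicator_def)
    have i1: "integrable (lebesgue_on S) (\<lambda>x. \<delta>\<^sup>2 :: real)"
      by (rule finite_measure.integrable_const[OF finite_measure_lebesgue_on[OF Sm]])
    have "mass S (\<lambda>x. complex_of_real (indicator A x) - complex_of_real (\<psi> x)) \<le>
        (LINT x|lebesgue_on S. indicator ?E x + \<delta>\<^sup>2)"
    proof (rule integral_mono)
      show "integrable (lebesgue_on S) (\<lambda>x. (cmod (complex_of_real (indicator A x) - complex_of_real (\<psi> x)))\<^sup>2)"
        by (intro square_integrableD square_integrable_diff si test_function_square_integrable[OF tf])
      fix x
      have "(indicator A x - \<psi> x)\<^sup>2 \<le> indicator ?E x + \<delta>\<^sup>2"
      proof (cases "x \<in> K")
        case True
        then have "(1 - \<psi> x)\<^sup>2 \<le> \<delta>\<^sup>2" using \<psi>(3,4)[of x] by (intro power_mono) auto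
        then show ?thesis using True K(2) by (auto simp: indicator_def)
      next
        case False
        show ?thesis
        proof (cases "x \<in> ?E")
          case True
          have "\<bar>indicator A x - \<psi> x\<bar> \<le> 1" using \<psi>(2,3)[of x] by (auto simp: indicator_def)
          then have "(indicator A x - \<psi> x)\<^sup>2 \<le> 1" by (simp add: abs_square_le_1)
          moreover have "indicator ?E x = (1::real)" using True by (rule indicator_simps)
          ultimately show ?thesis using zero_le_power2[of \<delta>] by linarith
        next
          case nE: False
          then have "x \<notin> A" "x \<notin> L" using False T \<psi>(6) by auto
          then show ?thesis using \<psi>(7) by simp
        qed
      qed
      then show "(cmod (complex_of_real (indicator A x) - complex_of_real (\<psi> x)))\<^sup>2 \<le> indicator ?E x + \<delta>\<^sup>2"
        by (simp flip: of_real_diff)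
    qed (intro Bochner_Integration.integrable_add iE i1)
    also have "\<dots> = (LINT x|lebesgue_on S. indicator ?E x) + \<delta>\<^sup>2 * m"
      using iE i1 by (simp add: m_def measure_restrict_space fmeasurableD[OF Sm])
    also have "(LINT x|lebesgue_on S. indicator ?E x :: real) = measure lebesgue (S \<inter> ?E)"
      using Sm E by (subst integral_restrict_space)
        (auto simp: indicator_inter_arith[symmetric] fmeasurableD)
    also have "\<dots> \<le> measure lebesgue ?E"
      using E Sm by (intro measure_mono_fmeasurable) (auto simp: fmeasurableD)
    finally have "mass S (\<lambda>x. complex_of_real (indicator A x) - complex_of_real (\<psi> x)) < \<epsilon>"
      using mE dm by simp
    then show ?thesis using tf by blast
  qed
  then show ?thesis using si by (simp add: test_approximable_def)
qed

text \<open>Simple functions are dominated by a multiple of \<open>f\<close> and converge to it pointwise, hence in mean square;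
  they are finite combinations of indicators.\<close>

lemma test_functions_dense:
  assumes f: "square_integrable S f" and \<epsilon>: "\<epsilon> > 0"
  obtains \<psi> where "test_function S \<psi>" "mass S (\<lambda>x. f x - \<psi> x) < \<epsilon>"
proof -
  have Sm: "S \<in> lmeasurable" by (rule finite_measure_bounded_open[OF S])
  obtain F where F': "\<forall>i. simple_function (lebesgue_on S) (F i)"
    "\<forall>x\<in>S. (\<lambda>i. F i x) \<longlonglongrightarrow> f x" "\<forall>i. \<forall>x\<in>S. cmod (F i x) \<le> 2 * cmod (f x)"
    using borel_measurable_implies_sequence_metric[OF square_integrableD(1)[OF f], of 0] by auto
  note F = F'(1)[rule_format] F'(2)[rule_format] F'(3)[rule_format]
  have mF: "F i \<in> borel_measurable (lebesgue_on S)" for i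
    using F(1) by (rule borel_measurable_simple_function)
  have sF: "square_integrable S (F i)" for i
    by (rule square_integrable_dominated(1)[OF f mF F(3)])
  have appr: "test_approximable S (F i)" for i
  proof -
    let ?A = "\<lambda>y. F i -` {y} \<inter> S"
    have fin: "finite (F i ` S)" using simple_functionD(1)[OF F(1), of i] by simp
    have "test_approximable S (\<lambda>x. \<Sum>y\<in>Y. y * complex_of_real (indicator (?A y) x))" if "finite Y" for Y
      using that
    proof (induction Y)
      case empty
      have "test_function S (\<lambda>x. 0)" by (rule test_functionI[of _ "{}"]) auto
      moreover have "mass S (\<lambda>x. 0 - 0) = 0" by simp
      ultimately show ?case
        unfolding test_approximable_def sum.empty
        by (intro conjI allI impI square_integrable_zero exI[of _ "\<lambda>x. 0"]) simp_all
    next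
      case (insert y Y)
      have "?A y \<in> sets (lebesgue_on S)" using simple_functionD(2)[OF F(1), of i "{y}"] by simp
      then have "?A y \<in> sets lebesgue" using Sm by (auto simp: sets_restrict_space_iff)
      then have "test_approximable S (\<lambda>x. y * complex_of_real (indicator (?A y) x))"
        by (intro test_approximable_cmult test_approximable_indicator) auto
      from test_approximable_add[OF this insert.IH] show ?case
        by (simp only: sum.insert[OF insert.hyps])
    qed
    from this[OF fin] have g: "test_approximable S (\<lambda>x. \<Sum>y\<in>F i ` S. y * complex_of_real (indicator (?A y) x))" .
    have eq: "(\<Sum>y\<in>F i ` S. y * complex_of_real (indicator (?A y) x)) = F i x" if x: "x \<in> S" for x
    proof -
      have "x \<in> space (lebesgue_on S)" using x by simp
      from simple_function_indicator_representation_banach[OF F(1) this, of i]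
      have "F i x = (\<Sum>y\<in>F i ` S. indicator (?A y) x *\<^sub>R y)"
        by (simp only: space_lebesgue_on)
      also have "\<dots> = (\<Sum>y\<in>F i ` S. y * complex_of_real (indicator (?A y) x))"
        by (simp only: scaleR_conv_of_real mult.commute)
      finally show ?thesis ..
    qed
    have "mass S (\<lambda>x. F i x - \<psi> x) = mass S (\<lambda>x. (\<Sum>y\<in>F i ` S. y * complex_of_real (indicator (?A y) x)) - \<psi> x)" for \<psi>
      using eq by (intro Bochner_Integration.integral_cong) auto
    then show ?thesis using g sF by (auto simp: test_approximable_def)
  qed
  have "(\<lambda>i. mass S (\<lambda>x. f x - F i x)) \<longlonglongrightarrow> (LINT x|lebesgue_on S. (0::real))"
  proof (rule integral_dominated_convergence[where w = "\<lambda>x. 9 * (cmod (f x))\<^sup>2"])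
    show "integrable (lebesgue_on S) (\<lambda>x. 9 * (cmod (f x))\<^sup>2)" using square_integrableD(2)[OF f] by simp
    show "AE x in lebesgue_on S. (\<lambda>i. (cmod (f x - F i x))\<^sup>2) \<longlonglongrightarrow> 0"
    proof (rule AE_I2)
      fix x assume "x \<in> space (lebesgue_on S)"
      then have "(\<lambda>i. (cmod (f x - F i x))\<^sup>2) \<longlonglongrightarrow> (cmod (f x - f x))\<^sup>2"
        using F(2) by (intro tendsto_intros) auto
      then show "(\<lambda>i. (cmod (f x - F i x))\<^sup>2) \<longlonglongrightarrow> 0" by simp
    qed
    show "AE x in lebesgue_on S. norm ((cmod (f x - F i x))\<^sup>2) \<le> 9 * (cmod (f x))\<^sup>2" for i
    proof (rule AE_I2)
      fix x assume "x \<in> space (lebesgue_on S)"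
      then have "cmod (f x - F i x) \<le> 3 * cmod (f x)"
        using norm_triangle_ineq4[of "f x" "F i x"] F(3)[of x i] by simp
      then have "(cmod (f x - F i x))\<^sup>2 \<le> (3 * cmod (f x))\<^sup>2" by (intro power_mono) auto
      then show "norm ((cmod (f x - F i x))\<^sup>2) \<le> 9 * (cmod (f x))\<^sup>2" by (simp add: power_mult_distrib)
    qed
  qed (use square_integrableD(1)[OF f] mF in auto)
  then have "(\<lambda>i. mass S (\<lambda>x. f x - F i x)) \<longlonglongrightarrow> 0" by simp
  then have "\<forall>\<^sub>F i in sequentially. mass S (\<lambda>x. f x - F i x) < \<epsilon> / 4"
    using \<epsilon> by (intro order_tendstoD) auto
  then obtain i where i: "mass S (\<lambda>x. f x - F i x) < \<epsilon> / 4"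
    by (auto simp: eventually_sequentially)
  obtain \<psi> where \<psi>: "test_function S \<psi>" "mass S (\<lambda>x. F i x - \<psi> x) < \<epsilon> / 4"
    using appr[of i] \<epsilon> unfolding test_approximable_def by (meson divide_pos_pos zero_less_numeral)
  have "mass S (\<lambda>x. (f x - F i x) + (F i x - \<psi> x)) \<le> 2 * mass S (\<lambda>x. f x - F i x) + 2 * mass S (\<lambda>x. F i x - \<psi> x)"
    by (intro square_integrable_add square_integrable_diff f sF test_function_square_integrable[OF \<psi>(1)])
  also have "\<dots> < \<epsilon>" using i \<psi>(2) by simp
  finally show ?thesis using that[OF \<psi>(1)] by simp
qed

end

section \<open>Difference quotients along dilations\<close>

text \<open>Differentiation under the integral sign: the mean value theorem bounds the difference quotients by the
  dominating function.\<close>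

lemma DERIV_integral:
  fixes k :: "real \<Rightarrow> 'a \<Rightarrow> real"
  assumes int: "\<And>s. a < s \<Longrightarrow> integrable M (k s)"
    and der: "\<And>s y. a < s \<Longrightarrow> y \<in> space M \<Longrightarrow> ((\<lambda>s. k s y) has_real_derivative k' s y) (at s)"
    and bd: "\<And>s y. a < s \<Longrightarrow> y \<in> space M \<Longrightarrow> \<bar>k' s y\<bar> \<le> w y"
    and w: "integrable M w" and m: "k' s0 \<in> borel_measurable M" and s0: "a < s0"
  shows "((\<lambda>s. integral\<^sup>L M (k s)) has_real_derivative integral\<^sup>L M (k' s0)) (at s0)"
proof -
  have "((\<lambda>s. (integral\<^sup>L M (k s) - integral\<^sup>L M (k s0)) / (s - s0)) \<longlongrightarrow> integral\<^sup>L M (k' s0))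
      (at s0 within {a<..})"
    unfolding tendsto_at_iff_sequentially
  proof (intro allI impI)
    fix X assume X: "\<forall>i. X i \<in> {a<..} - {s0}" "X \<longlonglongrightarrow> s0"
    let ?q = "\<lambda>i y. (k (X i) y - k s0 y) / (X i - s0)"
    have "(\<lambda>i. integral\<^sup>L M (?q i)) \<longlonglongrightarrow> integral\<^sup>L M (k' s0)"
    proof (rule integral_dominated_convergence[where w = w])
      show "?q i \<in> borel_measurable M" for i
        using int[of "X i"] int[OF s0] X(1) by (auto intro!: borel_measurable_divide borel_measurable_diff)
      show "AE y in M. (\<lambda>i. ?q i y) \<longlonglongrightarrow> k' s0 y"
      proof (rule AE_I2)
        fix y assume y: "y \<in> space M"
        have "((\<lambda>s. (k s y - k s0 y) / (s - s0)) \<longlongrightarrow> k' s0 y) (at s0)"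
          using der[OF s0 y] by (simp only: has_field_derivative_iff)
        then show "(\<lambda>i. ?q i y) \<longlonglongrightarrow> k' s0 y"
          unfolding tendsto_at_iff_sequentially comp_def using X by auto
      qed
      show "AE y in M. norm (?q i y) \<le> w y" for i
      proof (rule AE_I2)
        fix y assume y: "y \<in> space M"
        have "norm (k (X i) y - k s0 y) \<le> w y * norm (X i - s0)"
        proof (rule field_differentiable_bound[of "{a<..}" "\<lambda>s. k s y" "\<lambda>s. k' s y"])
          show "((\<lambda>s. k s y) has_field_derivative k' s y) (at s within {a<..})" if "s \<in> {a<..}" for s
            using der[OF _ y, of s] that by (auto intro: has_field_derivative_at_within)
        qed (use X(1) s0 bd y in auto)
        then show "norm (?q i y) \<le> w y"
          using X(1) by (auto simp: divide_simps)
      qed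
    qed (use w m in auto)
    moreover have eq: "integral\<^sup>L M (?q i) = (integral\<^sup>L M (k (X i)) - integral\<^sup>L M (k s0)) / (X i - s0)" for i
    proof -
      have "integrable M (k (X i))" using int X(1) by auto
      then show ?thesis
        by (simp only: integral_divide_zero Bochner_Integration.integral_diff[OF _ int[OF s0]])
    qed
    ultimately show "((\<lambda>s. (integral\<^sup>L M (k s) - integral\<^sup>L M (k s0)) / (s - s0)) \<circ> X) \<longlonglongrightarrow> integral\<^sup>L M (k' s0)"
      unfolding eq comp_def by blast
  qed
  moreover have "at s0 within {a<..} = at s0"
    using s0 by (intro at_within_open) auto
  ultimately show ?thesis by (simp only: has_field_derivative_iff)
qed

lemma derivative_eq_pd:
  assumes "f differentiable (at z)"
  shows "frechet_derivative f (at z) v = (\<Sum>i\<in>UNIV. of_real (v $ i) * pd i f z)"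
proof -
  have lin: "linear (frechet_derivative f (at z))"
    using has_derivative_linear[OF has_derivative_frechet[OF assms]] .
  have "v = (\<Sum>i\<in>UNIV. (v $ i) *\<^sub>R axis i 1)"
    using basis_expansion[of v] by (simp add: scalar_mult_eq_scaleR)
  then have "frechet_derivative f (at z) v = frechet_derivative f (at z) (\<Sum>i\<in>UNIV. (v $ i) *\<^sub>R axis i 1)"
    by simp
  also have "\<dots> = (\<Sum>i\<in>UNIV. of_real (v $ i) * pd i f z)"
    by (simp add: linear_sum[OF lin] linear_scale[OF lin] pd_def flip: scaleR_conv_of_real)
  finally show ?thesis .
qed

definition offset :: "real^2 \<Rightarrow> 2 \<Rightarrow> real^2 \<Rightarrow> complex" where
  "offset p i x = of_real (x $ i) - of_real (p $ i)"

lemma smooth_offset: "smooth (offset p i)"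
  unfolding offset_def [abs_def] by (intro smooth_diff smooth_coord smooth_const)

lemma pd_offset: "pd j (offset p i) x = (if j = i then 1 else 0)"
proof -
  have "pd j (\<lambda>x. complex_of_real (x $ i) + (- of_real (p $ i))) x = (if j = i then 1 else 0)"
    by (subst pd_add) (auto simp: pd_coord pd_const intro: smooth_differentiable)
  then show ?thesis by (simp add: offset_def [abs_def])
qed

text \<open>The functions \<open>y \<mapsto> (1 / s\<^sup>2) \<psi>(dil p (1 / s) y)\<close> keep their integral as \<open>s\<close> varies, so their derivative in
  \<open>s\<close> is a divergence. In this form it can be moved onto a weakly differentiable function.\<close>

lemma DERIV_dilated:
  assumes \<psi>: "smooth \<psi>" and s: "s > 0"
  shows "((\<lambda>s. of_real (1 / s\<^sup>2) * \<psi> (dil p (1 / s) y)) has_vector_derivative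
      - of_real (1 / s\<^sup>2) * (\<Sum>i\<in>UNIV. pd i (\<lambda>y. offset p i (dil p (1 / s) y) * \<psi> (dil p (1 / s) y)) y)) (at s)"
proof -
  define z where "z = dil p (1 / s) y"
  have d\<psi>: "(\<psi> has_derivative frechet_derivative \<psi> (at z)) (at z)"
    by (rule has_derivative_frechet[OF smooth_differentiable[OF \<psi>]])
  have inv: "((\<lambda>s. 1 / s) has_real_derivative - (1 / s\<^sup>2)) (at s)"
    using DERIV_inverse[of s] s by (simp add: inverse_eq_divide power2_eq_square)
  have inv2: "((\<lambda>s. 1 / s\<^sup>2) has_real_derivative - (2 / s ^ 3)) (at s)"
    using s by (auto intro!: derivative_eq_intros simp: power2_eq_square power3_eq_cube field_simps)
  have "((\<lambda>s. dil p (1 / s) y) has_vector_derivative (- (1 / s\<^sup>2)) *\<^sub>R (y - p)) (at s)"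
    unfolding dil_def using has_vector_derivative_scaleR[OF inv has_vector_derivative_const[of "y - p"]]
      has_vector_derivative_add[OF has_vector_derivative_const[of p]] by fastforce
  then have dz: "((\<lambda>s. dil p (1 / s) y) has_vector_derivative (- (1 / s)) *\<^sub>R (z - p)) (at s)"
    by (simp add: z_def dil_def power2_eq_square)
  have "((\<lambda>s. \<psi> (dil p (1 / s) y)) has_derivative
      (\<lambda>h. frechet_derivative \<psi> (at z) (h *\<^sub>R ((- (1 / s)) *\<^sub>R (z - p))))) (at s)"
    using has_derivative_compose[OF dz[unfolded has_vector_derivative_def]] d\<psi> unfolding z_def by blast
  then have d: "((\<lambda>s. \<psi> (dil p (1 / s) y)) has_vector_derivative
      frechet_derivative \<psi> (at z) ((- (1 / s)) *\<^sub>R (z - p))) (at s)"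
    unfolding has_vector_derivative_def
    by (simp only: linear_scale[OF has_derivative_linear[OF d\<psi>]])
  have "frechet_derivative \<psi> (at z) ((- (1 / s)) *\<^sub>R (z - p)) = - (1 / s) *\<^sub>R (\<Sum>i\<in>UNIV. offset p i z * pd i \<psi> z)"
    unfolding linear_scale[OF has_derivative_linear[OF d\<psi>]]
    unfolding derivative_eq_pd[OF smooth_differentiable[OF \<psi>]] by (simp add: offset_def)
  from has_vector_derivative_scaleR[OF inv2 d[unfolded this]]
  have D: "((\<lambda>s. (1 / s\<^sup>2) *\<^sub>R \<psi> (dil p (1 / s) y)) has_vector_derivative
     (1 / s\<^sup>2) *\<^sub>R (- (1 / s) *\<^sub>R (\<Sum>i\<in>UNIV. offset p i z * pd i \<psi> z)) + (- (2 / s ^ 3)) *\<^sub>R \<psi> z) (at s)"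
    unfolding z_def .
  have pdi: "pd i (\<lambda>y. offset p i (dil p (1 / s) y) * \<psi> (dil p (1 / s) y)) y =
      of_real (1 / s) * (offset p i z * pd i \<psi> z + \<psi> z)" for i
  proof -
    have "pd i (\<lambda>y. offset p i (dil p (1 / s) y) * \<psi> (dil p (1 / s) y)) y =
        of_real (1 / s) * pd i (\<lambda>y. offset p i y * \<psi> y) z"
      unfolding z_def by (rule pd_dil) (intro differentiable_mult smooth_differentiable smooth_offset \<psi>)
    also have "pd i (\<lambda>y. offset p i y * \<psi> y) z = offset p i z * pd i \<psi> z + \<psi> z"
      by (subst pd_mult) (auto intro: smooth_differentiable smooth_offset \<psi> simp: pd_offset)
    finally show ?thesis .
  qed
  have "- of_real (1 / s\<^sup>2) * (\<Sum>i\<in>UNIV. pd i (\<lambda>y. offset p i (dil p (1 / s) y) * \<psi> (dil p (1 / s) y)) y) =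
      (1 / s\<^sup>2) *\<^sub>R (- (1 / s) *\<^sub>R (\<Sum>i\<in>UNIV. offset p i z * pd i \<psi> z)) + (- (2 / s ^ 3)) *\<^sub>R \<psi> z"
    unfolding pdi using s
    by (simp add: UNIV_2 scaleR_conv_of_real field_simps power2_eq_square power3_eq_cube)
  with D show ?thesis by (simp add: scaleR_conv_of_real)
qed

lemma bounded_compactly_supported:
  fixes f :: "real^2 \<Rightarrow> complex"
  assumes "continuous_on UNIV f" "compact K" "\<And>x. x \<notin> K \<Longrightarrow> f x = 0"
  obtains C where "0 \<le> C" "\<And>x. cmod (f x) \<le> C"
proof -
  have "bounded (f ` K)"
    using assms by (intro compact_imp_bounded compact_continuous_image) (auto intro: continuous_on_subset)
  then obtain C where C: "\<And>x. x \<in> K \<Longrightarrow> cmod (f x) \<le> C" unfolding bounded_iff by auto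
  show ?thesis
  proof (rule that[of "max C 0"])
    show "cmod (f x) \<le> max C 0" for x using C[of x] assms(3)[of x] by (cases "x \<in> K") auto
  qed simp
qed

lemma pd_zero_outside:
  assumes "closed K" "\<And>x. x \<notin> K \<Longrightarrow> f x = 0" "x \<notin> K"
  shows "pd i f x = 0"
proof -
  have "((\<lambda>x. 0) has_derivative (\<lambda>h. 0)) (at x)" by simp
  then have "(f has_derivative (\<lambda>h. 0)) (at x)"
    by (rule has_derivative_transform_within_open[of _ _ _ _ "- K"]) (use assms in auto)
  then show ?thesis by (rule pd_eq)
qed

lemma smooth_bounded_on:
  assumes "smooth f" "bounded S"
  obtains C where "0 \<le> C" "\<And>x. x \<in> S \<Longrightarrow> cmod (f x) \<le> C"
proof -
  have "compact (closure S)" using assms(2) by (simp add: compact_closure)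
  then have "bounded (f ` closure S)"
    by (intro compact_imp_bounded compact_continuous_image smooth_continuous_on[OF assms(1)])
  then obtain C where C: "\<And>x. x \<in> closure S \<Longrightarrow> cmod (f x) \<le> C" unfolding bounded_iff by auto
  show ?thesis
  proof (rule that[of "max C 0"])
    show "cmod (f x) \<le> max C 0" if "x \<in> S" for x
      using C[of x] that closure_subset[of S] by auto
  qed simp
qed

context conic_at
begin

text \<open>The values of \<open>v \<circ> \<delta>\<^sub>s\<close> outside the disc have no meaning for \<open>v\<close> on the domain; setting them to
  \<open>0\<close> makes the dilate square integrable.\<close>

definition cut :: "real \<Rightarrow> (real^2 \<Rightarrow> complex) \<Rightarrow> real^2 \<Rightarrow> complex" where
  "cut s v x = (if x \<in> ball p d then v (dil p s x) else 0)"

lemma square_integrable_cut: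
  assumes v: "square_integrable \<Omega> v" and s: "0 < s" "s \<le> 1"
  shows "square_integrable \<Omega> (cut s v)" "mass \<Omega> (cut s v) \<le> (1 / s\<^sup>2) * mass \<Omega> v"
proof -
  have z: "\<And>x. x \<notin> ball p d \<Longrightarrow> cut s v x = 0" "\<And>x. x \<notin> ball p d \<Longrightarrow> (cmod (cut s v x))\<^sup>2 = 0"
    by (simp_all add: cut_def)
  let ?w = "\<lambda>y. cut s v (dil p (1 / s) y)"
  have w: "?w = (\<lambda>y. if y \<in> dil p s ` ball p d then v y else 0)"
  proof
    fix y
    have "dil p (1 / s) y \<in> ball p d \<longleftrightarrow> y \<in> dil p s ` ball p d"
      using s dil_inverse by (metis (no_types, lifting) image_iff less_irrefl)
    then show "?w y = (if y \<in> dil p s ` ball p d then v y else 0)"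
      using s by (simp add: cut_def dil_inverse)
  qed
  have "open (dil p s ` ball p d)"
  proof -
    have "dil p s ` ball p d = (+) (p - s *\<^sub>R p) ` ((*\<^sub>R) s ` ball p d)"
      unfolding image_image by (rule image_cong) (auto simp: dil_def algebra_simps)
    then show ?thesis using s by (simp add: open_translation open_scaling)
  qed
  then have o: "dil p s ` ball p d \<in> sets (lebesgue_on UNIV)" by (simp add: borel_open sets_completionI_sets)
  have mw: "?w \<in> borel_measurable area"
    unfolding w using square_integrableD(1)[OF v] o
    by (intro measurable_If_set measurable_const) (auto simp: sets_restrict_space)
  have wle: "cmod (?w x) \<le> 1 * cmod (v x)" for x
    using s by (simp add: cut_def dil_inverse)
  have sw: "square_integrable \<Omega> ?w" and mass: "mass \<Omega> ?w \<le> 1\<^sup>2 * mass \<Omega> v"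
    using square_integrable_dominated[OF v mw wle] by blast+
  show "square_integrable \<Omega> (cut s v)"
    unfolding square_integrable_def
    using square_integrableD[OF sw] measurable_dil_iff[OF z(1) s] integrable_dil_iff[OF z(2) s] by simp
  show "mass \<Omega> (cut s v) \<le> (1 / s\<^sup>2) * mass \<Omega> v"
    using integral_dil_eq[OF z(2) s] mass s by (simp add: divide_right_mono)
qed

lemma test_function_dil:
  assumes \<psi>: "test_function (\<Omega> \<inter> ball p d) \<psi>" and s: "0 < s" "s \<le> 1"
  shows "test_function \<Omega> (\<lambda>y. \<psi> (dil p (1 / s) y))"
proof -
  obtain K where K: "compact K" "K \<subseteq> \<Omega> \<inter> ball p d" "\<forall>x. x \<notin> K \<longrightarrow> \<psi> x = 0"
    using test_function_support[OF \<psi>] by blast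
  show ?thesis
  proof (rule test_functionI[of _ "dil p s ` K"])
    show "smooth (\<lambda>y. \<psi> (dil p (1 / s) y))" by (rule smooth_dil[OF test_function_smooth[OF \<psi>]])
    have "continuous_on K (dil p s)" unfolding dil_def [abs_def] by (intro continuous_intros)
    then show "compact (dil p s ` K)" using K(1) by (rule compact_continuous_image)
    show "dil p s ` K \<subseteq> \<Omega>" using K(2) cone s by blast
    show "\<psi> (dil p (1 / s) y) = 0" if "y \<notin> dil p s ` K" for y
      using that K(3) s dil_inverse(1)[of s p y] by (metis image_eqI less_irrefl)
  qed
qed

lemma cut_mult_dil:
  assumes "\<And>x. x \<notin> ball p d \<Longrightarrow> \<psi> x = 0" "s \<noteq> 0"
  shows "cut s v (dil p (1 / s) y) * \<psi> (dil p (1 / s) y) = v y * \<psi> (dil p (1 / s) y)"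
  using assms by (auto simp: cut_def dil_inverse)

lemma integral_cut_mult:
  assumes "\<And>x. x \<notin> ball p d \<Longrightarrow> \<psi> x = 0" "0 < s" "s \<le> 1"
  shows "(LINT x|area. cut s v x * \<psi> x) =
    of_real (1 / s\<^sup>2) * (LINT y|area. v y * \<psi> (dil p (1 / s) y))"
proof -
  have e: "cut s v (dil p (1 / s) y) * \<psi> (dil p (1 / s) y) = v y * \<psi> (dil p (1 / s) y)" for y
    by (rule cut_mult_dil) (use assms in auto)
  have "(LINT x|area. cut s v x * \<psi> x) = (1 / s\<^sup>2) *\<^sub>R
      (LINT y|area. cut s v (dil p (1 / s) y) * \<psi> (dil p (1 / s) y))"
    by (rule integral_dil_eq) (use assms in auto)
  also have "\<dots> = of_real (1 / s\<^sup>2) * (LINT y|area. v y * \<psi> (dil p (1 / s) y))"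
    by (simp only: e scaleR_conv_of_real)
  finally show ?thesis .
qed

text \<open>The gradient at \<open>\<delta>\<^sub>s x\<close> paired with \<open>x - p\<close>; for smooth \<open>u\<close> it is the derivative of
  \<open>u(\<delta>\<^sub>s x)\<close> in \<open>s\<close>.\<close>

definition radial_deriv :: "(real^2 \<Rightarrow> complex^2) \<Rightarrow> real \<Rightarrow> real^2 \<Rightarrow> complex" where
  "radial_deriv G s x = (\<Sum>i\<in>UNIV. offset p i x * cut s (\<lambda>x. G x $ i) x)"

lemma smooth_mult_square_integrable:
  assumes f: "smooth f" and v: "square_integrable \<Omega> v"
  shows "square_integrable \<Omega> (\<lambda>x. f x * v x)"
proof -
  obtain C where C: "\<And>x. x \<in> \<Omega> \<Longrightarrow> cmod (f x) \<le> C"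
    using smooth_bounded_on[OF f bounded_dom] by blast
  have "f \<in> borel_measurable area"
    using square_integrableD(1)[OF smooth_square_integrable[OF open_dom bounded_dom f]] .
  then show ?thesis
    using C square_integrableD(1)[OF v]
    by (intro square_integrable_dominated(1)[OF v, of _ C])
       (auto simp: norm_mult intro!: mult_right_mono borel_measurable_times)
qed

lemma square_integrable_radial:
  assumes "H1 \<Omega> u G" "0 < s" "s \<le> 1"
  shows "square_integrable \<Omega> (radial_deriv G s)"
  unfolding radial_deriv_def [abs_def]
  by (intro square_integrable_sum smooth_mult_square_integrable smooth_offset square_integrable_cut assms(2,3))
     (use assms(1) in \<open>auto simp: H1_def\<close>)

text \<open>The function \<open>s \<mapsto> \<integral> u(\<delta>\<^sub>s x) \<psi>(x) dx\<close> is differentiable: after a change of variables the parameter sits in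
  the smooth factor, and the weak derivative brings it back to \<open>u\<close>. The mean value theorem on \<open>[c, 1]\<close>
  then compares the endpoints.\<close>

lemma difference_quotient_test:
  assumes H: "H1 \<Omega> u G" and \<psi>: "test_function (\<Omega> \<inter> ball p d) \<psi>" and c: "0 < c" "c < 1"
    and M: "\<And>s. c \<le> s \<Longrightarrow> s \<le> 1 \<Longrightarrow> Re (LINT x|area. radial_deriv G s x * \<psi> x) \<le> M"
  shows "Re (LINT x|area. (u x - cut c u x) * \<psi> x) \<le> (1 - c) * M"
proof -
  note sm = test_function_smooth[OF \<psi>]
  have u: "square_integrable \<Omega> u" and G: "\<And>i. square_integrable \<Omega> (\<lambda>x. G x $ i)"
    using H by (auto simp: H1_def)
  obtain K where K: "compact K" "K \<subseteq> \<Omega> \<inter> ball p d" "\<forall>x. x \<notin> K \<longrightarrow> \<psi> x = 0"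
    using test_function_support[OF \<psi>] by blast
  have \<psi>0: "\<psi> x = 0" if "x \<notin> ball p d" for x using K(2,3) that by blast
  define \<Psi> where "\<Psi> i z = offset p i z * \<psi> z" for i z
  have \<Psi>: "test_function (\<Omega> \<inter> ball p d) (\<Psi> i)" for i
    unfolding \<Psi>_def [abs_def] by (rule test_function_mult[OF smooth_offset \<psi>])
  have sm\<Psi>: "smooth (\<Psi> i)" for i by (rule test_function_smooth[OF \<Psi>])
  have \<Psi>0: "\<Psi> i x = 0" if "x \<notin> ball p d" for x i using \<psi>0[OF that] by (simp add: \<Psi>_def)
  have "\<exists>C\<ge>0. \<forall>x. cmod (pd i (\<Psi> i) x) \<le> C" for i
  proof -
    have z: "pd i (\<Psi> i) x = 0" if "x \<notin> K" for x
      by (rule pd_zero_outside[OF compact_imp_closed[OF K(1)] _ that]) (simp add: \<Psi>_def K(3))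
    show ?thesis
      by (rule bounded_compactly_supported[OF smooth_continuous_on[OF smooth_pd[OF sm\<Psi>]] K(1)])
         (use z in blast)+
  qed
  then obtain C where C: "\<And>i. C i \<ge> 0" "\<And>i x. cmod (pd i (\<Psi> i) x) \<le> C i" by metis
  define a where "a = c / 2"
  have a: "0 < a" "a < c" using c by (auto simp: a_def)
  define B where "B = (1 / a\<^sup>2) * (\<Sum>i\<in>UNIV. (1 / a) * C i)"
  define k where "k s y = Re (u y * (of_real (1 / s\<^sup>2) * \<psi> (dil p (1 / s) y)))" for s y
  define L where "L s y = (\<Sum>i\<in>UNIV. pd i (\<lambda>y. \<Psi> i (dil p (1 / s) y)) y)" for s y
  define k' where "k' s y = Re (u y * (- of_real (1 / s\<^sup>2) * L s y))" for s y
  have ik: "integrable area (\<lambda>y. u y * (of_real (1 / s\<^sup>2) * \<psi> (dil p (1 / s) y)))" for s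
    by (intro square_integrable_mult_integrable u smooth_square_integrable open_dom bounded_dom
        smooth_mult smooth_const smooth_dil sm)
  have iP: "integrable area (\<lambda>y. u y * pd i (\<lambda>y. \<Psi> i (dil p (1 / s) y)) y)" for s i
    by (intro square_integrable_mult_integrable u smooth_square_integrable open_dom bounded_dom
        smooth_pd smooth_dil sm\<Psi>)
  have ik': "integrable area (\<lambda>y. u y * (- of_real (1 / s\<^sup>2) * L s y))" for s
    unfolding L_def
    by (intro square_integrable_mult_integrable u smooth_square_integrable open_dom bounded_dom
        smooth_mult smooth_const smooth_sum smooth_pd smooth_dil sm\<Psi>)
  have der: "((\<lambda>s. integral\<^sup>L area (k s)) has_real_derivative integral\<^sup>L area (k' s)) (at s)"
    if s: "a < s" for s
  proof (rule DERIV_integral[OF _ _ _ _ _ s])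
    show "integrable area (k s)" for s unfolding k_def by (rule integrable_Re[OF ik])
    show "k' s \<in> borel_measurable area"
      unfolding k'_def by (rule borel_measurable_integrable[OF integrable_Re[OF ik']])
    have "integrable area (\<lambda>y. u y * 1)"
      by (intro square_integrable_mult_integrable u smooth_square_integrable open_dom bounded_dom smooth_const)
    then show "integrable area (\<lambda>y. B * cmod (u y))" by simp
    fix s y assume s: "a < s"
    have bl: "bounded_linear (\<lambda>z. Re (u y * z))"
      by (rule bounded_linear_compose[OF bounded_linear_Re bounded_linear_mult_right])
    have "0 < s" using s a by simp
    from bounded_linear.has_vector_derivative[OF bl DERIV_dilated[OF sm this, of p y]]
    show "((\<lambda>s. k s y) has_real_derivative k' s y) (at s)"
      unfolding has_real_derivative_iff_has_vector_derivative k_def k'_def L_def \<Psi>_def .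
    have "cmod (L s y) \<le> (\<Sum>i\<in>UNIV. cmod (pd i (\<lambda>y. \<Psi> i (dil p (1 / s) y)) y))"
      unfolding L_def by (rule norm_sum)
    also have "\<dots> \<le> (\<Sum>i\<in>UNIV. (1 / a) * C i)"
    proof (rule sum_mono)
      fix i :: 2
      have "cmod (pd i (\<lambda>y. \<Psi> i (dil p (1 / s) y)) y) = (1 / s) * cmod (pd i (\<Psi> i) (dil p (1 / s) y))"
        unfolding pd_dil[OF smooth_differentiable[OF sm\<Psi>]] using \<open>0 < s\<close> by (simp add: norm_mult norm_divide)
      also have "\<dots> \<le> (1 / a) * C i"
        using s a C by (intro mult_mono) (auto simp: frac_le)
      finally show "cmod (pd i (\<lambda>y. \<Psi> i (dil p (1 / s) y)) y) \<le> (1 / a) * C i" .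
    qed
    finally have L: "cmod (L s y) \<le> (\<Sum>i\<in>UNIV. (1 / a) * C i)" .
    have "(1 / s\<^sup>2) * cmod (L s y) \<le> B"
      unfolding B_def using s a L by (intro mult_mono) (auto simp: frac_le power_mono)
    then have "cmod (u y) * ((1 / s\<^sup>2) * cmod (L s y)) \<le> cmod (u y) * B"
      by (intro mult_left_mono) auto
    moreover have "\<bar>k' s y\<bar> \<le> cmod (u y * (- of_real (1 / s\<^sup>2) * L s y))"
      unfolding k'_def by (rule abs_Re_le_cmod)
    moreover have "cmod (u y * (- of_real (1 / s\<^sup>2) * L s y)) = cmod (u y) * ((1 / s\<^sup>2) * cmod (L s y))"
      by (simp only: norm_mult norm_minus_cancel norm_of_real) simp
    ultimately show "\<bar>k' s y\<bar> \<le> B * cmod (u y)" by (simp add: mult.commute)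
  qed
  have val: "integral\<^sup>L area (k s) = Re (LINT x|area. cut s u x * \<psi> x)"
    if s: "0 < s" "s \<le> 1" for s
  proof -
    have icm: "(LINT x|area. cut s u x * \<psi> x) =
        of_real (1 / s\<^sup>2) * (LINT y|area. u y * \<psi> (dil p (1 / s) y))"
      by (rule integral_cut_mult[OF _ s]) (rule \<psi>0)
    have "integral\<^sup>L area (k s) = Re (LINT y|area. of_real (1 / s\<^sup>2) * (u y * \<psi> (dil p (1 / s) y)))"
      unfolding k_def integral_Re[OF ik] by (simp only: mult.left_commute)
    also have "\<dots> = Re (LINT x|area. cut s u x * \<psi> x)"
      unfolding icm by (simp only: integral_mult_right_zero)
    finally show ?thesis .
  qed
  have val': "integral\<^sup>L area (k' s) = Re (LINT x|area. radial_deriv G s x * \<psi> x)"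
    if s: "0 < s" "s \<le> 1" for s
  proof -
    \<comment> \<open>The dilated test function is admissible because dilates stay in the domain.\<close>
    have parts: "(LINT y|area. u y * pd i (\<lambda>y. \<Psi> i (dil p (1 / s) y)) y) =
        - (LINT y|area. G y $ i * \<Psi> i (dil p (1 / s) y))" for i
      using H test_function_dil[OF \<Psi> s] unfolding H1_def by blast
    have icm: "(LINT x|area. cut s (\<lambda>x. G x $ i) x * \<Psi> i x) =
        of_real (1 / s\<^sup>2) * (LINT y|area. G y $ i * \<Psi> i (dil p (1 / s) y))" for i
      by (rule integral_cut_mult[OF _ s]) (rule \<Psi>0)
    have "(LINT y|area. u y * (- of_real (1 / s\<^sup>2) * L s y)) =
        (LINT y|area. - of_real (1 / s\<^sup>2) * (\<Sum>i\<in>UNIV. u y * pd i (\<lambda>y. \<Psi> i (dil p (1 / s) y)) y))"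
      unfolding L_def by (simp only: sum_distrib_left mult.left_commute)
    also have "\<dots> = - of_real (1 / s\<^sup>2) * (\<Sum>i\<in>UNIV. LINT y|area. u y * pd i (\<lambda>y. \<Psi> i (dil p (1 / s) y)) y)"
      by (simp only: integral_mult_right_zero Bochner_Integration.integral_sum[OF iP])
    also have "\<dots> = (\<Sum>i\<in>UNIV. of_real (1 / s\<^sup>2) * (LINT y|area. G y $ i * \<Psi> i (dil p (1 / s) y)))"
      unfolding parts by (simp only: sum_negf mult_minus_left mult_minus_right minus_minus sum_distrib_left)
    also have "\<dots> = (\<Sum>i\<in>UNIV. LINT x|area. cut s (\<lambda>x. G x $ i) x * \<Psi> i x)"
      unfolding icm ..
    also have "\<dots> = (LINT x|area. (\<Sum>i\<in>UNIV. cut s (\<lambda>x. G x $ i) x * \<Psi> i x))"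
      by (intro Bochner_Integration.integral_sum[symmetric] square_integrable_mult_integrable
          square_integrable_cut G s smooth_square_integrable open_dom bounded_dom sm\<Psi>)
    also have "(\<lambda>x. \<Sum>i\<in>UNIV. cut s (\<lambda>x. G x $ i) x * \<Psi> i x) = (\<lambda>x. radial_deriv G s x * \<psi> x)"
      by (simp add: fun_eq_iff radial_deriv_def \<Psi>_def sum_distrib_left sum_distrib_right mult_ac)
    finally show ?thesis unfolding k'_def integral_Re[OF ik'] by simp
  qed
  have "\<exists>z>c. z < 1 \<and> integral\<^sup>L area (k 1) - integral\<^sup>L area (k c) =
      (1 - c) * integral\<^sup>L area (k' z)"
    by (rule MVT2[OF c(2)]) (use der a in auto)
  then obtain z where z: "c < z" "z < 1" "integral\<^sup>L area (k 1) - integral\<^sup>L area (k c) =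
      (1 - c) * integral\<^sup>L area (k' z)" by blast
  have u1: "cut 1 u x * \<psi> x = u x * \<psi> x" for x
    using \<psi>0[of x] by (simp add: cut_def dil_def)
  have "(LINT x|area. (u x - cut c u x) * \<psi> x) =
      (LINT x|area. cut 1 u x * \<psi> x) - (LINT x|area. cut c u x * \<psi> x)"
    unfolding u1 left_diff_distrib
    by (intro Bochner_Integration.integral_diff square_integrable_mult_integrable u square_integrable_cut
        smooth_square_integrable open_dom bounded_dom sm) (use c in auto)
  then have "Re (LINT x|area. (u x - cut c u x) * \<psi> x) =
      (1 - c) * Re (LINT x|area. radial_deriv G z x * \<psi> x)"
    using z(3) c z val[of 1] val[of c] val'[of z] by simp
  also have "\<dots> \<le> (1 - c) * M"
    using M[of z] z c by (intro mult_left_mono) auto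
  finally show ?thesis .
qed

text \<open>The bound is uniform for \<open>s\<close> in \<open>[c, 1]\<close>, so that one test function can approximate for all these \<open>s\<close>.\<close>

lemma mass_radial_le:
  assumes H: "H1 \<Omega> u G" and c: "0 < c"
  obtains A where "\<And>s. c \<le> s \<Longrightarrow> s \<le> 1 \<Longrightarrow> mass \<Omega> (radial_deriv G s) \<le> A"
proof -
  have G: "\<And>i. square_integrable \<Omega> (\<lambda>x. G x $ i)" using H by (auto simp: H1_def)
  have le: "mass \<Omega> (\<lambda>x. offset p i x * cut s (\<lambda>x. G x $ i) x) \<le> d\<^sup>2 * ((1 / c\<^sup>2) * mass \<Omega> (\<lambda>x. G x $ i))"
    if s: "c \<le> s" "s \<le> 1" for s i
  proof -
    have s0: "0 < s" using s c by simp
    have m: "(\<lambda>x. offset p i x * cut s (\<lambda>x. G x $ i) x) \<in> borel_measurable area"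
      using square_integrableD(1)[OF smooth_mult_square_integrable[OF smooth_offset square_integrable_cut(1)[OF G s0 s(2)]]] .
    have "mass \<Omega> (\<lambda>x. offset p i x * cut s (\<lambda>x. G x $ i) x) \<le> d\<^sup>2 * mass \<Omega> (cut s (\<lambda>x. G x $ i))"
    proof (rule square_integrable_dominated(2)[OF square_integrable_cut(1)[OF G s0 s(2)] m])
      fix x
      show "cmod (offset p i x * cut s (\<lambda>x. G x $ i) x) \<le> d * cmod (cut s (\<lambda>x. G x $ i) x)"
      proof (cases "x \<in> ball p d")
        case True
        have "\<bar>x $ i - p $ i\<bar> \<le> norm (x - p)" using component_le_norm_cart[of "x - p" i] by simp
        also have "\<dots> \<le> d" using True by (simp add: dist_norm norm_minus_commute)
        finally have "cmod (offset p i x) \<le> d" by (simp add: offset_def flip: of_real_diff)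
        then show ?thesis by (simp add: norm_mult mult_right_mono)
      qed (simp add: cut_def)
    qed
    also have "\<dots> \<le> d\<^sup>2 * ((1 / s\<^sup>2) * mass \<Omega> (\<lambda>x. G x $ i))"
      by (intro mult_left_mono square_integrable_cut G s0 s) simp
    also have "\<dots> \<le> d\<^sup>2 * ((1 / c\<^sup>2) * mass \<Omega> (\<lambda>x. G x $ i))"
      using s c by (intro mult_left_mono mult_right_mono) (auto simp: frac_le power_mono)
    finally show ?thesis .
  qed
  have "mass \<Omega> (radial_deriv G s) \<le> (\<Sum>i\<in>UNIV. 2 * (d\<^sup>2 * ((1 / c\<^sup>2) * mass \<Omega> (\<lambda>x. G x $ i))))"
    if s: "c \<le> s" "s \<le> 1" for s
  proof -
    have s0: "0 < s" using s c by simp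
    have si: "square_integrable \<Omega> (\<lambda>x. offset p i x * cut s (\<lambda>x. G x $ i) x)" for i
      by (rule smooth_mult_square_integrable[OF smooth_offset square_integrable_cut(1)[OF G s0 s(2)]])
    have "mass \<Omega> (radial_deriv G s) \<le> (\<Sum>i\<in>UNIV. 2 * mass \<Omega> (\<lambda>x. offset p i x * cut s (\<lambda>x. G x $ i) x))"
      unfolding radial_deriv_def sum_2 by (rule square_integrable_add(2)[OF si si])
    also have "\<dots> \<le> (\<Sum>i\<in>UNIV. 2 * (d\<^sup>2 * ((1 / c\<^sup>2) * mass \<Omega> (\<lambda>x. G x $ i))))"
      by (intro sum_mono mult_left_mono le s) simp
    finally show ?thesis .
  qed
  then show ?thesis using that by blast
qed

text \<open>Both sides of the estimate for test functions are continuous in \<open>\<psi>\<close> for the mean-square norm, uniformly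
  in \<open>s\<close>, so density extends it to square integrable \<open>\<psi>\<close>. Only such weak information on the difference
  quotient \<open>(u - u \<circ> \<delta>\<^sub>c) / (1 - c)\<close> is needed below.\<close>

lemma difference_quotient:
  assumes H: "H1 \<Omega> u G" and \<psi>: "square_integrable \<Omega> \<psi>" "\<And>x. x \<notin> ball p d \<Longrightarrow> \<psi> x = 0"
    and c: "0 < c" "c < 1"
    and M: "\<And>s. c \<le> s \<Longrightarrow> s \<le> 1 \<Longrightarrow> Re (LINT x|area. radial_deriv G s x * \<psi> x) \<le> M"
  shows "Re (LINT x|area. (u x - cut c u x) * \<psi> x) \<le> (1 - c) * M"
proof -
  let ?D = "\<Omega> \<inter> ball p d"
  have D: "open ?D" "bounded ?D" using open_dom bounded_dom by auto
  have u: "square_integrable \<Omega> u" using H by (simp add: H1_def)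
  define w where "w x = u x - cut c u x" for x
  have w: "square_integrable \<Omega> w"
    unfolding w_def [abs_def] by (intro square_integrable_diff u square_integrable_cut) (use c in auto)
  obtain A where A: "\<And>s. c \<le> s \<Longrightarrow> s \<le> 1 \<Longrightarrow> mass \<Omega> (radial_deriv G s) \<le> A"
    using mass_radial_le[OF H c(1)] by blast
  have onD: "(LINT x|lebesgue_on ?D. g x) = (LINT x|area. g x)"
    if "\<And>x. x \<notin> ball p d \<Longrightarrow> g x = 0" for g :: "real^2 \<Rightarrow> real"
  proof -
    have "(\<lambda>x. if x \<in> ?D then g x else 0) = (\<lambda>x. if x \<in> \<Omega> then g x else 0)"
      using that by auto
    then show ?thesis
      using Lebesgue_Measure.integral_restrict_UNIV[of ?D g] Lebesgue_Measure.integral_restrict_UNIV[of \<Omega> g] D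
      by (simp add: borel_open sets_completionI_sets)
  qed
  have \<psi>D: "square_integrable ?D \<psi>"
  proof -
    have D\<Omega>: "?D \<in> sets lebesgue" using D by (simp add: borel_open sets_completionI_sets)
    have eq: "(\<lambda>x. if x \<in> ?D then \<psi> x else 0) = (\<lambda>x. if x \<in> \<Omega> then \<psi> x else 0)"
      "(\<lambda>x. if x \<in> ?D then (cmod (\<psi> x))\<^sup>2 else 0) = (\<lambda>x. if x \<in> \<Omega> then (cmod (\<psi> x))\<^sup>2 else 0)"
      using \<psi>(2) by (auto simp: fun_eq_iff)
    show ?thesis
      using \<psi>(1)
      unfolding square_integrable_def borel_measurable_if[OF D\<Omega>, symmetric] borel_measurable_if[OF sets_dom, symmetric]
        Lebesgue_Measure.integrable_restrict_UNIV[OF D\<Omega>, symmetric]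
        Lebesgue_Measure.integrable_restrict_UNIV[OF sets_dom, symmetric] eq .
  qed
  have main: "Re (LINT x|area. w x * \<psi> x) \<le> (1 - c) * M + \<epsilon> * ((A + 1) / 2 + (mass \<Omega> w + 1) / 2)"
    if \<epsilon>: "\<epsilon> > 0" for \<epsilon>
  proof -
    obtain \<phi> where \<phi>: "test_function ?D \<phi>" "mass ?D (\<lambda>x. \<psi> x - \<phi> x) < \<epsilon>\<^sup>2"
      using test_functions_dense[OF D \<psi>D, of "\<epsilon>\<^sup>2"] \<epsilon> by auto
    obtain K where K: "compact K" "K \<subseteq> ?D" "\<forall>x. x \<notin> K \<longrightarrow> \<phi> x = 0"
      using test_function_support[OF \<phi>(1)] by blast
    have "\<phi> x = 0" if "x \<notin> ball p d" for x using K that by blast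
    then have "mass ?D (\<lambda>x. \<psi> x - \<phi> x) = mass \<Omega> (\<lambda>x. \<psi> x - \<phi> x)"
      using \<psi>(2) by (intro onD) auto
    then have small: "mass \<Omega> (\<lambda>x. \<psi> x - \<phi> x) / \<epsilon> \<le> \<epsilon>"
      using \<phi>(2) \<epsilon> by (simp add: divide_simps power2_eq_square)
    have \<phi>si: "square_integrable \<Omega> \<phi>"
      by (rule smooth_square_integrable[OF open_dom bounded_dom test_function_smooth[OF \<phi>(1)]])
    have err: "\<bar>Re (LINT x|area. f x * \<psi> x) - Re (LINT x|area. f x * \<phi> x)\<bar> \<le> \<epsilon> * ((mass \<Omega> f + 1) / 2)"
      if f: "square_integrable \<Omega> f" for f
    proof -
      have "(LINT x|area. f x * (\<psi> x - \<phi> x)) = (LINT x|area. f x * \<psi> x) - (LINT x|area. f x * \<phi> x)"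
        unfolding right_diff_distrib
        by (intro Bochner_Integration.integral_diff square_integrable_mult_integrable f \<psi> \<phi>si)
      then have "\<bar>Re (LINT x|area. f x * \<psi> x) - Re (LINT x|area. f x * \<phi> x)\<bar> \<le>
          cmod (LINT x|area. f x * (\<psi> x - \<phi> x))"
        by (metis abs_Re_le_cmod minus_complex.sel(1))
      also have "2 * \<dots> \<le> \<epsilon> * mass \<Omega> f + mass \<Omega> (\<lambda>x. \<psi> x - \<phi> x) / \<epsilon>"
        by (intro young_integral f square_integrable_diff \<psi> \<phi>si \<epsilon>)
      also have "\<dots> \<le> \<epsilon> * mass \<Omega> f + \<epsilon>" using small by simp
      finally show ?thesis by (simp add: algebra_simps)
    qed
    have "Re (LINT x|area. (u x - cut c u x) * \<phi> x) \<le> (1 - c) * (M + \<epsilon> * ((A + 1) / 2))"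
    proof (rule difference_quotient_test[OF H \<phi>(1) c])
      fix s assume s: "c \<le> s" "s \<le> 1"
      have s0: "0 < s" using s c by simp
      have "Re (LINT x|area. radial_deriv G s x * \<phi> x) \<le>
          Re (LINT x|area. radial_deriv G s x * \<psi> x) + \<epsilon> * ((mass \<Omega> (radial_deriv G s) + 1) / 2)"
        using err[OF square_integrable_radial[OF H s0 s(2)]] by linarith
      also have "\<dots> \<le> M + \<epsilon> * ((A + 1) / 2)"
        using M[OF s] A[OF s] \<epsilon> by (intro add_mono mult_left_mono divide_right_mono) auto
      finally show "Re (LINT x|area. radial_deriv G s x * \<phi> x) \<le> M + \<epsilon> * ((A + 1) / 2)" .
    qed
    moreover have "(1 - c) * (\<epsilon> * ((A + 1) / 2)) \<le> \<epsilon> * ((A + 1) / 2)"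
    proof -
      have "0 \<le> mass \<Omega> (radial_deriv G 1)" by simp
      then have "0 \<le> A" using A[of 1] c by linarith
      then show ?thesis using c \<epsilon> by (intro mult_left_le_one_le) auto
    qed
    ultimately show ?thesis
      using err[OF w] by (simp only: w_def distrib_left)
  qed
  show ?thesis
  proof (rule field_le_epsilon)
    fix e :: real assume e: "e > 0"
    let ?Q = "(A + 1) / 2 + (mass \<Omega> w + 1) / 2"
    have "0 \<le> mass \<Omega> (radial_deriv G 1)" by simp
    then have "0 \<le> A" using A[of 1] c by linarith
    then have Q: "?Q > 0" by (simp add: add_nonneg_pos)
    from main[of "e / ?Q"] show "Re (LINT x|area. (u x - cut c u x) * \<psi> x) \<le> (1 - c) * M + e"
      using e Q by (simp add: w_def)
  qed
qed

end

section \<open>Cut-off dilates in the form domain\<close>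

lemma linepath_dil:
  assumes "p = linepath a b t0"
  shows "dil p c (linepath a b t) = linepath a b (t0 + c * (t - t0))"
  unfolding assms dil_def linepath_def by (simp add: algebra_simps)

text \<open>The image of \<open>[0, 1]\<close> under a contraction towards one of its points stays in \<open>[0, 1]\<close>. This controls the
  trace of a dilate on a face through the centre of dilation.\<close>

lemma integral_contraction:
  fixes f :: "real \<Rightarrow> real"
  assumes f: "continuous_on {0..1} f" "\<And>t. t \<in> {0..1} \<Longrightarrow> 0 \<le> f t"
    and t0: "t0 \<in> {0..1}" and c: "0 < c" "c \<le> 1"
  shows "integral {0..1} (\<lambda>t. f (t0 + c * (t - t0))) \<le> (1 / c) * integral {0..1} f"
proof -
  let ?g = "\<lambda>t. t0 + c * (t - t0)"
  have g: "?g t \<in> {0..1}" if "t \<in> {0..1}" for t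
  proof -
    have "0 \<le> (1 - c) * t0 + c * t" using t0 c that by simp
    moreover have "(1 - c) * t0 + c * t \<le> (1 - c) * 1 + c * 1"
      using t0 c that by (intro add_mono mult_left_mono) auto
    ultimately show ?thesis by (simp add: algebra_simps)
  qed
  have g01: "?g 0 \<le> ?g 1" using c by (simp add: algebra_simps)
  have img: "?g ` {0..1} \<subseteq> {0..1}" using g by blast
  have der: "(?g has_real_derivative c) (at t within {0..1})" for t
    by (auto intro!: derivative_eq_intros)
  have "((\<lambda>t. c *\<^sub>R f (?g t)) has_integral integral {?g 0..?g 1} f) {0..1}"
    by (rule has_integral_substitution[OF _ g01 img f(1) der]) simp
  then have "integral {0..1} (\<lambda>t. c *\<^sub>R f (?g t)) = integral {?g 0..?g 1} f"
    by (rule integral_unique)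
  then have "c * integral {0..1} (\<lambda>t. f (?g t)) = integral {?g 0..?g 1} f" by simp
  also have "\<dots> \<le> integral {0..1} f"
  proof (rule integral_subset_le)
    show "{?g 0..?g 1} \<subseteq> {0..1}" using g[of 0] g[of 1] by auto
    then show "f integrable_on {?g 0..?g 1}"
      using continuous_on_subset[OF f(1)] by (intro integrable_continuous_real) auto
    show "f integrable_on {0..1}" using f(1) by (rule integrable_continuous_real)
  qed (use f(2) in auto)
  finally show ?thesis using c by (simp add: field_simps)
qed

lemma L2_norm_on_tendsto_iff:
  "(\<lambda>n. L2_norm_on S (f n)) \<longlonglongrightarrow> 0 \<longleftrightarrow> (\<lambda>n. mass S (f n)) \<longlonglongrightarrow> 0"
proof
  assume "(\<lambda>n. L2_norm_on S (f n)) \<longlonglongrightarrow> 0"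
  then have "(\<lambda>n. (L2_norm_on S (f n))\<^sup>2) \<longlonglongrightarrow> 0\<^sup>2" by (intro tendsto_intros)
  then show "(\<lambda>n. mass S (f n)) \<longlonglongrightarrow> 0" by (simp add: L2_norm_on_def)
next
  assume "(\<lambda>n. mass S (f n)) \<longlonglongrightarrow> 0"
  then have "(\<lambda>n. sqrt (mass S (f n))) \<longlonglongrightarrow> sqrt 0" by (intro tendsto_intros)
  then show "(\<lambda>n. L2_norm_on S (f n)) \<longlonglongrightarrow> 0" by (simp add: L2_norm_on_def)
qed

lemma tendsto_0_le_mult:
  fixes f g :: "nat \<Rightarrow> real"
  assumes "g \<longlonglongrightarrow> 0" "\<And>n. 0 \<le> f n" "\<And>n. f n \<le> C * g n"
  shows "f \<longlonglongrightarrow> 0"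
proof (rule tendsto_sandwich[of "\<lambda>_. 0" f sequentially "\<lambda>n. C * g n"])
  show "(\<lambda>n. C * g n) \<longlonglongrightarrow> 0" using tendsto_mult_right_zero[OF assms(1)] .
qed (use assms in auto)

context conic_at
begin

text \<open>The support keeps a positive distance from the circle of radius \<open>d\<close>, so that multiplication by a
  localized function produces test functions supported inside the open disc.\<close>

definition localized :: "(real^2 \<Rightarrow> complex) \<Rightarrow> bool" where
  "localized f \<longleftrightarrow> smooth f \<and> (\<exists>R<d. \<forall>x. x \<notin> cball p R \<longrightarrow> f x = 0)"

lemma localized_smooth: "localized f \<Longrightarrow> smooth f"
  by (simp add: localized_def)

lemma localized_outside: "localized f \<Longrightarrow> x \<notin> ball p d \<Longrightarrow> f x = 0"
  by (auto simp: localized_def)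

lemma localized_pd:
  assumes "localized f" shows "localized (pd i f)"
proof -
  obtain R where R: "R < d" "\<And>x. x \<notin> cball p R \<Longrightarrow> f x = 0"
    using assms by (auto simp: localized_def)
  have "pd i f x = 0" if "x \<notin> cball p R" for x
    by (rule pd_zero_outside[OF closed_cball _ that]) (rule R(2))
  then show ?thesis using R(1) smooth_pd[OF localized_smooth[OF assms]] unfolding localized_def by blast
qed

lemma localized_mult:
  assumes "localized f" "smooth g" shows "localized (\<lambda>x. f x * g x)"
  using assms by (auto simp: localized_def)

lemma localized_dil:
  assumes "localized f" "0 < c" "c \<le> 1"
  shows "localized (\<lambda>x. f (dil p (1 / c) x))"
proof -
  obtain R where R: "R < d" "\<And>x. x \<notin> cball p R \<Longrightarrow> f x = 0"
    using assms(1) by (auto simp: localized_def)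
  have "f (dil p (1 / c) x) = 0" if "x \<notin> cball p R" for x
  proof (rule R(2))
    have "dist p (dil p (1 / c) x) = (1 / c) * dist p x"
      using assms by (simp add: dil_def dist_norm norm_minus_commute)
    moreover have "1 * dist p x \<le> (1 / c) * dist p x"
      using assms by (intro mult_right_mono) auto
    ultimately show "dil p (1 / c) x \<notin> cball p R" using that by auto
  qed
  then show ?thesis
    using R(1) smooth_dil[OF localized_smooth[OF assms(1)]] unfolding localized_def by blast
qed

lemma mass_smooth_mult_le:
  assumes "smooth f"
  obtains C where "0 \<le> C" "\<And>v. square_integrable \<Omega> v \<Longrightarrow> mass \<Omega> (\<lambda>x. f x * v x) \<le> C * mass \<Omega> v"
proof -
  obtain C where C: "0 \<le> C" "\<And>x. x \<in> \<Omega> \<Longrightarrow> cmod (f x) \<le> C"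
    using smooth_bounded_on[OF assms bounded_dom] by blast
  show ?thesis
  proof (rule that[of "C\<^sup>2"])
    fix v assume v: "square_integrable \<Omega> v"
    show "mass \<Omega> (\<lambda>x. f x * v x) \<le> C\<^sup>2 * mass \<Omega> v"
      by (rule square_integrable_dominated(2)[OF v square_integrableD(1)[OF smooth_mult_square_integrable[OF assms v]]])
         (simp add: norm_mult C mult_right_mono)
  qed simp
qed

lemma weak_derivative_cut:
  assumes H: "H1 \<Omega> u G" and \<omega>: "localized \<omega>" and c: "0 < c" "c \<le> 1"
  shows "H1 \<Omega> (\<lambda>x. \<omega> x * cut c u x)
    (\<lambda>x. \<chi> i. pd i \<omega> x * cut c u x + of_real c * (\<omega> x * cut c (\<lambda>x. G x $ i) x))"
proof -
  have u: "square_integrable \<Omega> u" and G: "\<And>i. square_integrable \<Omega> (\<lambda>x. G x $ i)"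
    using H by (auto simp: H1_def)
  note cu = square_integrable_cut(1)[OF u c] and cG = square_integrable_cut(1)[OF G c]
  note sm = localized_smooth[OF \<omega>]
  have "(LINT x|area. \<omega> x * cut c u x * pd i \<phi> x) =
      - (LINT x|area. (pd i \<omega> x * cut c u x + of_real c * (\<omega> x * cut c (\<lambda>x. G x $ i) x)) * \<phi> x)"
    if \<phi>: "test_function \<Omega> \<phi>" for i \<phi>
  proof -
    note s\<phi> = test_function_smooth[OF \<phi>]
    define \<xi> where "\<xi> x = \<omega> x * \<phi> x" for x
    have s\<xi>: "smooth \<xi>" unfolding \<xi>_def [abs_def] by (intro smooth_mult sm s\<phi>)
    have \<xi>: "test_function (\<Omega> \<inter> ball p d) \<xi>"
    proof -
      obtain R where R: "R < d" "\<And>x. x \<notin> cball p R \<Longrightarrow> \<omega> x = 0"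
        using \<omega> by (auto simp: localized_def)
      obtain K where K: "compact K" "K \<subseteq> \<Omega>" "\<forall>x. x \<notin> K \<longrightarrow> \<phi> x = 0"
        using test_function_support[OF \<phi>] by blast
      show ?thesis
      proof (rule test_functionI[of _ "K \<inter> cball p R"])
        show "compact (K \<inter> cball p R)" using K(1) by (intro compact_Int_closed) auto
        show "K \<inter> cball p R \<subseteq> \<Omega> \<inter> ball p d" using K(2) R(1) by auto
      qed (use s\<xi> R K in \<open>auto simp: \<xi>_def\<close>)
    qed
    have \<xi>0: "\<xi> x = 0" "pd i \<xi> x = 0" if "x \<notin> ball p d" for x
    proof -
      have "localized \<xi>" unfolding \<xi>_def [abs_def] by (rule localized_mult[OF \<omega> s\<phi>])
      then show "\<xi> x = 0" "pd i \<xi> x = 0"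
        using localized_outside[OF _ that] localized_pd by blast+
    qed
    have pd\<xi>: "pd i \<xi> x = \<omega> x * pd i \<phi> x + pd i \<omega> x * \<phi> x" for x
      unfolding \<xi>_def [abs_def] by (intro pd_mult smooth_differentiable sm s\<phi>)
    have "(LINT x|area. cut c u x * pd i \<xi> x) =
        of_real (1 / c\<^sup>2) * (LINT y|area. u y * pd i \<xi> (dil p (1 / c) y))"
      by (rule integral_cut_mult[OF _ c]) (rule \<xi>0)
    also have "(\<lambda>y. u y * pd i \<xi> (dil p (1 / c) y)) = (\<lambda>y. of_real c * (u y * pd i (\<lambda>y. \<xi> (dil p (1 / c) y)) y))"
      unfolding pd_dil[OF smooth_differentiable[OF s\<xi>]] using c by (simp add: fun_eq_iff)
    also have "(LINT y|area. of_real c * (u y * pd i (\<lambda>y. \<xi> (dil p (1 / c) y)) y)) =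
        of_real c * - (LINT y|area. G y $ i * \<xi> (dil p (1 / c) y))"
      using H test_function_dil[OF \<xi> c] unfolding H1_def by (simp only: integral_mult_right_zero)
    also have "of_real (1 / c\<^sup>2) * (of_real c * - (LINT y|area. G y $ i * \<xi> (dil p (1 / c) y))) =
        - of_real c * (of_real (1 / c\<^sup>2) * (LINT y|area. G y $ i * \<xi> (dil p (1 / c) y)))"
      by simp
    also have "of_real (1 / c\<^sup>2) * (LINT y|area. G y $ i * \<xi> (dil p (1 / c) y)) =
        (LINT x|area. cut c (\<lambda>x. G x $ i) x * \<xi> x)"
      by (rule integral_cut_mult[OF _ c, symmetric]) (rule \<xi>0)
    finally have main: "(LINT x|area. cut c u x * pd i \<xi> x) =
        - (LINT x|area. of_real c * (cut c (\<lambda>x. G x $ i) x * \<xi> x))"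
      by (simp only: integral_mult_right_zero mult_minus_left)
    have i1: "integrable area (\<lambda>x. cut c u x * (\<omega> x * pd i \<phi> x))"
      and i2: "integrable area (\<lambda>x. cut c u x * (pd i \<omega> x * \<phi> x))"
      and i3: "integrable area (\<lambda>x. of_real c * (cut c (\<lambda>x. G x $ i) x * \<xi> x))"
      by (intro integrable_mult_right square_integrable_mult_integrable cu cG smooth_square_integrable open_dom bounded_dom
          smooth_mult smooth_pd sm s\<phi> s\<xi>)+
    have "(LINT x|area. \<omega> x * cut c u x * pd i \<phi> x) = (LINT x|area. cut c u x * (\<omega> x * pd i \<phi> x))"
      by (simp only: mult_ac)
    also have "\<dots> = (LINT x|area. cut c u x * pd i \<xi> x) - (LINT x|area. cut c u x * (pd i \<omega> x * \<phi> x))"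
      unfolding pd\<xi> distrib_left Bochner_Integration.integral_add[OF i1 i2] by simp
    also have "\<dots> = - (LINT x|area. cut c u x * (pd i \<omega> x * \<phi> x) + of_real c * (cut c (\<lambda>x. G x $ i) x * \<xi> x))"
      unfolding main Bochner_Integration.integral_add[OF i2 i3] by simp
    also have "(\<lambda>x. cut c u x * (pd i \<omega> x * \<phi> x) + of_real c * (cut c (\<lambda>x. G x $ i) x * \<xi> x)) =
        (\<lambda>x. (pd i \<omega> x * cut c u x + of_real c * (\<omega> x * cut c (\<lambda>x. G x $ i) x)) * \<phi> x)"
      by (simp add: fun_eq_iff \<xi>_def algebra_simps)
    finally show ?thesis .
  qed
  moreover have "square_integrable \<Omega> (\<lambda>x. \<omega> x * cut c u x)"
    by (intro smooth_mult_square_integrable sm cu)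
  moreover have "square_integrable \<Omega> (\<lambda>x. pd i \<omega> x * cut c u x + of_real c * (\<omega> x * cut c (\<lambda>x. G x $ i) x))" for i
    by (intro square_integrable_add square_integrable_cmult smooth_mult_square_integrable smooth_pd sm cu cG)
  ultimately show ?thesis unfolding H1_def by simp
qed

text \<open>The approximants \<open>\<phi> n\<close> of \<open>u\<close> give the approximants \<open>\<omega> (\<phi> n \<circ> \<delta>\<^sub>c)\<close> of \<open>\<omega> (u \<circ> \<delta>\<^sub>c)\<close>. On a face away from
  the disc they vanish; a face through \<open>p\<close> is mapped into itself by \<open>\<delta>\<^sub>c\<close>, so their \<open>L\<^sup>2\<close> norm there is
  controlled by that of \<open>\<phi> n\<close>.\<close>

lemma zero_trace_cut:
  assumes H: "H1 \<Omega> u G" and tr: "zero_trace \<Omega> u G e" and \<omega>: "localized \<omega>" and c: "0 < c" "c \<le> 1"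
    and e: "p \<in> face_set e \<or> face_set e \<inter> ball p d = {}"
  shows "zero_trace \<Omega> (\<lambda>x. \<omega> x * cut c u x)
    (\<lambda>x. \<chi> i. pd i \<omega> x * cut c u x + of_real c * (\<omega> x * cut c (\<lambda>x. G x $ i) x)) e"
proof -
  have u: "square_integrable \<Omega> u" and G: "\<And>i. square_integrable \<Omega> (\<lambda>x. G x $ i)"
    using H by (auto simp: H1_def)
  note sm = localized_smooth[OF \<omega>]
  obtain \<phi> where s\<phi>: "\<And>n. smooth (\<phi> n)"
    and lim0: "(\<lambda>n. L2_norm_on \<Omega> (\<lambda>x. \<phi> n x - u x)) \<longlonglongrightarrow> 0"
    and lim1: "\<And>i. (\<lambda>n. L2_norm_on \<Omega> (\<lambda>x. pd i (\<phi> n) x - G x $ i)) \<longlonglongrightarrow> 0"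
    and lim2: "(\<lambda>n. dist (fst e) (snd e) * integral {0..1} (\<lambda>t. (cmod (\<phi> n (linepath (fst e) (snd e) t)))\<^sup>2)) \<longlonglongrightarrow> 0"
    using tr unfolding zero_trace_def by blast
  note m0 = lim0[unfolded L2_norm_on_tendsto_iff] and m1 = lim1[unfolded L2_norm_on_tendsto_iff]
  define \<eta> where "\<eta> n x = \<omega> x * \<phi> n (dil p c x)" for n x
  have s\<eta>: "smooth (\<eta> n)" for n
    unfolding \<eta>_def [abs_def] by (intro smooth_mult sm smooth_dil s\<phi>)
  have d0: "square_integrable \<Omega> (\<lambda>x. \<phi> n x - u x)" for n
    by (intro square_integrable_diff u smooth_square_integrable open_dom bounded_dom s\<phi>)
  have d1: "square_integrable \<Omega> (\<lambda>x. pd i (\<phi> n) x - G x $ i)" for n i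
    by (intro square_integrable_diff G smooth_square_integrable open_dom bounded_dom smooth_pd s\<phi>)
  have cutmass: "mass \<Omega> (\<lambda>x. f x * cut c v x) \<le> C * (1 / c\<^sup>2) * mass \<Omega> v"
    if "square_integrable \<Omega> v" "0 \<le> C" "\<And>v. square_integrable \<Omega> v \<Longrightarrow> mass \<Omega> (\<lambda>x. f x * v x) \<le> C * mass \<Omega> v" for f v C
  proof -
    have "mass \<Omega> (\<lambda>x. f x * cut c v x) \<le> C * mass \<Omega> (cut c v)"
      using that(3)[OF square_integrable_cut(1)[OF that(1) c]] .
    also have "\<dots> \<le> C * ((1 / c\<^sup>2) * mass \<Omega> v)"
      by (intro mult_left_mono square_integrable_cut(2) that c)
    finally show ?thesis by (simp only: mult.assoc)
  qed
  obtain C0 where C0: "0 \<le> C0" "\<And>v. square_integrable \<Omega> v \<Longrightarrow> mass \<Omega> (\<lambda>x. \<omega> x * v x) \<le> C0 * mass \<Omega> v"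
    using mass_smooth_mult_le[OF sm] by blast
  have eq0: "\<eta> n x - \<omega> x * cut c u x = \<omega> x * cut c (\<lambda>x. \<phi> n x - u x) x" for n x
    using localized_outside[OF \<omega>, of x] by (simp add: \<eta>_def cut_def algebra_simps)
  have L0: "(\<lambda>n. L2_norm_on \<Omega> (\<lambda>x. \<eta> n x - \<omega> x * cut c u x)) \<longlonglongrightarrow> 0"
    unfolding L2_norm_on_tendsto_iff eq0
    by (rule tendsto_0_le_mult[OF m0]) (simp, rule cutmass[OF d0 C0])
  have L1: "(\<lambda>n. L2_norm_on \<Omega> (\<lambda>x. pd i (\<eta> n) x -
      (pd i \<omega> x * cut c u x + of_real c * (\<omega> x * cut c (\<lambda>x. G x $ i) x)))) \<longlonglongrightarrow> 0" for i
  proof -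
    have pd\<eta>: "pd i (\<eta> n) x = \<omega> x * (of_real c * pd i (\<phi> n) (dil p c x)) + pd i \<omega> x * \<phi> n (dil p c x)" for n x
      unfolding \<eta>_def [abs_def] pd_dil[OF smooth_differentiable[OF s\<phi>], symmetric]
      by (rule pd_mult[OF smooth_differentiable[OF sm] smooth_differentiable[OF smooth_dil[OF s\<phi>]]])
    have eq1: "pd i (\<eta> n) x - (pd i \<omega> x * cut c u x + of_real c * (\<omega> x * cut c (\<lambda>x. G x $ i) x)) =
        pd i \<omega> x * cut c (\<lambda>x. \<phi> n x - u x) x + of_real c * (\<omega> x * cut c (\<lambda>x. pd i (\<phi> n) x - G x $ i) x)" for n x
      using localized_outside[OF \<omega>, of x] localized_outside[OF localized_pd[OF \<omega>], of x i]
      by (simp add: pd\<eta> cut_def algebra_simps)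
    obtain C1 where C1: "0 \<le> C1" "\<And>v. square_integrable \<Omega> v \<Longrightarrow> mass \<Omega> (\<lambda>x. pd i \<omega> x * v x) \<le> C1 * mass \<Omega> v"
      using mass_smooth_mult_le[OF smooth_pd[OF sm]] by blast
    have "(\<lambda>n. 2 * (C1 * (1 / c\<^sup>2) * mass \<Omega> (\<lambda>x. \<phi> n x - u x)) +
        2 * (c\<^sup>2 * (C0 * (1 / c\<^sup>2) * mass \<Omega> (\<lambda>x. pd i (\<phi> n) x - G x $ i)))) \<longlonglongrightarrow>
        2 * (C1 * (1 / c\<^sup>2) * 0) + 2 * (c\<^sup>2 * (C0 * (1 / c\<^sup>2) * 0))"
      by (intro tendsto_intros m0 m1)
    then have lim: "(\<lambda>n. 2 * (C1 * (1 / c\<^sup>2) * mass \<Omega> (\<lambda>x. \<phi> n x - u x)) +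
        2 * (c\<^sup>2 * (C0 * (1 / c\<^sup>2) * mass \<Omega> (\<lambda>x. pd i (\<phi> n) x - G x $ i)))) \<longlonglongrightarrow> 0"
      by (simp only: mult_zero_right add_0)
    show ?thesis
      unfolding L2_norm_on_tendsto_iff eq1
    proof (rule tendsto_0_le_mult[OF lim, of _ 1])
      fix n
      have "mass \<Omega> (\<lambda>x. pd i \<omega> x * cut c (\<lambda>x. \<phi> n x - u x) x + of_real c * (\<omega> x * cut c (\<lambda>x. pd i (\<phi> n) x - G x $ i) x)) \<le>
        2 * mass \<Omega> (\<lambda>x. pd i \<omega> x * cut c (\<lambda>x. \<phi> n x - u x) x) +
        2 * mass \<Omega> (\<lambda>x. of_real c * (\<omega> x * cut c (\<lambda>x. pd i (\<phi> n) x - G x $ i) x))"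
        by (intro square_integrable_add square_integrable_cmult smooth_mult_square_integrable smooth_pd sm
            square_integrable_cut d0 d1 c)
      also have "mass \<Omega> (\<lambda>x. of_real c * (\<omega> x * cut c (\<lambda>x. pd i (\<phi> n) x - G x $ i) x)) =
          c\<^sup>2 * mass \<Omega> (\<lambda>x. \<omega> x * cut c (\<lambda>x. pd i (\<phi> n) x - G x $ i) x)"
        by (simp add: norm_mult power_mult_distrib)
      also have "2 * mass \<Omega> (\<lambda>x. pd i \<omega> x * cut c (\<lambda>x. \<phi> n x - u x) x) +
          2 * (c\<^sup>2 * mass \<Omega> (\<lambda>x. \<omega> x * cut c (\<lambda>x. pd i (\<phi> n) x - G x $ i) x)) \<le>
        2 * (C1 * (1 / c\<^sup>2) * mass \<Omega> (\<lambda>x. \<phi> n x - u x)) +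
        2 * (c\<^sup>2 * (C0 * (1 / c\<^sup>2) * mass \<Omega> (\<lambda>x. pd i (\<phi> n) x - G x $ i)))"
        by (intro add_mono mult_left_mono cutmass d0 d1 C0 C1) auto
      finally show "mass \<Omega> (\<lambda>x. pd i \<omega> x * cut c (\<lambda>x. \<phi> n x - u x) x + of_real c * (\<omega> x * cut c (\<lambda>x. pd i (\<phi> n) x - G x $ i) x))
        \<le> 1 * (2 * (C1 * (1 / c\<^sup>2) * mass \<Omega> (\<lambda>x. \<phi> n x - u x)) +
        2 * (c\<^sup>2 * (C0 * (1 / c\<^sup>2) * mass \<Omega> (\<lambda>x. pd i (\<phi> n) x - G x $ i))))" by (simp only: mult_1)
    qed simp
  qed
  let ?\<gamma> = "linepath (fst e) (snd e)"
  have \<gamma>: "?\<gamma> t \<in> face_set e" if "t \<in> {0..1}" for t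
    using that by (auto simp: face_set_def linepath_in_path)
  have L2: "(\<lambda>n. dist (fst e) (snd e) * integral {0..1} (\<lambda>t. (cmod (\<eta> n (?\<gamma> t)))\<^sup>2)) \<longlonglongrightarrow> 0"
  proof (cases "p \<in> face_set e")
    case False
    then have "face_set e \<inter> ball p d = {}" using e by blast
    then have \<eta>0: "\<eta> n (?\<gamma> t) = 0" if "t \<in> {0..1}" for t n
    proof -
      have "?\<gamma> t \<notin> ball p d" using \<gamma>[OF that] \<open>face_set e \<inter> ball p d = {}\<close> by blast
      then show ?thesis using localized_outside[OF \<omega>] by (simp add: \<eta>_def)
    qed
    have "integral {0..1} (\<lambda>t. (cmod (\<eta> n (?\<gamma> t)))\<^sup>2) = 0" for n
      by (rule integral_unique[OF has_integral_is_0]) (simp only: \<eta>0 norm_zero power_zero_numeral)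
    then show ?thesis by simp
  next
    case True
    then obtain t0 where t0: "t0 \<in> {0..1}" "p = ?\<gamma> t0"
      unfolding face_set_def by (metis imageE linepath_image_01)
    obtain C where C: "0 \<le> C" "\<And>x. x \<in> face_set e \<Longrightarrow> cmod (\<omega> x) \<le> C"
      by (rule smooth_bounded_on[OF sm, of "face_set e"])
         (simp add: face_set_def compact_imp_bounded compact_segment, blast)
    have cl: "continuous_on {0..1} (\<lambda>t. f (?\<gamma> t))" if "smooth f" for f
      by (rule continuous_on_compose2[OF smooth_continuous_on[OF that, of UNIV] continuous_on_linepath]) simp
    show ?thesis
    proof (rule tendsto_0_le_mult[OF lim2])
      fix n
      have "integral {0..1} (\<lambda>t. (cmod (\<eta> n (?\<gamma> t)))\<^sup>2) \<le>
          integral {0..1} (\<lambda>t. C\<^sup>2 * (cmod (\<phi> n (?\<gamma> (t0 + c * (t - t0)))))\<^sup>2)"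
      proof (rule integral_le)
        show "(\<lambda>t. (cmod (\<eta> n (?\<gamma> t)))\<^sup>2) integrable_on {0..1}"
          by (intro integrable_continuous_real continuous_intros cl s\<eta>)
        have "continuous_on {0..1} (\<lambda>t. \<phi> n (?\<gamma> (t0 + c * (t - t0))))"
          unfolding linepath_dil[OF t0(2), symmetric] by (rule cl) (intro smooth_dil s\<phi>)
        then show "(\<lambda>t. C\<^sup>2 * (cmod (\<phi> n (?\<gamma> (t0 + c * (t - t0)))))\<^sup>2) integrable_on {0..1}"
          by (intro integrable_continuous_real continuous_intros)
        fix t :: real assume t: "t \<in> {0..1}"
        have "cmod (\<eta> n (?\<gamma> t)) \<le> C * cmod (\<phi> n (?\<gamma> (t0 + c * (t - t0))))"
          unfolding \<eta>_def linepath_dil[OF t0(2)] norm_mult by (intro mult_right_mono C(2) \<gamma>[OF t]) simp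
        then show "(cmod (\<eta> n (?\<gamma> t)))\<^sup>2 \<le> C\<^sup>2 * (cmod (\<phi> n (?\<gamma> (t0 + c * (t - t0)))))\<^sup>2"
          unfolding power_mult_distrib[symmetric] by (rule power_mono) simp
      qed
      also have "\<dots> = C\<^sup>2 * integral {0..1} (\<lambda>t. (cmod (\<phi> n (?\<gamma> (t0 + c * (t - t0)))))\<^sup>2)" by simp
      also have "\<dots> \<le> C\<^sup>2 * ((1 / c) * integral {0..1} (\<lambda>t. (cmod (\<phi> n (?\<gamma> t)))\<^sup>2))"
        by (intro mult_left_mono integral_contraction[where f = "\<lambda>t. (cmod (\<phi> n (?\<gamma> t)))\<^sup>2"]
            continuous_intros cl s\<phi> t0 c) auto
      finally have "dist (fst e) (snd e) * integral {0..1} (\<lambda>t. (cmod (\<eta> n (?\<gamma> t)))\<^sup>2) \<le>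
          dist (fst e) (snd e) * (C\<^sup>2 * ((1 / c) * integral {0..1} (\<lambda>t. (cmod (\<phi> n (?\<gamma> t)))\<^sup>2)))"
        by (rule mult_left_mono) simp
      then show "dist (fst e) (snd e) * integral {0..1} (\<lambda>t. (cmod (\<eta> n (?\<gamma> t)))\<^sup>2) \<le>
          (C\<^sup>2 * (1 / c)) * (dist (fst e) (snd e) * integral {0..1} (\<lambda>t. (cmod (\<phi> n (?\<gamma> t)))\<^sup>2))"
        by (simp only: mult_ac)
      show "0 \<le> dist (fst e) (snd e) * integral {0..1} (\<lambda>t. (cmod (\<eta> n (?\<gamma> t)))\<^sup>2)"
        by (intro mult_nonneg_nonneg integral_nonneg integrable_continuous_real continuous_intros cl s\<eta>) auto
    qed
  qed
  show ?thesis
    unfolding zero_trace_def using s\<eta> L0 L1 L2 by (intro exI[of _ \<eta>]) simp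
qed

end

text \<open>The faces that meet the disc all pass through its centre, so contractions preserve them. This is why
  dilates satisfy the same boundary conditions.\<close>

locale conic_polygon = conic_at +
  fixes \<C> :: "(real^2) list set"
  assumes faces_near: "e \<in> faces \<C> \<Longrightarrow> p \<in> face_set e \<or> face_set e \<inter> ball p d = {}"
begin

lemma form_domain_cut:
  assumes "form_domain \<Omega> \<C> B u G" "localized \<omega>" "0 < c" "c \<le> 1"
  shows "form_domain \<Omega> \<C> B (\<lambda>x. \<omega> x * cut c u x)
    (\<lambda>x. \<chi> i. pd i \<omega> x * cut c u x + of_real c * (\<omega> x * cut c (\<lambda>x. G x $ i) x))"
  using assms faces_near unfolding form_domain_def by (blast intro: weak_derivative_cut zero_trace_cut)

end

section \<open>Testing the eigenvalue equation with dilates\<close>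

lemma cnj_pd_of_real:
  assumes "(\<lambda>x. complex_of_real (m x)) differentiable (at x)"
  shows "cnj (pd i (\<lambda>x. complex_of_real (m x)) x) = pd i (\<lambda>x. complex_of_real (m x)) x"
proof -
  obtain D where D: "((\<lambda>x. complex_of_real (m x)) has_derivative D) (at x)"
    using assms unfolding differentiable_def by blast
  have "((\<lambda>x. 0) has_derivative (\<lambda>h. Im (D h))) (at x)"
    using bounded_linear.has_derivative[OF bounded_linear_Im D] by simp
  moreover have "((\<lambda>x. 0) has_derivative (\<lambda>h. 0)) (at x)" by simp
  ultimately have "(\<lambda>h. Im (D h)) = (\<lambda>h. 0)" by (rule has_derivative_unique)
  then have "Im (D (axis i 1)) = 0" by meson
  then show ?thesis unfolding pd_eq[OF D] by (simp add: complex_eq_iff)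
qed

context conic_at
begin

lemma integrable_smooth_mult:
  assumes "smooth f" "square_integrable \<Omega> v" "square_integrable \<Omega> w"
  shows "integrable area (\<lambda>x. f x * (v x * cnj (w x)))"
  using square_integrable_mult_integrable[OF smooth_mult_square_integrable[OF assms(1,2)] square_integrable_cnj[OF assms(3)]]
  by (simp only: mult.assoc)

lemma of_real_cmod_sq: "complex_of_real ((cmod z)\<^sup>2) = z * cnj z"
  by (rule complex_norm_square)

lemma integrable_weight:
  assumes m: "smooth (\<lambda>x. complex_of_real (m x))" and v: "square_integrable \<Omega> v"
  shows "integrable area (\<lambda>x. m x * (cmod (v x))\<^sup>2)"
proof -
  have "integrable area (\<lambda>x. Re (complex_of_real (m x) * (v x * cnj (v x))))"
    by (intro integrable_Re integrable_smooth_mult m v)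
  moreover have "Re (complex_of_real (m x) * (v x * cnj (v x))) = m x * (cmod (v x))\<^sup>2" for x
    unfolding of_real_cmod_sq[symmetric] by simp
  ultimately show ?thesis by (simp only:)
qed

lemma integral_weight_cut:
  assumes m: "localized (\<lambda>x. complex_of_real (m x))" and c: "0 < c" "c \<le> 1"
  shows "(LINT x|area. m x * (cmod (cut c v x))\<^sup>2) =
    (1 / c\<^sup>2) * (LINT y|area. m (dil p (1 / c) y) * (cmod (v y))\<^sup>2)"
proof -
  have m0: "m x = 0" if "x \<notin> ball p d" for x using localized_outside[OF m that] by simp
  have "(LINT x|area. m x * (cmod (cut c v x))\<^sup>2) = (1 / c\<^sup>2) *\<^sub>R
      (LINT y|area. m (dil p (1 / c) y) * (cmod (cut c v (dil p (1 / c) y)))\<^sup>2)"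
    by (rule integral_dil_eq[OF _ c]) (simp add: m0)
  also have "(\<lambda>y. m (dil p (1 / c) y) * (cmod (cut c v (dil p (1 / c) y)))\<^sup>2) = (\<lambda>y. m (dil p (1 / c) y) * (cmod (v y))\<^sup>2)"
  proof
    fix y
    show "m (dil p (1 / c) y) * (cmod (cut c v (dil p (1 / c) y)))\<^sup>2 = m (dil p (1 / c) y) * (cmod (v y))\<^sup>2"
      using c m0[of "dil p (1 / c) y"] by (cases "dil p (1 / c) y \<in> ball p d") (simp_all add: cut_def dil_inverse)
  qed
  finally show ?thesis by simp
qed

end

locale eigenfunction = conic_polygon +
  fixes B :: "(real^2) \<times> (real^2) \<Rightarrow> boundary_condition" and u :: "real^2 \<Rightarrow> complex"
    and G :: "real^2 \<Rightarrow> complex^2" and \<mu> :: real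
  assumes dom: "form_domain \<Omega> \<C> B u G"
    and weak: "\<And>v H. form_domain \<Omega> \<C> B v H \<Longrightarrow>
      (LINT x|area. (\<Sum>i\<in>UNIV. G x $ i * cnj (H x $ i))) =
      complex_of_real \<mu> * (LINT x|area. u x * cnj (v x))"
    and normalized: "mass \<Omega> u = 1"
begin

lemma H1_u: "H1 \<Omega> u G" using dom by (simp add: form_domain_def)

lemma si_u: "square_integrable \<Omega> u" and si_G: "square_integrable \<Omega> (\<lambda>x. G x $ i)"
  using H1_u by (auto simp: H1_def)

definition grad_sq :: "real^2 \<Rightarrow> real" where "grad_sq x = (\<Sum>i\<in>UNIV. (cmod (G x $ i))\<^sup>2)"

lemma integrable_gsq:
  assumes m: "smooth (\<lambda>x. complex_of_real (m x))"
  shows "integrable area (\<lambda>x. m x * grad_sq x)"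
  unfolding grad_sq_def sum_distrib_left
  by (intro Bochner_Integration.integrable_sum integrable_weight m si_G)

lemma energy: "(LINT x|area. grad_sq x) = \<mu>"
proof -
  have "complex_of_real (LINT x|area. grad_sq x) = (LINT x|area. complex_of_real (grad_sq x))"
    by (rule integral_complex_of_real[symmetric])
  also have "\<dots> = complex_of_real \<mu> * (LINT x|area. u x * cnj (u x))"
    using weak[OF dom] by (simp only: grad_sq_def of_real_sum of_real_cmod_sq)
  also have "\<dots> = complex_of_real (\<mu> * mass \<Omega> u)"
    by (simp only: of_real_cmod_sq[symmetric] integral_complex_of_real of_real_mult)
  finally show ?thesis using normalized by (simp only: of_real_eq_iff mult_1_right)
qed

lemma eig_cut:
  assumes m: "localized (\<lambda>x. complex_of_real (m x))" and c: "0 < c" "c \<le> 1"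
  shows "c * Re (LINT x|area. (\<Sum>i\<in>UNIV. of_real (m x) * (G x $ i * cnj (cut c (\<lambda>x. G x $ i) x)))) =
    \<mu> * Re (LINT x|area. of_real (m x) * (u x * cnj (cut c u x))) -
    Re (LINT x|area. (\<Sum>i\<in>UNIV. pd i (\<lambda>x. of_real (m x)) x * (G x $ i * cnj (cut c u x))))"
proof -
  note sm = localized_smooth[OF m]
  note cu = square_integrable_cut(1)[OF si_u c] and cG = square_integrable_cut(1)[OF si_G c]
  have cnjpd: "cnj (pd i (\<lambda>x. complex_of_real (m x)) x) = pd i (\<lambda>x. complex_of_real (m x)) x" for i x
    by (rule cnj_pd_of_real[OF smooth_differentiable[OF sm]])
  have i1: "integrable area (\<lambda>x. \<Sum>i\<in>UNIV. pd i (\<lambda>x. of_real (m x)) x * (G x $ i * cnj (cut c u x)))"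
    by (intro Bochner_Integration.integrable_sum integrable_smooth_mult smooth_pd sm si_G cu)
  have i2: "integrable area (\<lambda>x. of_real c * (\<Sum>i\<in>UNIV. of_real (m x) * (G x $ i * cnj (cut c (\<lambda>x. G x $ i) x))))"
    by (intro integrable_mult_right Bochner_Integration.integrable_sum integrable_smooth_mult sm si_G cG)
  have "(\<Sum>i\<in>UNIV. G x $ i * cnj ((\<chi> i. pd i (\<lambda>x. of_real (m x)) x * cut c u x + of_real c * (of_real (m x) * cut c (\<lambda>x. G x $ i) x)) $ i)) =
      (\<Sum>i\<in>UNIV. pd i (\<lambda>x. of_real (m x)) x * (G x $ i * cnj (cut c u x))) +
      of_real c * (\<Sum>i\<in>UNIV. of_real (m x) * (G x $ i * cnj (cut c (\<lambda>x. G x $ i) x)))" for x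
    by (simp add: cnjpd sum_2 algebra_simps)
  with weak[OF form_domain_cut[OF dom m c]]
  have "(LINT x|area. (\<Sum>i\<in>UNIV. pd i (\<lambda>x. of_real (m x)) x * (G x $ i * cnj (cut c u x))) +
      of_real c * (\<Sum>i\<in>UNIV. of_real (m x) * (G x $ i * cnj (cut c (\<lambda>x. G x $ i) x)))) =
      of_real \<mu> * (LINT x|area. of_real (m x) * (u x * cnj (cut c u x)))"
    by (simp add: mult.left_commute)
  then have "(LINT x|area. (\<Sum>i\<in>UNIV. pd i (\<lambda>x. of_real (m x)) x * (G x $ i * cnj (cut c u x)))) +
      of_real c * (LINT x|area. (\<Sum>i\<in>UNIV. of_real (m x) * (G x $ i * cnj (cut c (\<lambda>x. G x $ i) x)))) =
      of_real \<mu> * (LINT x|area. of_real (m x) * (u x * cnj (cut c u x)))"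
    unfolding Bochner_Integration.integral_add[OF i1 i2] by (simp only: integral_mult_right_zero)
  from arg_cong[OF this, of Re] show ?thesis by simp
qed

text \<open>The contribution of the derivatives of the weight when the equation is tested with \<open>m u\<close>. It is of lower
  order, \<open>O(\<lambda>)\<close> against \<open>O(\<lambda>\<^sup>2)\<close>.\<close>

definition flux :: "(real^2 \<Rightarrow> real) \<Rightarrow> real" where
  "flux m = Re (LINT x|area. (\<Sum>i\<in>UNIV. pd i (\<lambda>x. of_real (m x)) x * (G x $ i * cnj (u x))))"

lemma eig_weight:
  assumes m: "localized (\<lambda>x. complex_of_real (m x))"
  shows "(LINT x|area. m x * grad_sq x) = \<mu> * (LINT x|area. m x * (cmod (u x))\<^sup>2) - flux m"
proof -
  note sm = localized_smooth[OF m]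
  have m0: "m x = 0" if "x \<notin> ball p d" for x using localized_outside[OF m that] by simp
  have c1: "f * (v * cnj (cut 1 w x)) = f * (v * cnj (w x))" if "x \<notin> ball p d \<Longrightarrow> f = 0" for f v w x
    using that by (cases "x \<in> ball p d") (simp_all add: cut_def dil_def)
  have a: "(\<Sum>i\<in>UNIV. of_real (m x) * (G x $ i * cnj (cut 1 (\<lambda>x. G x $ i) x))) = complex_of_real (m x * grad_sq x)" for x
    unfolding grad_sq_def of_real_mult of_real_sum of_real_cmod_sq sum_distrib_left
    by (intro sum.cong refl c1) (simp add: m0)
  have b: "of_real (m x) * (u x * cnj (cut 1 u x)) = complex_of_real (m x * (cmod (u x))\<^sup>2)" for x
    unfolding of_real_mult of_real_cmod_sq by (intro c1) (simp add: m0)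
  have c: "pd i (\<lambda>x. of_real (m x)) x * (G x $ i * cnj (cut 1 u x)) = pd i (\<lambda>x. of_real (m x)) x * (G x $ i * cnj (u x))" for i x
    by (intro c1 localized_outside[OF localized_pd[OF m]])
  show ?thesis
    using eig_cut[OF m, of 1] unfolding a b c integral_complex_of_real flux_def by simp
qed

text \<open>Positivity of \<open>\<integral> m |\<nabla>(u \<circ> \<delta>\<^sub>c) - \<nabla>u|\<^sup>2\<close>, with every quadratic expression in the gradient
  eliminated through the equation. What remains is linear in the gradient or contains \<open>u\<close> alone. The
  first term is \<open>- 2 (1 - c) \<mu> \<integral> m |u|\<^sup>2\<close> to leading order, the second is quadratic in \<open>1 - c\<close>, the third
  is \<open>(1 - c) O(\<lambda>)\<close>, and the last produces the radial energy.\<close>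

lemma dilation_inequality:
  assumes m: "localized (\<lambda>x. complex_of_real (m x))" and nn: "\<And>x. 0 \<le> m x" and c: "0 < c" "c \<le> 1"
  shows "0 \<le> \<mu> * (1 - 1 / c\<^sup>2) * (LINT x|area. m (dil p (1 / c) x) * (cmod (u x))\<^sup>2)
    + \<mu> * (LINT x|area. m x * (cmod (u x - cut c u x))\<^sup>2)
    - (flux (\<lambda>x. m (dil p (1 / c) x)) - flux m)
    - 2 * Re (LINT x|area. (\<Sum>i\<in>UNIV. pd i (\<lambda>x. of_real (m x)) x * (G x $ i * cnj (u x - cut c u x))))"
proof -
  note sm = localized_smooth[OF m]
  note cu = square_integrable_cut(1)[OF si_u c] and cG = square_integrable_cut(1)[OF si_G c]
  let ?mc = "\<lambda>x. m (dil p (1 / c) x)"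
  have mc: "localized (\<lambda>x. complex_of_real (?mc x))" by (rule localized_dil[OF m c])
  have smc: "smooth (\<lambda>x. complex_of_real (?mc x))" by (rule localized_smooth[OF mc])
  define cross where "cross x = (\<Sum>i\<in>UNIV. of_real (m x) * (G x $ i * cnj (cut c (\<lambda>x. G x $ i) x)))" for x
  have icross: "integrable area cross"
    unfolding cross_def [abs_def] by (intro Bochner_Integration.integrable_sum integrable_smooth_mult sm si_G cG)
  define V where "V x = (\<Sum>i\<in>UNIV. m x * (cmod (cut c (\<lambda>x. G x $ i) x))\<^sup>2)" for x
  have iV: "integrable area V"
    unfolding V_def [abs_def] by (intro Bochner_Integration.integrable_sum integrable_weight sm cG)
  have intV: "c\<^sup>2 * integral\<^sup>L area V = (LINT x|area. ?mc x * grad_sq x)"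
  proof -
    have "integral\<^sup>L area V = (\<Sum>i\<in>UNIV. LINT x|area. m x * (cmod (cut c (\<lambda>x. G x $ i) x))\<^sup>2)"
      unfolding V_def [abs_def] by (intro Bochner_Integration.integral_sum integrable_weight sm cG)
    also have "\<dots> = (1 / c\<^sup>2) * (\<Sum>i\<in>UNIV. LINT x|area. ?mc x * (cmod (G x $ i))\<^sup>2)"
      unfolding integral_weight_cut[OF m c] sum_distrib_left ..
    also have "(\<Sum>i\<in>UNIV. LINT x|area. ?mc x * (cmod (G x $ i))\<^sup>2) = (LINT x|area. ?mc x * grad_sq x)"
      unfolding grad_sq_def sum_distrib_left
      by (intro Bochner_Integration.integral_sum[symmetric] integrable_weight smc si_G)
    finally show ?thesis using c by simp
  qed
  have "0 \<le> c\<^sup>2 * V x + m x * grad_sq x - 2 * (c * Re (cross x))" for x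
  proof -
    have "0 \<le> (\<Sum>i\<in>UNIV. m x * (cmod (of_real c * cut c (\<lambda>x. G x $ i) x - G x $ i))\<^sup>2)"
      by (intro sum_nonneg mult_nonneg_nonneg nn) simp
    also have "\<dots> = c\<^sup>2 * V x + m x * grad_sq x - 2 * (c * Re (cross x))"
      unfolding V_def grad_sq_def cross_def cmod_power2 by (simp add: sum_2 power2_eq_square algebra_simps)
    finally show ?thesis .
  qed
  then have "0 \<le> (LINT x|area. c\<^sup>2 * V x + m x * grad_sq x - 2 * (c * Re (cross x)))"
    by (intro integral_nonneg_AE AE_I2)
  also have "\<dots> = c\<^sup>2 * integral\<^sup>L area V + (LINT x|area. m x * grad_sq x) -
      2 * (c * Re (integral\<^sup>L area cross))"
    using iV icross integrable_gsq[OF sm] integrable_Re[OF icross]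
    by (subst Bochner_Integration.integral_diff Bochner_Integration.integral_add | simp)+
  finally have 1: "0 \<le> (LINT x|area. ?mc x * grad_sq x) + (LINT x|area. m x * grad_sq x) -
      2 * (c * Re (integral\<^sup>L area cross))" unfolding intV .
  define Q where "Q = (LINT x|area. m x * (cmod (u x))\<^sup>2)"
  define Qc where "Qc = (LINT x|area. ?mc x * (cmod (u x))\<^sup>2)"
  define W where "W = (LINT x|area. m x * (cmod (u x - cut c u x))\<^sup>2)"
  define R where "R = Re (LINT x|area. of_real (m x) * (u x * cnj (cut c u x)))"
  define S where "S = Re (LINT x|area. (\<Sum>i\<in>UNIV. pd i (\<lambda>x. of_real (m x)) x * (G x $ i * cnj (cut c u x))))"
  have 2: "c * Re (integral\<^sup>L area cross) = \<mu> * R - S"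
    using eig_cut[OF m c] unfolding cross_def [abs_def] R_def S_def .
  have 3: "(LINT x|area. ?mc x * grad_sq x) = \<mu> * Qc - flux ?mc"
    "(LINT x|area. m x * grad_sq x) = \<mu> * Q - flux m"
    unfolding Qc_def Q_def by (rule eig_weight[OF mc], rule eig_weight[OF m])
  \<comment> \<open>Polarisation; the mass of the dilate is rescaled by the Jacobian.\<close>
  have 4: "W = Q + (1 / c\<^sup>2) * Qc - 2 * R"
  proof -
    have iR: "integrable area (\<lambda>x. complex_of_real (m x) * (u x * cnj (cut c u x)))"
      by (intro integrable_smooth_mult sm si_u cu)
    have "m x * (cmod (u x - cut c u x))\<^sup>2 = m x * (cmod (u x))\<^sup>2 + m x * (cmod (cut c u x))\<^sup>2 -
        2 * Re (complex_of_real (m x) * (u x * cnj (cut c u x)))" for x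
      unfolding cmod_power2 by (simp add: power2_eq_square algebra_simps)
    then have "W = (LINT x|area. m x * (cmod (u x))\<^sup>2 + m x * (cmod (cut c u x))\<^sup>2 -
        2 * Re (complex_of_real (m x) * (u x * cnj (cut c u x))))" unfolding W_def by simp
    also have "\<dots> = Q + (LINT x|area. m x * (cmod (cut c u x))\<^sup>2) - 2 * R"
    proof -
      have "(LINT x|area. m x * (cmod (u x))\<^sup>2 + m x * (cmod (cut c u x))\<^sup>2 -
          2 * Re (complex_of_real (m x) * (u x * cnj (cut c u x)))) =
        (LINT x|area. m x * (cmod (u x))\<^sup>2 + m x * (cmod (cut c u x))\<^sup>2) -
        (LINT x|area. 2 * Re (complex_of_real (m x) * (u x * cnj (cut c u x))))"
        by (intro Bochner_Integration.integral_diff Bochner_Integration.integrable_add integrable_weight sm si_u cu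
            integrable_mult_right integrable_Re iR)
      also have "\<dots> = Q + (LINT x|area. m x * (cmod (cut c u x))\<^sup>2) - 2 * R"
        unfolding Q_def R_def integral_mult_right_zero integral_Re[OF iR]
          Bochner_Integration.integral_add[OF integrable_weight[OF sm si_u] integrable_weight[OF sm cu]] ..
      finally show ?thesis .
    qed
    finally show ?thesis unfolding integral_weight_cut[OF m c] Qc_def .
  qed
  have 5: "Re (LINT x|area. (\<Sum>i\<in>UNIV. pd i (\<lambda>x. of_real (m x)) x * (G x $ i * cnj (u x - cut c u x)))) = flux m - S"
  proof -
    have i: "integrable area (\<lambda>x. \<Sum>i\<in>UNIV. pd i (\<lambda>x. of_real (m x)) x * (G x $ i * cnj (v x)))"
      if "square_integrable \<Omega> v" for v
      by (intro Bochner_Integration.integrable_sum integrable_smooth_mult smooth_pd sm si_G that)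
    have "(\<Sum>i\<in>UNIV. pd i (\<lambda>x. of_real (m x)) x * (G x $ i * cnj (u x - cut c u x))) =
        (\<Sum>i\<in>UNIV. pd i (\<lambda>x. of_real (m x)) x * (G x $ i * cnj (u x))) -
        (\<Sum>i\<in>UNIV. pd i (\<lambda>x. of_real (m x)) x * (G x $ i * cnj (cut c u x)))" for x
      by (simp add: sum_2 algebra_simps)
    then show ?thesis
      unfolding flux_def S_def using Bochner_Integration.integral_diff[OF i[OF si_u] i[OF cu]] by simp
  qed
  have "0 \<le> \<mu> * (1 - 1 / c\<^sup>2) * Qc + \<mu> * W - (flux ?mc - flux m) - 2 * (flux m - S)"
    using 1 unfolding 2 3 4 by (simp add: algebra_simps)
  then show ?thesis unfolding 5 Qc_def W_def .
qed

end

section \<open>The virial inequality\<close>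

lemma lipschitz_compact_support:
  assumes f: "smooth f" and K: "compact K" "\<And>x. x \<notin> K \<Longrightarrow> f x = 0"
  obtains L where "0 \<le> L" "\<And>x y. cmod (f x - f y) \<le> L * norm (x - y)"
proof -
  have "\<exists>C\<ge>0. \<forall>x. cmod (pd i f x) \<le> C" for i
  proof -
    have z: "pd i f x = 0" if "x \<notin> K" for x
      by (rule pd_zero_outside[OF compact_imp_closed[OF K(1)] _ that]) (rule K(2))
    show ?thesis
      by (rule bounded_compactly_supported[OF smooth_continuous_on[OF smooth_pd[OF f]] K(1)])
         (use z in blast)+
  qed
  then obtain C where C: "\<And>i. 0 \<le> C i" "\<And>i x. cmod (pd i f x) \<le> C i" by metis
  let ?L = "\<Sum>i\<in>UNIV. C i"
  have L: "0 \<le> ?L" by (intro sum_nonneg C)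
  have on: "onorm (frechet_derivative f (at x)) \<le> ?L" for x
  proof (rule onorm_bound[OF L])
    fix h
    have "cmod (frechet_derivative f (at x) h) \<le> (\<Sum>i\<in>UNIV. cmod (of_real (h $ i) * pd i f x))"
      unfolding derivative_eq_pd[OF smooth_differentiable[OF f]] by (rule norm_sum)
    also have "\<dots> \<le> (\<Sum>i\<in>UNIV. C i * norm h)"
    proof (rule sum_mono)
      fix i :: 2
      have "\<bar>h $ i\<bar> * cmod (pd i f x) \<le> norm h * C i"
        by (intro mult_mono component_le_norm_cart C) auto
      then show "cmod (of_real (h $ i) * pd i f x) \<le> C i * norm h" by (simp add: norm_mult mult.commute)
    qed
    finally show "cmod (frechet_derivative f (at x) h) \<le> ?L * norm h" by (simp add: sum_distrib_right)
  qed
  have "cmod (f x - f y) \<le> ?L * norm (x - y)" for x y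
    by (rule differentiable_bound[of UNIV f "\<lambda>x. frechet_derivative f (at x)"])
       (use on has_derivative_frechet[OF smooth_differentiable[OF f]] in auto)
  then show ?thesis using L that by blast
qed

lemma inverse_power_bound:
  assumes "1 / 2 \<le> s" "s \<le> (1 :: real)"
  shows "\<bar>(1 / s) ^ n - 1\<bar> \<le> (2 * real n * 2 ^ n) * (1 - s)"
proof (induction n)
  case (Suc n)
  have s: "s > 0" using assms by simp
  have le2: "1 / s \<le> 2" using assms s by (simp add: divide_simps)
  have p: "(1 / s) ^ n \<le> 2 ^ n" using le2 s by (intro power_mono) auto
  have q: "\<bar>1 / s - 1\<bar> \<le> 2 * (1 - s)"
  proof -
    have "1 / s - 1 = (1 / s) * (1 - s)" using s by (simp add: field_simps)
    moreover have "(1 / s) * (1 - s) \<le> 2 * (1 - s)" using assms le2 by (intro mult_right_mono) auto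
    moreover have "0 \<le> (1 / s) * (1 - s)" using assms s by simp
    ultimately show ?thesis by linarith
  qed
  have "(1 / s) ^ Suc n - 1 = (1 / s) ^ n * (1 / s - 1) + ((1 / s) ^ n - 1)"
    by (simp add: algebra_simps)
  then have "\<bar>(1 / s) ^ Suc n - 1\<bar> \<le> \<bar>(1 / s) ^ n * (1 / s - 1)\<bar> + \<bar>(1 / s) ^ n - 1\<bar>"
    by (simp only: abs_triangle_ineq)
  also have "\<bar>(1 / s) ^ n * (1 / s - 1)\<bar> \<le> 2 ^ n * (2 * (1 - s))"
    unfolding abs_mult using p q s by (intro mult_mono) auto
  also have "2 ^ n * (2 * (1 - s)) + \<bar>(1 / s) ^ n - 1\<bar> \<le> 2 ^ n * (2 * (1 - s)) + (2 * real n * 2 ^ n) * (1 - s)"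
    using Suc.IH by simp
  also have "\<dots> = (2 * (real n + 1) * 2 ^ n) * (1 - s)" by (simp add: algebra_simps)
  also have "\<dots> \<le> (2 * real (Suc n) * 2 ^ Suc n) * (1 - s)"
    using assms by (intro mult_right_mono) auto
  finally show ?case by simp
qed simp

context conic_at
begin

lemma localized_bounded:
  assumes "localized f"
  obtains b where "0 \<le> b" "\<And>x. cmod (f x) \<le> b"
proof -
  obtain R where "\<And>x. x \<notin> cball p R \<Longrightarrow> f x = 0" using assms by (auto simp: localized_def)
  from bounded_compactly_supported[OF smooth_continuous_on[OF localized_smooth[OF assms]] compact_cball this]
  show ?thesis using that by blast
qed

text \<open>First-order comparison of a localized function with its dilates. The powers \<open>n = 0, 1, 4\<close> are those that
  arise from the cutoff, from its gradient, and from the weight of the radial energy.\<close>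

lemma dilation_lipschitz:
  assumes f: "localized f"
  obtains C where "0 \<le> C"
    "\<And>s x. 1 / 2 \<le> s \<Longrightarrow> s \<le> 1 \<Longrightarrow> cmod (of_real ((1 / s) ^ n) * f (dil p (1 / s) x) - f x) \<le> C * (1 - s)"
proof -
  obtain R where R: "R < d" "\<And>x. x \<notin> cball p R \<Longrightarrow> f x = 0" using f by (auto simp: localized_def)
  obtain b where b: "0 \<le> b" "\<And>x. cmod (f x) \<le> b" using localized_bounded[OF f] by blast
  obtain L where L: "0 \<le> L" "\<And>x y. cmod (f x - f y) \<le> L * norm (x - y)"
    using lipschitz_compact_support[OF localized_smooth[OF f] compact_cball R(2)] by blast
  define N where "N = 2 * real n * 2 ^ n"
  have N: "0 \<le> N" by (simp add: N_def)
  have lip: "cmod (f (dil p (1 / s) x) - f x) \<le> (2 * L * d) * (1 - s)" if s: "1 / 2 \<le> s" "s \<le> 1" for s x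
  proof (cases "dist p x \<le> d")
    case True
    have s0: "s > 0" using s by simp
    have "dil p (1 / s) x - x = (1 / s - 1) *\<^sub>R (x - p)" by (simp add: dil_def algebra_simps)
    then have n: "norm (dil p (1 / s) x - x) = (1 / s - 1) * dist p x"
      using s s0 by (simp add: dist_norm norm_minus_commute)
    have "(1 / s - 1) \<le> 2 * (1 - s)"
    proof -
      have "1 / s - 1 = (1 / s) * (1 - s)" using s0 by (simp add: field_simps)
      also have "\<dots> \<le> 2 * (1 - s)" using s s0 by (intro mult_right_mono) (auto simp: divide_simps)
      finally show ?thesis .
    qed
    then have "(1 / s - 1) * dist p x \<le> (2 * (1 - s)) * d"
      using True s s0 by (intro mult_mono) auto
    then have "L * norm (dil p (1 / s) x - x) \<le> L * ((2 * (1 - s)) * d)"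
      unfolding n using L(1) by (rule mult_left_mono)
    then show ?thesis using L(2)[of "dil p (1 / s) x" x] by (simp add: algebra_simps)
  next
    case False
    have s0: "s > 0" using s by simp
    have "dist p (dil p (1 / s) x) = (1 / s) * dist p x"
      using s0 by (simp add: dil_def dist_norm norm_minus_commute)
    moreover have "1 * dist p x \<le> (1 / s) * dist p x" using s s0 by (intro mult_right_mono) auto
    ultimately have "f (dil p (1 / s) x) = 0" "f x = 0" using False R by (auto intro!: R(2))
    then show ?thesis using L(1) d_pos s by simp
  qed
  have "cmod (of_real ((1 / s) ^ n) * f (dil p (1 / s) x) - f x) \<le> (N * b + 2 * L * d) * (1 - s)"
    if s: "1 / 2 \<le> s" "s \<le> 1" for s x
  proof -
    have "of_real ((1 / s) ^ n) * f (dil p (1 / s) x) - f x =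
        of_real ((1 / s) ^ n - 1) * f (dil p (1 / s) x) + (f (dil p (1 / s) x) - f x)"
      by (simp add: algebra_simps)
    then have "cmod (of_real ((1 / s) ^ n) * f (dil p (1 / s) x) - f x) \<le>
        cmod (of_real ((1 / s) ^ n - 1) * f (dil p (1 / s) x)) + cmod (f (dil p (1 / s) x) - f x)"
      by (simp only: norm_triangle_ineq)
    also have "cmod (of_real ((1 / s) ^ n - 1) * f (dil p (1 / s) x)) \<le> (N * (1 - s)) * b"
      unfolding norm_mult norm_of_real N_def using s b
      by (intro mult_mono inverse_power_bound) auto
    finally show ?thesis using lip[OF s, of x] by (simp add: algebra_simps)
  qed
  moreover have "0 \<le> N * b + 2 * L * d" using N b L d_pos by simp
  ultimately show ?thesis using that by blast
qed

end

context eigenfunction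
begin

text \<open>Young's inequality with weight \<open>\<lambda>\<close> balances the energy, which is \<open>\<lambda>\<^sup>2\<close>, against the mass, which is
  \<open>1\<close>.\<close>

lemma flux_bound:
  assumes q: "\<And>i. smooth (q i)" "\<And>i x. x \<in> \<Omega> \<Longrightarrow> cmod (q i x) \<le> b" and b: "0 \<le> b" and \<mu>: "0 < \<mu>"
  shows "\<bar>Re (LINT x|area. (\<Sum>i\<in>UNIV. q i x * (G x $ i * cnj (u x))))\<bar> \<le> 2 * b * sqrt \<mu>"
proof -
  let ?r = "sqrt \<mu>"
  have r: "?r > 0" using \<mu> by simp
  let ?F = "\<lambda>x. \<Sum>i\<in>UNIV. q i x * (G x $ i * cnj (u x))"
  have iG: "integrable area grad_sq" using integrable_gsq[of "\<lambda>x. 1"] by simp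
  have iu: "integrable area (\<lambda>x. (cmod (u x))\<^sup>2)" by (rule square_integrableD(2)[OF si_u])
  have iF: "integrable area ?F"
    by (intro Bochner_Integration.integrable_sum integrable_smooth_mult q si_u si_G)
  have "\<bar>Re (integral\<^sup>L area ?F)\<bar> \<le> cmod (integral\<^sup>L area ?F)" by (rule abs_Re_le_cmod)
  also have "\<dots> \<le> (LINT x|area. cmod (?F x))" by (rule integral_norm_bound)
  also have "\<dots> \<le> (LINT x|area. (b / (2 * ?r)) * grad_sq x + (b * ?r) * (cmod (u x))\<^sup>2)"
  proof (rule integral_mono)
    show "integrable area (\<lambda>x. cmod (?F x))" using iF by (rule integrable_norm)
    show "integrable area (\<lambda>x. (b / (2 * ?r)) * grad_sq x + (b * ?r) * (cmod (u x))\<^sup>2)"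
      by (intro Bochner_Integration.integrable_add integrable_mult_right iG iu)
    fix x assume x: "x \<in> space area"
    have t: "cmod (q i x * (G x $ i * cnj (u x))) \<le> b * ((cmod (G x $ i))\<^sup>2 / (2 * ?r) + ?r * (cmod (u x))\<^sup>2 / 2)" for i
    proof -
      have "0 \<le> (cmod (G x $ i) - ?r * cmod (u x))\<^sup>2 / (2 * ?r)" using r by simp
      also have "\<dots> = (cmod (G x $ i))\<^sup>2 / (2 * ?r) + ?r * (cmod (u x))\<^sup>2 / 2 - cmod (G x $ i) * cmod (u x)"
        using r by (simp add: field_simps power2_eq_square)
      finally have "cmod (G x $ i) * cmod (u x) \<le> (cmod (G x $ i))\<^sup>2 / (2 * ?r) + ?r * (cmod (u x))\<^sup>2 / 2" by simp
      then have "cmod (q i x) * (cmod (G x $ i) * cmod (u x)) \<le> b * ((cmod (G x $ i))\<^sup>2 / (2 * ?r) + ?r * (cmod (u x))\<^sup>2 / 2)"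
        using q(2)[of x i] x b by (intro mult_mono) auto
      then show ?thesis by (simp add: norm_mult)
    qed
    have "cmod (?F x) \<le> (\<Sum>i\<in>UNIV. cmod (q i x * (G x $ i * cnj (u x))))" by (rule norm_sum)
    also have "\<dots> \<le> (\<Sum>i\<in>UNIV. b * ((cmod (G x $ i))\<^sup>2 / (2 * ?r) + ?r * (cmod (u x))\<^sup>2 / 2))"
      by (intro sum_mono t)
    also have "\<dots> = (b / (2 * ?r)) * grad_sq x + (b * ?r) * (cmod (u x))\<^sup>2"
      unfolding grad_sq_def sum_2 using r by (simp add: field_simps)
    finally show "cmod (?F x) \<le> (b / (2 * ?r)) * grad_sq x + (b * ?r) * (cmod (u x))\<^sup>2" .
  qed
  also have "\<dots> = (b / (2 * ?r)) * \<mu> + b * ?r"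
    using iG iu normalized energy by (subst Bochner_Integration.integral_add) auto
  also have "(b / (2 * ?r)) * \<mu> = b * ?r / 2"
    using r \<mu> by (simp add: field_simps)
  also have "b * ?r / 2 + b * ?r \<le> 2 * b * ?r" using b r by simp
  finally show ?thesis .
qed

definition radial_part :: "real^2 \<Rightarrow> complex" where
  "radial_part x = (\<Sum>i\<in>UNIV. offset p i x * G x $ i)"

lemma si_radial_part: "square_integrable \<Omega> radial_part"
  unfolding radial_part_def [abs_def]
  by (intro square_integrable_sum smooth_mult_square_integrable smooth_offset si_G)

lemma radial_part_le: "(cmod (radial_part x))\<^sup>2 \<le> sqdist p x * grad_sq x"
proof -
  have "cmod (radial_part x) \<le> (\<Sum>i\<in>UNIV. cmod (offset p i x * G x $ i))"
    unfolding radial_part_def by (rule norm_sum)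
  also have "\<dots> = (\<Sum>i\<in>UNIV. cmod (offset p i x) * cmod (G x $ i))" by (simp add: norm_mult)
  finally have "(cmod (radial_part x))\<^sup>2 \<le> (\<Sum>i\<in>UNIV. cmod (offset p i x) * cmod (G x $ i))\<^sup>2"
    by (intro power_mono) auto
  also have "\<dots> \<le> (\<Sum>i\<in>UNIV. (cmod (offset p i x))\<^sup>2) * (\<Sum>i\<in>UNIV. (cmod (G x $ i))\<^sup>2)"
    by (rule Cauchy_Schwarz_ineq_sum)
  also have "(\<Sum>i\<in>UNIV. (cmod (offset p i x))\<^sup>2) = sqdist p x"
    by (simp add: offset_def sqdist_def norm_vec_def L2_set_def sum_2 flip: of_real_diff)
  finally show ?thesis by (simp add: grad_sq_def)
qed

text \<open>Two factors \<open>1 / s\<^sup>2\<close> appear, one from the Jacobian and one from rescaling \<open>x - p\<close>.\<close>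

lemma radial_weight_le:
  assumes k: "localized (\<lambda>x. complex_of_real (k x))"
    and C: "0 \<le> C" "\<And>x. \<bar>(1 / s) ^ 4 * k (dil p (1 / s) x) - k x\<bar> \<le> C * (1 - s)"
    and s: "0 < s" "s \<le> 1"
  shows "(LINT x|area. k x * (cmod (radial_deriv G s x))\<^sup>2) \<le>
    (LINT x|area. k x * (cmod (radial_part x))\<^sup>2) + C * (1 - s) * mass \<Omega> radial_part"
proof -
  note sm = localized_smooth[OF k]
  let ?ks = "\<lambda>x. (1 / s) ^ 4 * k (dil p (1 / s) x)"
  have sks: "smooth (\<lambda>x. complex_of_real (?ks x))"
    unfolding of_real_mult using smooth_dil[OF sm, of p "1 / s"] by (intro smooth_mult smooth_const)
  have k0: "k x = 0" if "x \<notin> ball p d" for x using localized_outside[OF k that] by simp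
  have "(LINT x|area. k x * (cmod (radial_deriv G s x))\<^sup>2) = (1 / s\<^sup>2) *\<^sub>R
     (LINT y|area. k (dil p (1 / s) y) * (cmod (radial_deriv G s (dil p (1 / s) y)))\<^sup>2)"
    by (rule integral_dil_eq[OF _ s]) (simp add: k0)
  also have "(\<lambda>y. k (dil p (1 / s) y) * (cmod (radial_deriv G s (dil p (1 / s) y)))\<^sup>2) =
      (\<lambda>y. s\<^sup>2 * (?ks y * (cmod (radial_part y))\<^sup>2))"
  proof
    fix y
    show "k (dil p (1 / s) y) * (cmod (radial_deriv G s (dil p (1 / s) y)))\<^sup>2 = s\<^sup>2 * (?ks y * (cmod (radial_part y))\<^sup>2)"
    proof (cases "dil p (1 / s) y \<in> ball p d")
      case True
      have "offset p i (dil p (1 / s) y) = of_real (1 / s) * offset p i y" for i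
        by (simp add: offset_def dil_def algebra_simps)
      then have "radial_deriv G s (dil p (1 / s) y) = of_real (1 / s) * radial_part y"
        using True s by (simp add: radial_deriv_def radial_part_def cut_def dil_inverse sum_distrib_left mult.assoc)
      then have "(cmod (radial_deriv G s (dil p (1 / s) y)))\<^sup>2 = (1 / s)\<^sup>2 * (cmod (radial_part y))\<^sup>2"
        using s by (simp only: norm_mult norm_of_real power_mult_distrib power2_abs)
      moreover have "(1 / s)\<^sup>2 = s\<^sup>2 * (1 / s) ^ 4" using s by (simp add: field_simps power2_eq_square power4_eq_xxxx)
      ultimately show ?thesis by (simp add: mult_ac)
    qed (simp add: k0)
  qed
  also have "(1 / s\<^sup>2) *\<^sub>R (LINT y|area. s\<^sup>2 * (?ks y * (cmod (radial_part y))\<^sup>2)) =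
      (LINT y|area. ?ks y * (cmod (radial_part y))\<^sup>2)"
    using s by simp
  also have "\<dots> \<le> (LINT y|area. k y * (cmod (radial_part y))\<^sup>2 + C * (1 - s) * (cmod (radial_part y))\<^sup>2)"
  proof (rule integral_mono)
    show "integrable area (\<lambda>y. ?ks y * (cmod (radial_part y))\<^sup>2)"
      by (rule integrable_weight[OF sks si_radial_part])
    show "integrable area (\<lambda>y. k y * (cmod (radial_part y))\<^sup>2 + C * (1 - s) * (cmod (radial_part y))\<^sup>2)"
      by (intro Bochner_Integration.integrable_add integrable_weight[OF sm si_radial_part] integrable_mult_right
          square_integrableD(2)[OF si_radial_part])
    fix y
    have "?ks y \<le> k y + C * (1 - s)" using C(2)[of y] by linarith
    then have "?ks y * (cmod (radial_part y))\<^sup>2 \<le> (k y + C * (1 - s)) * (cmod (radial_part y))\<^sup>2"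
      by (rule mult_right_mono) simp
    then show "?ks y * (cmod (radial_part y))\<^sup>2 \<le> k y * (cmod (radial_part y))\<^sup>2 + C * (1 - s) * (cmod (radial_part y))\<^sup>2"
      by (simp only: distrib_right)
  qed
  also have "\<dots> = (LINT x|area. k x * (cmod (radial_part x))\<^sup>2) + C * (1 - s) * mass \<Omega> radial_part"
    using integrable_weight[OF sm si_radial_part] square_integrableD(2)[OF si_radial_part]
    by (subst Bochner_Integration.integral_add) auto
  finally show ?thesis .
qed

text \<open>The difference \<open>u - u \<circ> \<delta>\<^sub>c\<close> is tested against itself, with Young's inequality used to absorb half of
  the result into the left-hand side.\<close>

lemma difference_mass_le:
  assumes m: "localized (\<lambda>x. complex_of_real (m x))" "\<And>x. 0 \<le> m x" "\<And>x. m x \<le> 1"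
    and A: "\<And>s. c \<le> s \<Longrightarrow> s \<le> 1 \<Longrightarrow> mass \<Omega> (radial_deriv G s) \<le> A"
    and c: "0 < c" "c < 1"
  shows "(LINT x|area. m x * (cmod (u x - cut c u x))\<^sup>2) \<le> (1 - c)\<^sup>2 * A"
proof -
  define w where "w x = u x - cut c u x" for x
  define \<psi> where "\<psi> x = complex_of_real (m x) * cnj (w x)" for x
  let ?W = "LINT x|area. m x * (cmod (w x))\<^sup>2"
  note sm = localized_smooth[OF m(1)]
  have w: "square_integrable \<Omega> w"
    unfolding w_def [abs_def] using c by (intro square_integrable_diff si_u square_integrable_cut) auto
  have \<psi>: "square_integrable \<Omega> \<psi>"
    unfolding \<psi>_def [abs_def] by (intro smooth_mult_square_integrable sm square_integrable_cnj w)
  have \<psi>0: "\<psi> x = 0" if "x \<notin> ball p d" for x using localized_outside[OF m(1) that] by (simp add: \<psi>_def)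
  have m\<psi>: "mass \<Omega> \<psi> \<le> ?W"
  proof (rule integral_mono[OF square_integrableD(2)[OF \<psi>] integrable_weight[OF sm w]])
    fix x
    have "(m x)\<^sup>2 \<le> m x" using m(2,3)[of x] by (simp add: power2_eq_square mult_left_le)
    then show "(cmod (\<psi> x))\<^sup>2 \<le> m x * (cmod (w x))\<^sup>2"
      by (simp add: \<psi>_def norm_mult power_mult_distrib mult_right_mono)
  qed
  have t: "0 < 1 - c" using c by simp
  have "Re (LINT x|area. (u x - cut c u x) * \<psi> x) \<le> (1 - c) * (((1 - c) * A + ?W / (1 - c)) / 2)"
  proof (rule difference_quotient[OF H1_u \<psi> _ c])
    fix s assume s: "c \<le> s" "s \<le> 1"
    have s0: "0 < s" using s c by simp
    have "Re (LINT x|area. radial_deriv G s x * \<psi> x) \<le> cmod (LINT x|area. radial_deriv G s x * \<psi> x)"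
      by (rule complex_Re_le_cmod)
    also have "2 * \<dots> \<le> (1 - c) * mass \<Omega> (radial_deriv G s) + mass \<Omega> \<psi> / (1 - c)"
      by (rule young_integral[OF square_integrable_radial[OF H1_u s0 s(2)] \<psi> t])
    also have "\<dots> \<le> (1 - c) * A + ?W / (1 - c)"
      using A[OF s] m\<psi> t by (intro add_mono mult_left_mono divide_right_mono) auto
    finally show "Re (LINT x|area. radial_deriv G s x * \<psi> x) \<le> ((1 - c) * A + ?W / (1 - c)) / 2" by simp
  qed (rule \<psi>0)
  moreover have "(u x - cut c u x) * \<psi> x = complex_of_real (m x * (cmod (w x))\<^sup>2)" for x
    unfolding of_real_mult of_real_cmod_sq \<psi>_def w_def by (simp only: mult_ac)
  ultimately have "?W \<le> (1 - c) * (((1 - c) * A + ?W / (1 - c)) / 2)"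
    by (simp only: integral_complex_of_real Re_complex_of_real)
  also have "\<dots> = (1 - c)\<^sup>2 * A / 2 + ?W / 2" using t by (simp add: field_simps power2_eq_square)
  finally show ?thesis by (simp add: w_def)
qed

text \<open>The dilation inequality divided by \<open>1 - c\<close>, in the limit \<open>c \<rightarrow> 1\<close> for a fixed eigenfunction. The constant
  \<open>C\<close> depends only on the cutoff, hence the error term is uniform along a sequence of eigenfunctions, while
  the bound \<open>A\<close> on dilated radial derivatives may depend on \<open>u\<close> because it disappears in the limit.
  The last term of the dilation inequality is a pairing of \<open>u - u \<circ> \<delta>\<^sub>c\<close> with \<open>2 k\<close> times the conjugate
  radial derivative; \<open>2 Re (a b) \<le> |a|\<^sup>2 + |b|\<^sup>2\<close> yields twice the radial energy.\<close>

lemma virial_inequality: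
  assumes m: "localized (\<lambda>x. complex_of_real (m x))" "\<And>x. 0 \<le> m x" "\<And>x. m x \<le> 1"
    and k: "localized (\<lambda>x. complex_of_real (k x))" "\<And>x. 0 \<le> k x"
    and grad: "\<And>i x. pd i (\<lambda>x. of_real (m x)) x = - of_real (k x) * offset p i x"
    and C: "0 \<le> C" "\<And>s x. 1 / 2 \<le> s \<Longrightarrow> s \<le> 1 \<Longrightarrow> \<bar>m (dil p (1 / s) x) - m x\<bar> \<le> C * (1 - s)"
      "\<And>i s x. 1 / 2 \<le> s \<Longrightarrow> s \<le> 1 \<Longrightarrow>
         cmod (of_real (1 / s) * pd i (\<lambda>x. of_real (m x)) (dil p (1 / s) x) - pd i (\<lambda>x. of_real (m x)) x) \<le> C * (1 - s)"
      "\<And>s x. 1 / 2 \<le> s \<Longrightarrow> s \<le> 1 \<Longrightarrow> \<bar>(1 / s) ^ 4 * k (dil p (1 / s) x) - k x\<bar> \<le> C * (1 - s)"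
    and \<mu>: "0 < \<mu>"
  shows "\<mu> * (LINT x|area. m x * (cmod (u x))\<^sup>2) \<le>
    (LINT x|area. k x * (cmod (radial_part x))\<^sup>2) + C * sqrt \<mu>"
proof -
  note sm = localized_smooth[OF m(1)] and sk = localized_smooth[OF k(1)]
  obtain A where A: "\<And>s. 1 / 2 \<le> s \<Longrightarrow> s \<le> 1 \<Longrightarrow> mass \<Omega> (radial_deriv G s) \<le> A"
    using mass_radial_le[OF H1_u, of "1 / 2"] by auto
  define Q where "Q = (LINT x|area. m x * (cmod (u x))\<^sup>2)"
  define K where "K = (LINT x|area. k x * (cmod (radial_part x))\<^sup>2)"
  define g where "g = mass \<Omega> radial_part"
  have main: "2 * \<mu> * Q \<le> 2 * K + 2 * C * sqrt \<mu> + \<tau> * (2 * \<mu> * C + \<mu> * A + C * g)"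
    if \<tau>: "0 < \<tau>" "\<tau> \<le> 1 / 2" for \<tau>
  proof -
    define c where "c = 1 - \<tau>"
    have c: "1 / 2 \<le> c" "0 < c" "c < 1" "c \<le> 1" "1 - c = \<tau>" using \<tau> by (auto simp: c_def)
    let ?mc = "\<lambda>x. m (dil p (1 / c) x)"
    have mc: "localized (\<lambda>x. complex_of_real (?mc x))" by (rule localized_dil[OF m(1) c(2,4)])
    note smc = localized_smooth[OF mc]
    define w where "w x = u x - cut c u x" for x
    define Qc where "Qc = (LINT x|area. ?mc x * (cmod (u x))\<^sup>2)"
    define W where "W = (LINT x|area. m x * (cmod (w x))\<^sup>2)"
    define X where "X = Re (LINT x|area. (\<Sum>i\<in>UNIV. pd i (\<lambda>x. of_real (m x)) x * (G x $ i * cnj (w x))))"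
    have start: "0 \<le> \<mu> * (1 - 1 / c\<^sup>2) * Qc + \<mu> * W - (flux ?mc - flux m) - 2 * X"
      unfolding Qc_def W_def X_def w_def by (rule dilation_inequality[OF m(1,2) c(2,4)])
    have T1: "\<mu> * (1 - 1 / c\<^sup>2) * Qc \<le> - (2 * \<tau> * \<mu>) * (Q - C * \<tau>)"
    proof -
      have Qc0: "0 \<le> Qc" unfolding Qc_def by (intro integral_nonneg_AE AE_I2 mult_nonneg_nonneg m) simp
      have "Q - C * \<tau> \<le> Qc"
      proof -
        have iu: "integrable area (\<lambda>x. C * \<tau> * (cmod (u x))\<^sup>2)"
          using square_integrableD(2)[OF si_u] by simp
        have "Q \<le> (LINT x|area. ?mc x * (cmod (u x))\<^sup>2 + C * \<tau> * (cmod (u x))\<^sup>2)"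
          unfolding Q_def
        proof (rule integral_mono)
          show "integrable area (\<lambda>x. m x * (cmod (u x))\<^sup>2)" by (rule integrable_weight[OF sm si_u])
          show "integrable area (\<lambda>x. ?mc x * (cmod (u x))\<^sup>2 + C * \<tau> * (cmod (u x))\<^sup>2)"
            by (intro Bochner_Integration.integrable_add integrable_weight[OF smc si_u] iu)
          fix x
          have "m x \<le> ?mc x + C * \<tau>" using C(2)[OF c(1,4), of x] c(5) by auto
          then have "m x * (cmod (u x))\<^sup>2 \<le> (?mc x + C * \<tau>) * (cmod (u x))\<^sup>2" by (rule mult_right_mono) simp
          then show "m x * (cmod (u x))\<^sup>2 \<le> ?mc x * (cmod (u x))\<^sup>2 + C * \<tau> * (cmod (u x))\<^sup>2"
            by (simp only: distrib_right)
        qed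
        also have "\<dots> = Qc + C * \<tau>"
          unfolding Qc_def Bochner_Integration.integral_add[OF integrable_weight[OF smc si_u] iu]
          using normalized by simp
        finally show ?thesis by simp
      qed
      then have a: "(2 * \<tau> * \<mu>) * (Q - C * \<tau>) \<le> (2 * \<tau> * \<mu>) * Qc" using \<tau> \<mu> by (intro mult_left_mono) auto
      \<comment> \<open>The Jacobian factor supplies the leading term \<open>- 2 \<tau> \<mu> Q\<close>.\<close>
      have "1 + 2 * \<tau> \<le> 1 / c\<^sup>2"
      proof -
        have "c\<^sup>2 * (1 + 2 * \<tau>) = 1 - \<tau>\<^sup>2 * (3 - 2 * \<tau>)"
          unfolding c_def by (simp add: power2_eq_square algebra_simps)
        also have "\<dots> \<le> 1" using \<tau> by simp
        finally show ?thesis using c(2) by (simp add: field_simps)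
      qed
      then have "\<mu> * (1 - 1 / c\<^sup>2) * Qc \<le> \<mu> * (- (2 * \<tau>)) * Qc"
        using \<mu> Qc0 by (intro mult_right_mono mult_left_mono) auto
      then show ?thesis using a by (simp add: algebra_simps)
    qed
    have T2: "W \<le> \<tau>\<^sup>2 * A"
      unfolding W_def w_def using difference_mass_le[OF m _ c(2,3), of A] A c by simp
    have T3: "\<bar>flux ?mc - flux m\<bar> \<le> 2 * (C * \<tau>) * sqrt \<mu>"
    proof -
      let ?q = "\<lambda>i x. pd i (\<lambda>x. of_real (?mc x)) x - pd i (\<lambda>x. of_real (m x)) x"
      have pdc: "pd i (\<lambda>x. complex_of_real (?mc x)) x = of_real (1 / c) * pd i (\<lambda>x. of_real (m x)) (dil p (1 / c) x)" for i x
        by (rule pd_dil[OF smooth_differentiable[OF sm]])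
      have i: "integrable area (\<lambda>x. \<Sum>i\<in>UNIV. pd i f x * (G x $ i * cnj (u x)))" if "smooth f" for f
        by (intro Bochner_Integration.integrable_sum integrable_smooth_mult smooth_pd that si_G si_u)
      have "flux ?mc - flux m = Re (LINT x|area. (\<Sum>i\<in>UNIV. ?q i x * (G x $ i * cnj (u x))))"
        unfolding flux_def left_diff_distrib sum_subtractf Bochner_Integration.integral_diff[OF i[OF smc] i[OF sm]] by simp
      also have "\<bar>\<dots>\<bar> \<le> 2 * (C * \<tau>) * sqrt \<mu>"
      proof (rule flux_bound[OF _ _ _ \<mu>])
        show "smooth (?q i)" for i by (intro smooth_diff smooth_pd sm smc)
        show "cmod (?q i x) \<le> C * \<tau>" for i x using C(3)[OF c(1,4), of i x] unfolding pdc c(5) .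
      qed (use C \<tau> in auto)
      finally show ?thesis .
    qed
    have T4: "- 2 * X \<le> \<tau> * (2 * K + C * \<tau> * g)"
    proof -
      define \<psi> where "\<psi> x = complex_of_real (2 * k x) * cnj (radial_part x)" for x
      have s2k: "smooth (\<lambda>x. complex_of_real (2 * k x))" unfolding of_real_mult by (intro smooth_mult sk smooth_const)
      have \<psi>: "square_integrable \<Omega> \<psi>"
        unfolding \<psi>_def [abs_def] by (intro smooth_mult_square_integrable square_integrable_cnj si_radial_part s2k)
      have k0: "k x = 0" if "x \<notin> ball p d" for x using localized_outside[OF k(1) that] by simp
      have w: "square_integrable \<Omega> w"
        unfolding w_def [abs_def] using c by (intro square_integrable_diff si_u square_integrable_cut) auto
      have "- 2 * X = Re (LINT x|area. w x * \<psi> x)"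
      proof -
        \<comment> \<open>The gradient of the cutoff is \<open>- k (x - p)\<close>, so the sum is a radial derivative.\<close>
        have pt: "(\<Sum>i\<in>UNIV. pd i (\<lambda>x. of_real (m x)) x * (G x $ i * cnj (w x))) = (- 1 / 2) * cnj (w x * \<psi> x)" for x
          unfolding grad \<psi>_def radial_part_def by (simp add: sum_2 algebra_simps)
        show ?thesis unfolding X_def pt integral_mult_right_zero integral_cnj by (simp del: complex_cnj_mult)
      qed
      also have "\<dots> \<le> (1 - c) * (2 * K + C * \<tau> * g)"
        unfolding w_def
      proof (rule difference_quotient[OF H1_u \<psi> _ c(2,3)])
        show "\<psi> x = 0" if "x \<notin> ball p d" for x using k0[OF that] by (simp add: \<psi>_def)
        fix s assume s: "c \<le> s" "s \<le> 1"
        have s0: "0 < s" "1 / 2 \<le> s" using s c by auto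
        note sir = square_integrable_radial[OF H1_u s0(1) s(2)]
        have i\<psi>: "integrable area (\<lambda>x. radial_deriv G s x * \<psi> x)"
          by (rule square_integrable_mult_integrable[OF sir \<psi>])
        have "Re (LINT x|area. radial_deriv G s x * \<psi> x) = (LINT x|area. Re (radial_deriv G s x * \<psi> x))"
          by (rule integral_Re[OF i\<psi>, symmetric])
        also have "\<dots> \<le> (LINT x|area. k x * (cmod (radial_deriv G s x))\<^sup>2 + k x * (cmod (radial_part x))\<^sup>2)"
        proof (rule integral_mono)
          show "integrable area (\<lambda>x. Re (radial_deriv G s x * \<psi> x))" by (rule integrable_Re[OF i\<psi>])
          show "integrable area (\<lambda>x. k x * (cmod (radial_deriv G s x))\<^sup>2 + k x * (cmod (radial_part x))\<^sup>2)"
            by (intro Bochner_Integration.integrable_add integrable_weight sk sir si_radial_part)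
          fix x
          have "0 \<le> k x * (cmod (radial_deriv G s x - radial_part x))\<^sup>2" using k(2) by simp
          also have "\<dots> = k x * (cmod (radial_deriv G s x))\<^sup>2 + k x * (cmod (radial_part x))\<^sup>2 - Re (radial_deriv G s x * \<psi> x)"
            unfolding cmod_power2 \<psi>_def by (simp add: power2_eq_square algebra_simps)
          finally show "Re (radial_deriv G s x * \<psi> x) \<le> k x * (cmod (radial_deriv G s x))\<^sup>2 + k x * (cmod (radial_part x))\<^sup>2" by simp
        qed
        also have "\<dots> = (LINT x|area. k x * (cmod (radial_deriv G s x))\<^sup>2) + K"
          unfolding K_def by (rule Bochner_Integration.integral_add[OF integrable_weight[OF sk sir] integrable_weight[OF sk si_radial_part]])
        also have "\<dots> \<le> K + C * (1 - s) * g + K"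
          unfolding K_def g_def using radial_weight_le[OF k(1) C(1) C(4)[OF s0(2) s(2)] s0(1) s(2)] by simp
        also have "\<dots> \<le> 2 * K + C * \<tau> * g"
        proof -
          have "C * (1 - s) * g \<le> C * \<tau> * g"
            unfolding g_def using s c C(1) by (intro mult_right_mono mult_left_mono) auto
          then show ?thesis by simp
        qed
        finally show "Re (LINT x|area. radial_deriv G s x * \<psi> x) \<le> 2 * K + C * \<tau> * g" .
      qed
      finally show ?thesis unfolding c(5) .
    qed
    have "\<mu> * W \<le> \<mu> * (\<tau>\<^sup>2 * A)" using T2 \<mu> by (intro mult_left_mono) auto
    then have "0 \<le> - (2 * \<tau> * \<mu>) * (Q - C * \<tau>) + \<mu> * (\<tau>\<^sup>2 * A) + 2 * (C * \<tau>) * sqrt \<mu> + \<tau> * (2 * K + C * \<tau> * g)"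
      using start T1 T3 T4 by linarith
    also have "\<dots> = \<tau> * (2 * K + 2 * C * sqrt \<mu> + \<tau> * (2 * \<mu> * C + \<mu> * A + C * g) - 2 * \<mu> * Q)"
      by (simp add: algebra_simps power2_eq_square)
    finally show ?thesis using \<tau>(1) by (simp add: zero_le_mult_iff)
  qed
  have "2 * \<mu> * Q \<le> 2 * K + 2 * C * sqrt \<mu>"
  proof (rule tendsto_lowerbound[of "\<lambda>\<tau>. 2 * K + 2 * C * sqrt \<mu> + \<tau> * (2 * \<mu> * C + \<mu> * A + C * g)" _ "at_right 0"])
    have "((\<lambda>\<tau>. 2 * K + 2 * C * sqrt \<mu> + \<tau> * (2 * \<mu> * C + \<mu> * A + C * g)) \<longlongrightarrow>
        2 * K + 2 * C * sqrt \<mu> + 0 * (2 * \<mu> * C + \<mu> * A + C * g)) (at_right 0)"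
      by (intro tendsto_intros)
    then show "((\<lambda>\<tau>. 2 * K + 2 * C * sqrt \<mu> + \<tau> * (2 * \<mu> * C + \<mu> * A + C * g)) \<longlongrightarrow>
        2 * K + 2 * C * sqrt \<mu>) (at_right 0)" by (simp only: mult_zero_left add_0_right)
    show "\<forall>\<^sub>F \<tau> in at_right 0. 2 * \<mu> * Q \<le> 2 * K + 2 * C * sqrt \<mu> + \<tau> * (2 * \<mu> * C + \<mu> * A + C * g)"
      unfolding eventually_at_right_field using main by (intro exI[of _ "1 / 2"]) auto
  qed simp
  then show ?thesis unfolding Q_def K_def by simp
qed

text \<open>The tangential part of the energy is nonnegative, and the full energy with a weight is known from the equation up to the flux.\<close>

lemma radial_energy_le:
  assumes k: "localized (\<lambda>x. complex_of_real (k x))" "\<And>x. 0 \<le> k x"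
    and b: "0 \<le> b" "\<And>i x. cmod (pd i (\<lambda>x. complex_of_real (k x * sqdist p x)) x) \<le> b" and \<mu>: "0 < \<mu>"
  shows "(LINT x|area. k x * (cmod (radial_part x))\<^sup>2) \<le>
    \<mu> * (LINT x|area. (k x * sqdist p x) * (cmod (u x))\<^sup>2) + 2 * b * sqrt \<mu>"
proof -
  have n: "localized (\<lambda>x. complex_of_real (k x * sqdist p x))"
    unfolding of_real_mult by (rule localized_mult[OF k(1) smooth_sqdist])
  have "(LINT x|area. k x * (cmod (radial_part x))\<^sup>2) \<le> (LINT x|area. (k x * sqdist p x) * grad_sq x)"
  proof (rule integral_mono)
    show "integrable area (\<lambda>x. k x * (cmod (radial_part x))\<^sup>2)"
      by (rule integrable_weight[OF localized_smooth[OF k(1)] si_radial_part])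
    show "integrable area (\<lambda>x. (k x * sqdist p x) * grad_sq x)"
      by (rule integrable_gsq[OF localized_smooth[OF n]])
    show "k x * (cmod (radial_part x))\<^sup>2 \<le> (k x * sqdist p x) * grad_sq x" for x
      unfolding mult.assoc by (intro mult_left_mono radial_part_le k)
  qed
  also have "\<dots> = \<mu> * (LINT x|area. (k x * sqdist p x) * (cmod (u x))\<^sup>2) - flux (\<lambda>x. k x * sqdist p x)"
    by (rule eig_weight[OF n])
  also have "\<bar>flux (\<lambda>x. k x * sqdist p x)\<bar> \<le> 2 * b * sqrt \<mu>"
    unfolding flux_def by (rule flux_bound[OF smooth_pd[OF localized_smooth[OF n]] b(2) b(1) \<mu>])
  then have "\<mu> * (LINT x|area. (k x * sqdist p x) * (cmod (u x))\<^sup>2) - flux (\<lambda>x. k x * sqdist p x) \<le>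
      \<mu> * (LINT x|area. (k x * sqdist p x) * (cmod (u x))\<^sup>2) + 2 * b * sqrt \<mu>" by linarith
  finally show ?thesis .
qed

end

section \<open>A radial cutoff of small logarithmic slope\<close>

text \<open>Squared distances serve as variable, so that the centre needs no special treatment. The cutoff descends
  from \<open>1\<close> to \<open>0\<close> on \<open>[a, b]\<close>; on the inner interval \<open>[a1, b1]\<close> its unnormalised slope is close, for small \<open>\<delta>\<close>, to
  \<open>1 / (2 s)\<close>, the slope of half the logarithm. The parameter \<open>\<delta>\<close> measures how abruptly the slope
  is switched on and off; the chosen value makes the unnormalised descent at least \<open>\<beta>\<close>, because
  \<open>exp (- x) \<ge> 1 - x\<close>.\<close>

context
  fixes a a1 b1 b \<beta> \<delta> :: real
  assumes order: "0 < a" "a < a1" "a1 < b1" "b1 < b"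
    and \<beta>: "0 < \<beta>" "\<beta> < ln (b1 / a1) / 2"
    and \<delta>: "\<delta> = (1 - \<beta> / (ln (b1 / a1) / 2)) / (1 / a1 + 1 / (a1 - a) + 1 / (b - b1))"
begin

text \<open>The first flat factor equals \<open>(\<delta> / s) exp (- \<delta> / s)\<close>. It provides the factor \<open>1 / s\<close> in a form that
  is smooth on the whole line.\<close>

definition slope :: "real \<Rightarrow> real" where
  "slope s = (1 / (2 * \<delta>)) * flat_exp [:0, 1:] (s / \<delta>) * flat_exp 1 ((s - a) / \<delta>) * flat_exp 1 ((b - s) / \<delta>)"

definition total :: real where "total = integral {-1..b} slope"

text \<open>The lower limit \<open>-1\<close> keeps the values \<open>s \<ge> 0\<close> of the squared distance in the interior of the interval, where
  the integral has a two-sided derivative.\<close>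

definition step :: "real \<Rightarrow> real" where "step s = 1 - (1 / total) * integral {-1..s} slope"

lemma kappa_pos: "0 < 1 / a1 + 1 / (a1 - a) + 1 / (b - b1)"
  using order by (intro add_pos_pos) auto

lemma delta_pos: "\<delta> > 0"
  unfolding \<delta> using \<beta> kappa_pos by (intro divide_pos_pos) auto

lemma slope_eq: "slope s = (if a < s \<and> s < b then exp (- \<delta> / s) * exp (- \<delta> / (s - a)) * exp (- \<delta> / (b - s)) / (2 * s) else 0)"
  using order delta_pos by (auto simp: slope_def flat_exp_def zero_less_divide_iff field_simps)

lemma slope_nonneg: "0 \<le> slope s"
  using order by (auto simp: slope_eq)

lemma slope_le: "2 * s * slope s \<le> 1"
proof (cases "a < s \<and> s < b")
  case True
  then have "exp (- \<delta> / s) * exp (- \<delta> / (s - a)) * exp (- \<delta> / (b - s)) \<le> 1 * 1 * 1"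
    using order delta_pos by (intro mult_mono) auto
  then show ?thesis using True order by (simp add: slope_eq)
qed (auto simp: slope_eq)

lemma isCont_slope: "isCont slope s"
proof -
  have fe: "isCont (flat_exp q) t" for q t using DERIV_isCont[OF flat_exp_deriv] .
  have "isCont (\<lambda>s. s / \<delta>) s" "isCont (\<lambda>s. (s - a) / \<delta>) s" "isCont (\<lambda>s. (b - s) / \<delta>) s"
    using delta_pos by (intro continuous_intros; simp)+
  then show ?thesis
    unfolding slope_def [abs_def] using fe by (intro continuous_mult isCont_o2[of s _ "flat_exp _"] continuous_const)
qed

lemma continuous_slope: "continuous_on S slope"
  using isCont_slope continuous_at_imp_continuous_on by blast

lemma integrable_slope: "slope integrable_on {u..v}"
  by (rule integrable_continuous_real[OF continuous_slope])

text \<open>On \<open>[a1, b1]\<close> the product of the exponentials is at least \<open>\<beta>\<close> divided by half of \<open>ln (b1 / a1)\<close>, the integral of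
  \<open>1 / (2 s)\<close> there.\<close>

lemma total_ge: "\<beta> \<le> total"
proof -
  let ?L = "ln (b1 / a1) / 2" and ?\<kappa> = "1 / a1 + 1 / (a1 - a) + 1 / (b - b1)"
  have L: "?L > 0" using \<beta> by linarith
  have "1 - \<delta> * ?\<kappa> \<le> exp (- (\<delta> * ?\<kappa>))" using exp_ge_add_one_self[of "- (\<delta> * ?\<kappa>)"] by simp
  moreover have "\<delta> * ?\<kappa> = 1 - \<beta> / ?L" unfolding \<delta> using kappa_pos by simp
  ultimately have e: "\<beta> / ?L \<le> exp (- (\<delta> * ?\<kappa>))" by simp
  have der: "((\<lambda>s. ln s / 2) has_vector_derivative 1 / (2 * s)) (at s within {a1..b1})" if "s \<in> {a1..b1}" for s
    using that order by (auto intro!: derivative_eq_intros has_vector_derivative_at_within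
        simp: has_real_derivative_iff_has_vector_derivative[symmetric])
  have "((\<lambda>s. 1 / (2 * s)) has_integral (ln b1 / 2 - ln a1 / 2)) {a1..b1}"
    using order by (intro fundamental_theorem_of_calculus der) auto
  also have "ln b1 / 2 - ln a1 / 2 = ?L" using order by (simp add: ln_div)
  finally have int: "((\<lambda>s. exp (- (\<delta> * ?\<kappa>)) * (1 / (2 * s))) has_integral exp (- (\<delta> * ?\<kappa>)) * ?L) {a1..b1}"
    by (rule has_integral_mult_right)
  have "\<beta> = (\<beta> / ?L) * ?L" using L by simp
  also have "\<dots> \<le> exp (- (\<delta> * ?\<kappa>)) * ?L" using e L by (intro mult_right_mono) auto
  also have "\<dots> = integral {a1..b1} (\<lambda>s. exp (- (\<delta> * ?\<kappa>)) * (1 / (2 * s)))"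
    using integral_unique[OF int] by simp
  also have "\<dots> \<le> integral {a1..b1} slope"
  proof (rule integral_le[OF has_integral_integrable[OF int] integrable_slope])
    fix s assume s: "s \<in> {a1..b1}"
    have "1 / s \<le> 1 / a1" "1 / (s - a) \<le> 1 / (a1 - a)" "1 / (b - s) \<le> 1 / (b - b1)"
      using s order by (intro divide_left_mono; simp)+
    then have "1 / s + 1 / (s - a) + 1 / (b - s) \<le> ?\<kappa>" by linarith
    then have "\<delta> * (1 / s + 1 / (s - a) + 1 / (b - s)) \<le> \<delta> * ?\<kappa>"
      using delta_pos by (intro mult_left_mono) auto
    then have "exp (- (\<delta> * ?\<kappa>)) \<le> exp (- (\<delta> * (1 / s + 1 / (s - a) + 1 / (b - s))))" by simp
    also have "\<dots> = exp (- \<delta> / s) * exp (- \<delta> / (s - a)) * exp (- \<delta> / (b - s))"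
      unfolding exp_add[symmetric] by (simp add: algebra_simps)
    finally show "exp (- (\<delta> * ?\<kappa>)) * (1 / (2 * s)) \<le> slope s"
      using s order by (simp add: slope_eq divide_right_mono)
  qed
  also have "\<dots> \<le> total" unfolding total_def
    using order slope_nonneg by (intro integral_subset_le integrable_slope) auto
  finally show ?thesis .
qed

lemma total_pos: "0 < total" using total_ge \<beta> by linarith

lemma step_deriv:
  assumes "s > -1" shows "(step has_real_derivative - (slope s / total)) (at s)"
proof -
  have "((\<lambda>s. integral {-1..s} slope) has_real_derivative slope s) (at s within {-1..s + 1})"
    using assms by (intro integral_has_real_derivative continuous_slope) auto
  moreover have "at s within {-1..s + 1} = at s"
    using assms by (intro at_within_Icc_at) auto
  ultimately have "((\<lambda>s. integral {-1..s} slope) has_real_derivative slope s) (at s)" by simp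
  then show ?thesis unfolding step_def [abs_def]
    using total_pos by (auto intro!: derivative_eq_intros)
qed

lemma step_eq_1: "s \<le> a \<Longrightarrow> step s = 1"
proof -
  assume "s \<le> a"
  then have "integral {-1..s} slope = 0"
    by (intro integral_unique[OF has_integral_is_0]) (simp add: slope_eq)
  then show "step s = 1" by (simp add: step_def)
qed

lemma step_bounds: "-1 \<le> s \<Longrightarrow> 0 \<le> step s" "step s \<le> 1"
proof -
  show "step s \<le> 1"
    using total_pos slope_nonneg by (simp add: step_def integral_nonneg integrable_slope)
  assume s: "-1 \<le> s"
  have "integral {-1..s} slope \<le> integral {-1..max s b} slope"
    using slope_nonneg by (intro integral_subset_le integrable_slope) auto
  also have "\<dots> = total + integral {b..max s b} slope"
    unfolding total_def using order by (subst Henstock_Kurzweil_Integration.integral_combine) (auto intro: integrable_slope)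
  also have "integral {b..max s b} slope = 0"
    by (intro integral_unique[OF has_integral_is_0]) (simp add: slope_eq)
  finally show "0 \<le> step s" using total_pos by (simp add: step_def)
qed

lemma step_eq_0: "b \<le> s \<Longrightarrow> step s = 0"
proof -
  assume s: "b \<le> s"
  have "integral {-1..s} slope = total + integral {b..s} slope"
    unfolding total_def using order s by (subst Henstock_Kurzweil_Integration.integral_combine) (auto intro: integrable_slope)
  also have "integral {b..s} slope = 0"
    by (intro integral_unique[OF has_integral_is_0]) (simp add: slope_eq)
  finally show "step s = 0" using total_pos by (simp add: step_def)
qed

text \<open>The right-hand side is \<open>m + r \<partial>\<^sub>r m\<close> at \<open>r = sqrt s\<close>. Here \<open>- r \<partial>\<^sub>r m\<close> is the unnormalised slope
  \<open>2 s slope s \<le> 1\<close> divided by the descent to which it leads.\<close>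

lemma step_virial: "-1 \<le> s \<Longrightarrow> - (1 / \<beta>) \<le> step s - 2 * slope s / total * s"
proof -
  assume "-1 \<le> s"
  have "2 * slope s / total * s = (2 * s * slope s) / total" by simp
  also have "\<dots> \<le> 1 / total" using slope_le total_pos by (intro divide_right_mono) auto
  also have "\<dots> \<le> 1 / \<beta>" using total_ge \<beta> by (intro divide_left_mono) auto
  finally show "- (1 / \<beta>) \<le> step s - 2 * slope s / total * s"
    using step_bounds(1)[OF \<open>-1 \<le> s\<close>] by linarith
qed

lemma smooth_slope: "smooth (\<lambda>x. complex_of_real (slope (sqdist p x)))"
proof -
  have l: "smooth (\<lambda>x. complex_of_real ((c + e * sqdist p x) / \<delta>))" for c e
  proof -
    have "smooth (\<lambda>x. of_real (1 / \<delta>) * (of_real c + of_real e * complex_of_real (sqdist p x)))"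
      by (intro smooth_mult smooth_add smooth_const smooth_sqdist)
    then show ?thesis by simp
  qed
  have "smooth (\<lambda>x. complex_of_real (flat_exp [:0, 1:] (sqdist p x / \<delta>)))"
    "smooth (\<lambda>x. complex_of_real (flat_exp 1 ((sqdist p x - a) / \<delta>)))"
    "smooth (\<lambda>x. complex_of_real (flat_exp 1 ((b - sqdist p x) / \<delta>)))"
    using smooth_flat_exp[OF l[of 0 1]] smooth_flat_exp[OF l[of "- a" 1]] smooth_flat_exp[OF l[of b "-1"]]
    by simp_all
  then show ?thesis unfolding slope_def of_real_mult by (intro smooth_mult smooth_const)
qed

lemma pd_step:
  "(\<lambda>x. complex_of_real (step (sqdist p x))) differentiable (at x)"
  "pd i (\<lambda>x. complex_of_real (step (sqdist p x))) x = - of_real (2 * slope (sqdist p x) / total) * offset p i x"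
proof -
  have "-1 < sqdist p x" using zero_le_power2[of "norm (x - p)"] unfolding sqdist_def by linarith
  note chain = chain_of_real[OF step_deriv[OF this] smooth_differentiable[OF smooth_sqdist]]
  show "(\<lambda>x. complex_of_real (step (sqdist p x))) differentiable (at x)" by (rule chain(1))
  show "pd i (\<lambda>x. complex_of_real (step (sqdist p x))) x = - of_real (2 * slope (sqdist p x) / total) * offset p i x"
    unfolding chain(2) pd_sqdist by (simp add: offset_def)
qed

lemma smooth_weight: "smooth (\<lambda>x. complex_of_real (2 * slope (sqdist p x) / total))"
proof -
  have "smooth (\<lambda>x. of_real (2 / total) * complex_of_real (slope (sqdist p x)))"
    by (intro smooth_mult smooth_const smooth_slope)
  then show ?thesis by simp
qed

lemma smooth_step: "smooth (\<lambda>x. complex_of_real (step (sqdist p x)))"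
proof (rule smooth_generated[of "\<lambda>f. f = (\<lambda>x. complex_of_real (step (sqdist p x)))"])
  fix g :: "real^2 \<Rightarrow> complex" and i assume g: "g = (\<lambda>x. complex_of_real (step (sqdist p x)))"
  have "pd i g = (\<lambda>x. (- 1) * complex_of_real (2 * slope (sqdist p x) / total) * offset p i x)"
    unfolding g fun_eq_iff pd_step(2) by simp
  then show "generated_by (\<lambda>f. f = (\<lambda>x. complex_of_real (step (sqdist p x)))) (pd i g)"
    by (simp only:) (intro generated_by.smooth smooth_mult smooth_const smooth_weight smooth_offset)
qed (auto intro: generated_by.base pd_step(1))

end

lemma one_minus_less_ln_inverse:
  assumes "0 < \<alpha>" "\<alpha> < (1::real)" shows "1 - \<alpha> < ln (1 / \<alpha>)"
proof -
  have "ln \<alpha> < \<alpha> - 1"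
    using assms ln_eq_minus_one[of \<alpha>] ln_le_minus_one[of \<alpha>] by (auto simp: less_le)
  then show ?thesis using assms by (simp add: ln_div)
qed

text \<open>The descent begins at radius \<open>\<alpha> d\<close> and ends at \<open>d exp (- t)\<close>, inside the disc. It is steepest between
  \<open>\<alpha> d exp t\<close> and \<open>d exp (- 2 t)\<close>, whose logarithmic distance \<open>ln (1 / \<alpha>) - 3 t\<close> still exceeds
  \<open>1 - \<alpha>\<close>.\<close>

lemma (in conic_at) radial_cutoff:
  assumes \<alpha>: "0 < \<alpha>" "\<alpha> < 1"
  obtains m k where "localized (\<lambda>x. complex_of_real (m x))" "\<And>x. 0 \<le> m x" "\<And>x. m x \<le> 1"
    "localized (\<lambda>x. complex_of_real (k x))" "\<And>x. 0 \<le> k x"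
    "\<And>i x. pd i (\<lambda>x. of_real (m x)) x = - of_real (k x) * offset p i x"
    "\<And>x. x \<in> ball p (\<alpha> * d) \<Longrightarrow> m x - k x * sqdist p x = 1"
    "\<And>x. - (1 / (1 - \<alpha>)) \<le> m x - k x * sqdist p x"
proof -
  define t where "t = (ln (1 / \<alpha>) - (1 - \<alpha>)) / 4"
  have t: "0 < t" "ln (1 / \<alpha>) - 3 * t > 1 - \<alpha>"
  proof -
    have "4 * t = ln (1 / \<alpha>) - (1 - \<alpha>)" by (simp add: t_def)
    then show "0 < t" "ln (1 / \<alpha>) - 3 * t > 1 - \<alpha>"
      using one_minus_less_ln_inverse[OF \<alpha>] by linarith+
  qed
  define a where "a = (\<alpha> * d)\<^sup>2"
  define a1 where "a1 = (\<alpha> * d * exp t)\<^sup>2"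
  define b1 where "b1 = (d * exp (- (2 * t)))\<^sup>2"
  define b where "b = (d * exp (- t))\<^sup>2"
  have ln: "ln (b1 / a1) / 2 = ln (1 / \<alpha>) - 3 * t"
    unfolding a1_def b1_def using \<alpha> d_pos by (simp add: ln_div ln_mult ln_realpow)
  have "1 < b1 / a1"
  proof (rule ccontr)
    assume "\<not> 1 < b1 / a1"
    moreover have "0 < b1 / a1" unfolding a1_def b1_def using \<alpha> d_pos by simp
    ultimately have "ln (b1 / a1) \<le> 0" by simp
    then show False using ln t \<alpha> by linarith
  qed
  then have "a1 < b1" using \<alpha> d_pos by (simp add: a1_def)
  moreover have "a < a1" unfolding a_def a1_def using \<alpha> d_pos t by (intro power_strict_mono) auto
  moreover have "b1 < b" unfolding b_def b1_def using d_pos t by (intro power_strict_mono) auto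
  moreover have "0 < a" unfolding a_def using \<alpha> d_pos by simp
  ultimately have order: "0 < a" "a < a1" "a1 < b1" "b1 < b" by auto
  have \<beta>: "0 < 1 - \<alpha>" "1 - \<alpha> < ln (b1 / a1) / 2" using \<alpha> t ln by auto
  define \<delta> where "\<delta> = (1 - (1 - \<alpha>) / (ln (b1 / a1) / 2)) / (1 / a1 + 1 / (a1 - a) + 1 / (b - b1))"
  note facts = order \<beta> \<delta>_def
  define m where "m x = step a b \<delta> (sqdist p x)" for x
  define k where "k x = 2 * slope a b \<delta> (sqdist p x) / total a b \<delta>" for x
  have sq: "0 \<le> sqdist p x" "-1 \<le> sqdist p x" for x
    using zero_le_power2[of "norm (x - p)"] unfolding sqdist_def by linarith+
  have out: "b \<le> sqdist p x" if "x \<notin> cball p (d * exp (- t))" for x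
    unfolding b_def sqdist_def using that d_pos by (intro power_mono) (auto simp: dist_norm norm_minus_commute)
  have R: "d * exp (- t) < d" using d_pos t by simp
  have lm: "localized (\<lambda>x. complex_of_real (m x))"
    unfolding localized_def m_def using smooth_step[OF facts] step_eq_0[OF facts] out R by auto
  have lk: "localized (\<lambda>x. complex_of_real (k x))"
  proof -
    have "k x = 0" if "x \<notin> cball p (d * exp (- t))" for x
      unfolding k_def slope_eq[OF facts] using out[OF that] by simp
    then show ?thesis
      unfolding localized_def using smooth_weight[OF facts, of p] R by (auto simp: k_def)
  qed
  show ?thesis
  proof (rule that[OF lm _ _ lk])
    show "0 \<le> m x" "m x \<le> 1" for x
      unfolding m_def by (intro step_bounds[OF facts] sq)+
    show "0 \<le> k x" for x
      unfolding k_def using slope_nonneg[OF facts] total_pos[OF facts] by simp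
    show "pd i (\<lambda>x. of_real (m x)) x = - of_real (k x) * offset p i x" for i x
      unfolding m_def k_def by (rule pd_step(2)[OF facts])
    show "- (1 / (1 - \<alpha>)) \<le> m x - k x * sqdist p x" for x
      unfolding m_def k_def by (rule step_virial[OF facts sq(2)])
    show "m x - k x * sqdist p x = 1" if "x \<in> ball p (\<alpha> * d)" for x
    proof -
      have "sqdist p x \<le> a"
        unfolding a_def sqdist_def using that by (intro power_mono) (auto simp: dist_norm norm_minus_commute)
      then show ?thesis unfolding m_def k_def using step_eq_1[OF facts] slope_eq[OF facts] by simp
    qed
  qed
qed

section \<open>A polygonal domain is conical near a point\<close>

lemma polyline_endpoints:
  "vs \<noteq> [] \<Longrightarrow> pathstart (polyline vs) = hd vs" "vs \<noteq> [] \<Longrightarrow> pathfinish (polyline vs) = last vs"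
  by (induction vs rule: polyline.induct) auto

definition nth_edge :: "(real^2) list \<Rightarrow> nat \<Rightarrow> (real^2) set" where
  "nth_edge vs i = closed_segment (vs ! i) (vs ! Suc i)"

lemma nth_edge_Cons: "nth_edge (v # vs) (Suc i) = nth_edge vs i"
  by (simp add: nth_edge_def)

lemma edges_eq: "edges vs = {(vs ! i, vs ! Suc i) | i. Suc i < length vs}"
  by (auto simp: edges_def set_zip nth_tl)

lemma path_image_polyline:
  "2 \<le> length vs \<Longrightarrow> path_image (polyline vs) = (\<Union>i\<in>{i. Suc i < length vs}. nth_edge vs i)"
proof (induction vs rule: polyline.induct)
  case (4 a b c vs)
  have "path_image (polyline (a # b # c # vs)) = closed_segment a b \<union> path_image (polyline (b # c # vs))"
    by (simp add: path_image_join polyline_endpoints)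
  also have "\<dots> = nth_edge (a # b # c # vs) 0 \<union> (\<Union>i\<in>{i. Suc i < length (b # c # vs)}. nth_edge (a # b # c # vs) (Suc i))"
    using 4 by (simp add: nth_edge_def)
  also have "\<dots> = (\<Union>i\<in>{i. Suc i < length (a # b # c # vs)}. nth_edge (a # b # c # vs) i)"
    (is "?l = ?r")
  proof
    show "?l \<subseteq> ?r" by fastforce
    show "?r \<subseteq> ?l"
    proof
      fix x assume "x \<in> ?r"
      then obtain i where "Suc i < length (a # b # c # vs)" "x \<in> nth_edge (a # b # c # vs) i" by blast
      then show "x \<in> ?l" by (cases i) auto
    qed
  qed
  finally show ?case .
qed (auto simp: nth_edge_def)

lemma arc_polyline_adjacent:
  "arc (polyline vs) \<Longrightarrow> Suc (Suc i) < length vs \<Longrightarrow> nth_edge vs i \<inter> nth_edge vs (Suc i) \<subseteq> {vs ! Suc i}"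
proof (induction vs arbitrary: i rule: polyline.induct)
  case (4 a b c vs)
  have "pathfinish (linepath a b) = pathstart (polyline (b # c # vs))" by (simp add: polyline_endpoints)
  note arc = arc_join_eq[OF this]
  have A: "arc (polyline (b # c # vs))" "closed_segment a b \<inter> path_image (polyline (b # c # vs)) \<subseteq> {b}"
    using "4.prems"(1) arc by (auto simp: polyline_endpoints)
  show ?case
  proof (cases i)
    case 0
    have "nth_edge (b # c # vs) 0 \<subseteq> path_image (polyline (b # c # vs))"
      by (subst path_image_polyline) auto
    then show ?thesis using A(2) 0 by (auto simp: nth_edge_def)
  next
    case (Suc j)
    then show ?thesis using "4.IH"[OF A(1), of j] "4.prems"(2) by (simp add: nth_edge_Cons)
  qed
qed auto

lemma arc_linepath_eq: "arc (linepath a b) \<longleftrightarrow> a \<noteq> b"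
  using arc_linepath arc_distinct_ends by fastforce

lemma not_simple_path_trivial: "\<not> simple_path (linepath a a)"
proof
  assume "simple_path (linepath a a)"
  then have "\<forall>x\<in>{0..1::real}. \<forall>y\<in>{0..1}. x = y \<or> x = 0 \<and> y = 1 \<or> x = 1 \<and> y = 0"
    by (auto simp: simple_path_def loop_free_def linepath_def)
  from bspec[OF bspec[OF this, of 0], of "1 / 2"] show False by simp
qed

text \<open>Cyclically consecutive edges meet only at the common vertex. For edges after the first this follows from
  the arc formed by them. The pairs that involve the first edge are settled by the condition on closed
  paths together with the fact that the first vertex is not on the second edge, nor the second vertex on
  the last edge.\<close>

lemma closed_simple_polygon_adjacent:
  assumes "closed_simple_polygon vs"
  defines "n \<equiv> length vs - 1"
  shows "3 \<le> n" "vs ! n = vs ! 0"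
    "i < n \<Longrightarrow> nth_edge vs i \<inter> nth_edge vs (Suc i mod n) \<subseteq> {vs ! Suc i}"
proof -
  have sp: "simple_path (polyline vs)" and cl: "pathfinish (polyline vs) = pathstart (polyline vs)"
    using assms(1) by (auto simp: closed_simple_polygon_def)
  have "\<exists>x y z w ws. vs = x # y # z # w # ws"
  proof (cases vs rule: polyline.cases)
    case (4 x y z ws)
    have "pathfinish (polyline (y # z # ws)) = pathstart (linepath x y)"
      using cl 4 by (simp add: polyline_endpoints)
    moreover have "pathfinish (linepath x y) = pathstart (polyline (y # z # ws))" by (simp add: polyline_endpoints)
    ultimately have sub: "closed_segment x y \<inter> path_image (polyline (y # z # ws)) \<subseteq> {x, y}" and xy: "x \<noteq> y"
      using sp 4 simple_path_join_loop_eq[of "polyline (y # z # ws)" "linepath x y"]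
      by (auto simp: polyline_endpoints arc_linepath_eq)
    show ?thesis
    proof (cases ws)
      case Nil
      then have "z = x" using cl 4 by simp
      then have "closed_segment x y \<subseteq> {x, y}" using sub Nil by (simp add: closed_segment_commute)
      moreover have "midpoint x y \<in> closed_segment x y" by simp
      ultimately have "midpoint x y \<in> {x, y}" by blast
      then show ?thesis using xy by (simp add: midpoint_eq_endpoint)
    qed (use 4 in auto)
  qed (use sp cl not_simple_path_trivial in auto)
  then obtain x y z w ws where vs: "vs = x # y # z # w # ws" by blast
  define r where "r = y # z # w # ws"
  have vr: "vs = x # r" by (simp add: vs r_def)
  have n: "n = length r" "3 \<le> length r" by (auto simp: n_def vs r_def)
  show "3 \<le> n" using n by simp
  have lastx: "last r = x" using cl by (simp add: vs r_def polyline_endpoints del: last.simps) (simp add: polyline_endpoints)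
  have "r \<noteq> []" by (simp add: r_def)
  then have "vs ! n = last r" using n by (simp add: vr nth_Cons' last_conv_nth)
  then show "vs ! n = vs ! 0" by (simp add: lastx vr)
  have join: "polyline vs = linepath x y +++ polyline r" by (simp add: vs r_def)
  have "pathfinish (polyline r) = pathstart (linepath x y)" using lastx by (simp add: r_def polyline_endpoints)
  moreover have "pathfinish (linepath x y) = pathstart (polyline r)" by (simp add: r_def polyline_endpoints)
  ultimately have arcr: "arc (polyline r)" and sub: "closed_segment x y \<inter> path_image (polyline r) \<subseteq> {x, y}" and xy: "x \<noteq> y"
    using sp join simple_path_join_loop_eq[of "polyline r" "linepath x y"]
    by (auto simp: r_def polyline_endpoints arc_linepath_eq)
  define q where "q = z # w # ws"
  have rq: "polyline r = linepath y z +++ polyline q" by (simp add: r_def q_def)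
  have "pathfinish (linepath y z) = pathstart (polyline q)" by (simp add: q_def polyline_endpoints)
  then have arcq: "arc (polyline q)" "y \<noteq> z" and subq: "closed_segment y z \<inter> path_image (polyline q) \<subseteq> {z}"
    using arcr rq arc_join_eq[of "linepath y z" "polyline q"] by (auto simp: q_def polyline_endpoints arc_linepath_eq)
  have er: "nth_edge r j \<subseteq> path_image (polyline r)" if "Suc j < length r" for j
    using that n by (subst path_image_polyline) auto
  have eq: "nth_edge q j \<subseteq> path_image (polyline q)" if "Suc j < length q" for j
    using that by (subst path_image_polyline) (auto simp: q_def)
  have xq: "x \<in> path_image (polyline q)" "x \<noteq> z"
  proof -
    have "pathfinish (polyline q) = x" using lastx by (simp add: q_def r_def polyline_endpoints)
    then show "x \<in> path_image (polyline q)" using pathfinish_in_path_image by metis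
    show "x \<noteq> z" using arc_distinct_ends[OF arcq(1)] \<open>pathfinish (polyline q) = x\<close>
      by (auto simp: q_def polyline_endpoints)
  qed
  have x_first: "x \<notin> closed_segment y z" using xq subq by blast
  have y_q: "y \<notin> path_image (polyline q)" using subq arcq(2) by auto
  assume i: "i < n"
  consider "i = 0" | j where "i = Suc j" "Suc (Suc j) < n" | "Suc i = n" "i \<noteq> 0"
    using i by (cases i) (auto, metis Suc_lessI)
  then show "nth_edge vs i \<inter> nth_edge vs (Suc i mod n) \<subseteq> {vs ! Suc i}"
  proof cases
    case 1
    have "nth_edge vs 0 = closed_segment x y" "nth_edge vs 1 = closed_segment y z" by (auto simp: nth_edge_def vs)
    moreover have "closed_segment y z \<subseteq> path_image (polyline r)" using er[of 0] n by (simp add: nth_edge_def r_def)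
    ultimately show ?thesis using 1 sub x_first n by (auto simp: vs)
  next
    case (2 j)
    then show ?thesis using arc_polyline_adjacent[OF arcr, of j] n by (simp add: vr nth_edge_Cons)
  next
    case 3
    then obtain j where j: "i = Suc (Suc j)" using n by (cases i; cases "i - 1") auto
    have "nth_edge vs i = nth_edge q j" by (simp add: j vr r_def q_def nth_edge_Cons)
    then have e: "nth_edge vs i \<subseteq> path_image (polyline q)" using eq[of j] 3 j n by (simp add: q_def r_def)
    moreover have "path_image (polyline q) \<subseteq> path_image (polyline r)"
      unfolding rq using \<open>pathfinish (linepath y z) = pathstart (polyline q)\<close> by (simp add: path_image_join)
    moreover have "nth_edge vs 0 = closed_segment x y" by (simp add: nth_edge_def vs)
    moreover have "vs ! Suc i = x" using 3 \<open>vs ! n = vs ! 0\<close> by (simp add: vs)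
    ultimately show ?thesis using sub y_q 3 by auto
  qed
qed

text \<open>Either endpoint of an edge lies on a further edge that avoids every other point of the first one. Applied
  to a point \<open>q\<close> of a face, it shows that an endpoint other than \<open>q\<close> belongs to a face not adjacent to
  \<open>q\<close>.\<close>

lemma polygon_vertex_neighbour:
  assumes vs: "closed_simple_polygon vs" and ab: "(a, b) \<in> edges vs" and q: "q \<in> closed_segment a b"
  shows "q \<noteq> a \<Longrightarrow> \<exists>e\<in>edges vs. a \<in> face_set e \<and> q \<notin> face_set e"
    and "q \<noteq> b \<Longrightarrow> \<exists>e\<in>edges vs. b \<in> face_set e \<and> q \<notin> face_set e"
proof -
  define n where "n = length vs - 1"
  note adj = closed_simple_polygon_adjacent[OF vs, folded n_def]
  obtain i where i: "a = vs ! i" "b = vs ! Suc i" "i < n"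
    using ab by (auto simp: edges_eq n_def)
  have qi: "q \<in> nth_edge vs i" using q i by (simp add: nth_edge_def)
  have edge: "(vs ! j, vs ! Suc j) \<in> edges vs" if "j < n" for j
    using that by (auto simp: edges_eq n_def)
  have fs: "face_set (vs ! j, vs ! Suc j) = nth_edge vs j" for j by (simp add: face_set_def nth_edge_def)
  show "\<exists>e\<in>edges vs. b \<in> face_set e \<and> q \<notin> face_set e" if "q \<noteq> b"
  proof -
    let ?j = "Suc i mod n"
    have j: "?j < n" using adj(1) by simp
    have "vs ! ?j = b" using i adj(2) by (cases "Suc i = n") auto
    then have "b \<in> nth_edge vs ?j" by (simp add: nth_edge_def)
    moreover have "q \<notin> nth_edge vs ?j" using adj(3)[OF i(3)] qi that i(2) by blast
    ultimately show ?thesis using edge[OF j] fs by metis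
  qed
  show "\<exists>e\<in>edges vs. a \<in> face_set e \<and> q \<notin> face_set e" if "q \<noteq> a"
  proof -
    define j where "j = (if i = 0 then n - 1 else i - 1)"
    have j: "j < n" "Suc j mod n = i" using i adj(1) by (auto simp: j_def)
    have "vs ! Suc j = a" using i adj(1,2) by (auto simp: j_def)
    then have "a \<in> nth_edge vs j" "q \<notin> nth_edge vs j"
      using adj(3)[OF j(1)] qi that unfolding j(2) by (auto simp: nth_edge_def)
    then show ?thesis using edge[OF j(1)] fs by metis
  qed
qed

lemma ray_in_segment:
  fixes a b :: "real^2"
  assumes p: "p = linepath a b t0" and y: "y = linepath a b t1" and t: "0 \<le> t0" "t0 \<le> 1" "t0 < t1"
    and d: "d \<le> dist p b" and z: "z = p + c *\<^sub>R (y - p)" "0 < c" "dist p z < d"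
  shows "z \<in> closed_segment a b"
proof -
  have yp: "y - p = (t1 - t0) *\<^sub>R (b - a)" unfolding p y linepath_def by (simp add: algebra_simps)
  have bp: "b - p = (1 - t0) *\<^sub>R (b - a)" unfolding p linepath_def by (simp add: algebra_simps)
  let ?t = "t0 + c * (t1 - t0)"
  have zt: "z = linepath a b ?t"
    unfolding z(1) yp unfolding p linepath_def by (simp add: algebra_simps)
  have "?t \<le> 1"
  proof (rule ccontr)
    assume "\<not> ?t \<le> 1"
    then have "\<bar>1 - t0\<bar> \<le> \<bar>c * (t1 - t0)\<bar>" using t by linarith
    moreover have "dist p z = \<bar>c * (t1 - t0)\<bar> * norm (b - a)"
      unfolding z(1) yp by (simp add: dist_norm)
    moreover have "dist p b = \<bar>1 - t0\<bar> * norm (b - a)"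
      using bp by (metis dist_commute dist_norm norm_scaleR)
    ultimately show False using d z(3) mult_right_mono[of "\<bar>1 - t0\<bar>" "\<bar>c * (t1 - t0)\<bar>" "norm (b - a)"] by auto
  qed
  moreover have "0 \<le> ?t" using t z(2) by simp
  ultimately show ?thesis unfolding zt by (simp add: linepath_in_path)
qed

lemma linepath_eq_end:
  assumes "linepath a b t = b" "t < 1" shows "a = b"
proof -
  have "(1 - t) *\<^sub>R (a - b) = 0" using assms(1) by (simp add: linepath_def algebra_simps)
  then show ?thesis using assms(2) by simp
qed

lemma frontier_eq_faces:
  assumes "polygonal_domain \<Omega> \<C>"
  shows "frontier \<Omega> = (\<Union>e\<in>faces \<C>. face_set e)"
proof -
  have "path_image (polyline vs) = (\<Union>e\<in>edges vs. face_set e)" if "vs \<in> \<C>" for vs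
  proof -
    have "closed_simple_polygon vs" using assms that by (simp add: polygonal_domain_def)
    from closed_simple_polygon_adjacent(1)[OF this] have "2 \<le> length vs" by simp
    from path_image_polyline[OF this] show ?thesis
      by (auto simp: edges_eq face_set_def nth_edge_def)
  qed
  then show ?thesis using assms by (auto simp: polygonal_domain_def faces_def)
qed

text \<open>Within the disc the boundary consists of segments from \<open>p\<close> that reach the circle: a face meeting the disc
  passes through \<open>p\<close>, and its endpoints other than \<open>p\<close> belong to non-adjacent faces, hence lie at distance
  at least \<open>d\<close>. So an open radius is contained in the boundary or disjoint from it, and in the second case
  connectedness puts it entirely inside or outside the domain.\<close>

lemma polygonal_domain_conic:
  assumes dom: "polygonal_domain \<Omega> \<C>" and d: "0 < d"
    and far: "\<And>e. e \<in> faces \<C> \<Longrightarrow> p \<notin> face_set e \<Longrightarrow> d \<le> infdist p (face_set e)"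
  shows "conic_polygon \<Omega> p d \<C>"
proof
  show op: "open \<Omega>" and "bounded \<Omega>" using dom by (auto simp: polygonal_domain_def)
  show "0 < d" by (rule d)
  have far': "d \<le> dist p y" if "e \<in> faces \<C>" "p \<notin> face_set e" "y \<in> face_set e" for e y
    using far[OF that(1,2)] infdist_le[OF that(3), of p] by linarith
  show "p \<in> face_set e \<or> face_set e \<inter> ball p d = {}" if "e \<in> faces \<C>" for e
    using far'[OF that] by fastforce
  have endpoint: "p \<noteq> a \<Longrightarrow> d \<le> dist p a" "p \<noteq> b \<Longrightarrow> d \<le> dist p b"
    if e: "(a, b) \<in> faces \<C>" "p \<in> closed_segment a b" for a b
  proof -
    obtain vs where vs: "vs \<in> \<C>" "(a, b) \<in> edges vs" using e(1) by (auto simp: faces_def)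
    have csp: "closed_simple_polygon vs" using dom vs(1) by (simp add: polygonal_domain_def)
    have sub: "e \<in> faces \<C>" if "e \<in> edges vs" for e using that vs(1) by (auto simp: faces_def)
    show "d \<le> dist p a" if "p \<noteq> a"
      using polygon_vertex_neighbour(1)[OF csp vs(2) e(2) that] sub far' by blast
    show "d \<le> dist p b" if "p \<noteq> b"
      using polygon_vertex_neighbour(2)[OF csp vs(2) e(2) that] sub far' by blast
  qed
  fix x :: "real^2" and s :: real assume x: "x \<in> ball p d" and s: "0 < s" "s \<le> 1"
  have dd: "dist p (dil p r x) < d" if "0 < r" "r \<le> 1" for r
  proof -
    have "dist p (dil p r x) = r * dist p x" using that by (simp add: dil_def dist_norm norm_minus_commute)
    also have "\<dots> \<le> 1 * dist p x" using that by (intro mult_right_mono) auto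
    finally show ?thesis using x by simp
  qed
  \<comment> \<open>A radius that meets the boundary is contained in it.\<close>
  have ray: "dil p r' x \<in> frontier \<Omega>"
    if r: "0 < r" "r \<le> 1" "dil p r x \<in> frontier \<Omega>" and r': "0 < r'" "r' \<le> 1" and xp: "x \<noteq> p" for r r'
  proof -
    let ?y = "dil p r x" and ?z = "dil p r' x"
    obtain a b where e: "(a, b) \<in> faces \<C>" "?y \<in> closed_segment a b"
      using r(3) unfolding frontier_eq_faces[OF dom] face_set_def by auto
    have pe: "p \<in> closed_segment a b"
      using far'[OF e(1), of ?y] e(2) dd[OF r(1,2)] by (auto simp: face_set_def)
    obtain t0 where t0: "0 \<le> t0" "t0 \<le> 1" "p = linepath a b t0"
      using pe by (auto simp: in_segment linepath_def)
    obtain t1 where t1: "0 \<le> t1" "t1 \<le> 1" "?y = linepath a b t1"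
      using e(2) by (auto simp: in_segment linepath_def)
    have z: "?z = p + (r' / r) *\<^sub>R (?y - p)" using r by (simp add: dil_def)
    have "?y \<noteq> p" using r xp by (simp add: dil_def)
    then have "t0 \<noteq> t1" using t0 t1 by auto
    then consider "t0 < t1" | "t1 < t0" by linarith
    then have "?z \<in> closed_segment a b"
    proof cases
      case 1
      then have "p \<noteq> b"
        using linepath_eq_end[of a b t0] t0(3) t1 \<open>?y \<noteq> p\<close> by auto
      show ?thesis
        by (rule ray_in_segment[OF t0(3) t1(3) t0(1,2) 1 _ z]) (use endpoint(2)[OF e(1) pe] r r' dd \<open>p \<noteq> b\<close> in auto)
    next
      case 2
      have rev: "linepath a b t = linepath b a (1 - t)" for t
        by (simp add: linepath_def algebra_simps)
      have "p \<noteq> a" 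
        using linepath_eq_end[of b a "1 - t0"] t0(3) t1 2 \<open>?y \<noteq> p\<close> rev[of t0] by auto
      have "?z \<in> closed_segment b a"
        by (rule ray_in_segment[OF t0(3)[unfolded rev] t1(3)[unfolded rev] _ _ _ _ z])
           (use endpoint(1)[OF e(1) pe] r r' dd \<open>p \<noteq> a\<close> t0 2 in auto)
      then show ?thesis by (simp add: closed_segment_commute)
    qed
    then show ?thesis unfolding frontier_eq_faces[OF dom] face_set_def using e(1) by force
  qed
  show "dil p s x \<in> \<Omega> \<longleftrightarrow> x \<in> \<Omega>"
  proof (cases "x = p")
    case True
    then show ?thesis by (simp add: dil_def)
  next
    case xp: False
    have x1: "dil p 1 x = x" by (simp add: dil_def)
    show ?thesis
    proof (cases "x \<in> frontier \<Omega>")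
      case True
      then have "dil p s x \<in> frontier \<Omega>" using ray[of 1 s] x1 s xp by simp
      then show ?thesis using True op frontier_disjoint_eq by blast
    next
      case False
      have nf: "dil p r x \<notin> frontier \<Omega>" if "0 < r" "r \<le> 1" for r
        using ray[of r 1] that x1 xp False by auto
      have "closed_segment (dil p s x) x \<inter> frontier \<Omega> = {}"
      proof -
        have "y \<notin> frontier \<Omega>" if y: "y \<in> closed_segment (dil p s x) x" for y
        proof -
          obtain t where t: "0 \<le> t" "t \<le> 1" "y = (1 - t) *\<^sub>R dil p s x + t *\<^sub>R x"
            using y by (auto simp: in_segment)
          have "y = dil p ((1 - t) * s + t) x" unfolding t(3) dil_def by (simp add: algebra_simps)
          moreover have "0 < (1 - t) * s + t"
          proof (cases "t = 0")
            case False
            then have "0 < t" "0 \<le> (1 - t) * s" using t s by auto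
            then show ?thesis by linarith
          qed (use s in simp)
          moreover have "(1 - t) * s + t \<le> 1"
            using mult_left_mono[OF s(2), of "1 - t"] t by simp
          ultimately show ?thesis using nf by simp
        qed
        then show ?thesis by blast
      qed
      then show ?thesis
        using connected_Int_frontier[of "closed_segment (dil p s x) x" \<Omega>] by auto
    qed
  qed
qed

section \<open>Non-concentration\<close>

text \<open>The function \<open>m - n\<close> is \<open>1\<close> on the small disc and at least \<open>- 1 / (1 - \<alpha>)\<close> elsewhere; the total mass
  is \<open>1\<close>.\<close>

lemma (in eigenfunction) mass_near_point_le:
  assumes \<alpha>: "0 < \<alpha>" "\<alpha> < 1"
    and m: "smooth (\<lambda>x. complex_of_real (m x))" and n: "smooth (\<lambda>x. complex_of_real (n x))"
    and near: "\<And>x. x \<in> ball p (\<alpha> * d) \<Longrightarrow> m x - n x = 1"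
    and lower: "\<And>x. - (1 / (1 - \<alpha>)) \<le> m x - n x"
    and \<mu>: "0 < \<mu>" and K: "0 \<le> K"
    and virial: "\<mu> * (LINT x|area. m x * (cmod (u x))\<^sup>2) \<le>
      \<mu> * (LINT x|area. n x * (cmod (u x))\<^sup>2) + K * sqrt \<mu>"
  shows "mass (ball p (\<alpha> * d) \<inter> \<Omega>) u \<le> 1 / (2 - \<alpha>) + K / sqrt \<mu>"
proof -
  let ?S = "ball p (\<alpha> * d)" and ?\<beta> = "1 / (1 - \<alpha>)"
  have iu: "integrable area (\<lambda>x. (cmod (u x))\<^sup>2)" by (rule square_integrableD(2)[OF si_u])
  have S: "?S \<inter> \<Omega> \<in> sets lebesgue" using sets_dom by (intro sets.Int) auto
  have eq: "(\<lambda>x. if x \<in> ?S \<inter> \<Omega> then (cmod (u x))\<^sup>2 else 0) =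
      (\<lambda>x. if x \<in> \<Omega> then indicator ?S x * (cmod (u x))\<^sup>2 else 0)" by (auto simp: indicator_def)
  have mass: "mass (?S \<inter> \<Omega>) u = (LINT x|area. indicator ?S x * (cmod (u x))\<^sup>2)"
    unfolding Lebesgue_Measure.integral_restrict_UNIV[OF S, symmetric]
      Lebesgue_Measure.integral_restrict_UNIV[OF sets_dom, symmetric] eq ..
  have iS: "integrable area (\<lambda>x. indicator ?S x * (cmod (u x))\<^sup>2)"
  proof (rule Bochner_Integration.integrable_bound[OF iu])
    have "(\<lambda>x. indicator ?S x :: real) \<in> borel_measurable area"
      by (intro measurable_restrict_space1 borel_measurable_indicator) auto
    then show "(\<lambda>x. indicator ?S x * (cmod (u x))\<^sup>2) \<in> borel_measurable area"
      using borel_measurable_integrable[OF iu] by (rule borel_measurable_times)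
  qed (simp add: indicator_def)
  have im: "integrable area (\<lambda>x. m x * (cmod (u x))\<^sup>2)"
    and inn: "integrable area (\<lambda>x. n x * (cmod (u x))\<^sup>2)"
    by (rule integrable_weight[OF _ si_u], rule m, rule integrable_weight[OF _ si_u], rule n)
  have "(1 + ?\<beta>) * mass (?S \<inter> \<Omega>) u - ?\<beta> =
      (LINT x|area. (1 + ?\<beta>) * (indicator ?S x * (cmod (u x))\<^sup>2) - ?\<beta> * (cmod (u x))\<^sup>2)"
    unfolding mass Bochner_Integration.integral_diff[OF integrable_mult_right[OF iS] integrable_mult_right[OF iu]]
      integral_mult_right_zero normalized by simp
  also have "\<dots> \<le> (LINT x|area. m x * (cmod (u x))\<^sup>2 - n x * (cmod (u x))\<^sup>2)"
  proof (rule integral_mono)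
    show "integrable area (\<lambda>x. (1 + ?\<beta>) * (indicator ?S x * (cmod (u x))\<^sup>2) - ?\<beta> * (cmod (u x))\<^sup>2)"
      by (intro Bochner_Integration.integrable_diff integrable_mult_right iS iu)
    show "integrable area (\<lambda>x. m x * (cmod (u x))\<^sup>2 - n x * (cmod (u x))\<^sup>2)"
      by (intro Bochner_Integration.integrable_diff im inn)
    fix x
    have "(1 + ?\<beta>) * indicator ?S x - ?\<beta> \<le> m x - n x"
      using near[of x] lower[of x] by (cases "x \<in> ?S") auto
    then have "((1 + ?\<beta>) * indicator ?S x - ?\<beta>) * (cmod (u x))\<^sup>2 \<le> (m x - n x) * (cmod (u x))\<^sup>2"
      by (rule mult_right_mono) simp
    then show "(1 + ?\<beta>) * (indicator ?S x * (cmod (u x))\<^sup>2) - ?\<beta> * (cmod (u x))\<^sup>2 \<le>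
        m x * (cmod (u x))\<^sup>2 - n x * (cmod (u x))\<^sup>2" by (simp only: left_diff_distrib mult.assoc)
  qed
  also have "\<dots> = (LINT x|area. m x * (cmod (u x))\<^sup>2) - (LINT x|area. n x * (cmod (u x))\<^sup>2)"
    by (rule Bochner_Integration.integral_diff[OF im inn])
  also have "\<dots> \<le> K / sqrt \<mu>"
  proof -
    define D where "D = (LINT x|area. m x * (cmod (u x))\<^sup>2) - (LINT x|area. n x * (cmod (u x))\<^sup>2)"
    have r: "0 < sqrt \<mu>" "sqrt \<mu> * sqrt \<mu> = \<mu>" using \<mu> by simp_all
    have "\<mu> * D \<le> K * sqrt \<mu>" using virial unfolding D_def right_diff_distrib by linarith
    moreover have "(D * sqrt \<mu>) * sqrt \<mu> = \<mu> * D" by (simp only: mult.assoc r(2)) (rule mult.commute)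
    ultimately have "(D * sqrt \<mu>) * sqrt \<mu> \<le> K * sqrt \<mu>" by (simp only:)
    then have "D * sqrt \<mu> \<le> K" using r(1) by (simp only: mult_le_cancel_right_pos)
    then show ?thesis unfolding D_def using r(1) by (simp only: pos_le_divide_eq)
  qed
  finally have "(1 + ?\<beta>) * mass (?S \<inter> \<Omega>) u \<le> ?\<beta> + K / sqrt \<mu>" by simp
  then have "(1 - \<alpha>) * ((1 + ?\<beta>) * mass (?S \<inter> \<Omega>) u) \<le> (1 - \<alpha>) * (?\<beta> + K / sqrt \<mu>)"
    using \<alpha> by (intro mult_left_mono) auto
  moreover have "(1 - \<alpha>) * (1 + ?\<beta>) = 2 - \<alpha>" "(1 - \<alpha>) * ?\<beta> = 1" using \<alpha> by (simp_all add: field_simps)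
  ultimately have "(2 - \<alpha>) * mass (?S \<inter> \<Omega>) u \<le> 1 + (1 - \<alpha>) * (K / sqrt \<mu>)"
    by (simp only: mult.assoc[symmetric] distrib_left)
  also have "\<dots> \<le> 1 + (2 - \<alpha>) * (K / sqrt \<mu>)"
    using K \<mu> by (intro add_left_mono mult_right_mono) auto
  also have "\<dots> = (2 - \<alpha>) * (1 / (2 - \<alpha>) + K / sqrt \<mu>)" using \<alpha> by (simp add: distrib_left)
  finally show ?thesis using \<alpha> by (simp only: mult_le_cancel_left_pos)
qed

text \<open>The constant depends on the cutoff only, so it serves all eigenfunctions and all boundary conditions.\<close>

lemma (in conic_polygon) nonconcentration:
  assumes \<alpha>: "0 < \<alpha>" "\<alpha> < 1"
  obtains K where "\<And>B u G \<mu>. eigenfunction \<Omega> p d \<C> B u G \<mu> \<Longrightarrow> 0 < \<mu> \<Longrightarrow>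
    mass (ball p (\<alpha> * d) \<inter> \<Omega>) u \<le> 1 / (2 - \<alpha>) + K / sqrt \<mu>"
proof (rule radial_cutoff[OF \<alpha>])
  fix m k assume m: "localized (\<lambda>x. complex_of_real (m x))" "\<And>x. 0 \<le> m x" "\<And>x. m x \<le> 1"
    and k: "localized (\<lambda>x. complex_of_real (k x))" "\<And>x. 0 \<le> k x"
    and grad: "\<And>i x. pd i (\<lambda>x. of_real (m x)) x = - of_real (k x) * offset p i x"
    and near: "\<And>x. x \<in> ball p (\<alpha> * d) \<Longrightarrow> m x - k x * sqdist p x = 1"
    and lower: "\<And>x. - (1 / (1 - \<alpha>)) \<le> m x - k x * sqdist p x"
  have n: "localized (\<lambda>x. complex_of_real (k x * sqdist p x))"
    unfolding of_real_mult by (rule localized_mult[OF k(1) smooth_sqdist])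
  have "\<exists>C\<ge>0. \<forall>s x. 1 / 2 \<le> s \<longrightarrow> s \<le> 1 \<longrightarrow>
      cmod (of_real ((1 / s) ^ 0) * of_real (m (dil p (1 / s) x)) - of_real (m x)) \<le> C * (1 - s)"
    by (rule dilation_lipschitz[OF m(1), of 0]) blast
  then obtain C0 where C0: "0 \<le> C0" "\<And>s x. 1 / 2 \<le> s \<Longrightarrow> s \<le> 1 \<Longrightarrow>
      cmod (of_real ((1 / s) ^ 0) * of_real (m (dil p (1 / s) x)) - of_real (m x)) \<le> C0 * (1 - s)"
    by metis
  have "\<exists>C\<ge>0. \<forall>s x. 1 / 2 \<le> s \<longrightarrow> s \<le> 1 \<longrightarrow> cmod (of_real ((1 / s) ^ 1) * pd i (\<lambda>x. of_real (m x)) (dil p (1 / s) x) -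
      pd i (\<lambda>x. of_real (m x)) x) \<le> C * (1 - s)" for i
    by (rule dilation_lipschitz[OF localized_pd[OF m(1), of i], of 1]) blast
  then obtain C1 where C1: "\<And>i. 0 \<le> C1 i" "\<And>i s x. 1 / 2 \<le> s \<Longrightarrow> s \<le> 1 \<Longrightarrow>
      cmod (of_real ((1 / s) ^ 1) * pd i (\<lambda>x. of_real (m x)) (dil p (1 / s) x) - pd i (\<lambda>x. of_real (m x)) x) \<le> C1 i * (1 - s)"
    by metis
  have "\<exists>C\<ge>0. \<forall>s x. 1 / 2 \<le> s \<longrightarrow> s \<le> 1 \<longrightarrow>
      cmod (of_real ((1 / s) ^ 4) * of_real (k (dil p (1 / s) x)) - of_real (k x)) \<le> C * (1 - s)"
    by (rule dilation_lipschitz[OF k(1), of 4]) blast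
  then obtain C4 where C4: "0 \<le> C4" "\<And>s x. 1 / 2 \<le> s \<Longrightarrow> s \<le> 1 \<Longrightarrow>
      cmod (of_real ((1 / s) ^ 4) * of_real (k (dil p (1 / s) x)) - of_real (k x)) \<le> C4 * (1 - s)"
    by metis
  have "\<exists>b\<ge>0. \<forall>x. cmod (pd i (\<lambda>x. complex_of_real (k x * sqdist p x)) x) \<le> b" for i
    by (rule localized_bounded[OF localized_pd[OF n, of i]]) blast
  then obtain b where b: "\<And>i. 0 \<le> b i" "\<And>i x. cmod (pd i (\<lambda>x. complex_of_real (k x * sqdist p x)) x) \<le> b i"
    by metis
  define C where "C = C0 + (\<Sum>i\<in>UNIV. C1 i) + C4"
  define b' where "b' = (\<Sum>i\<in>UNIV. b i)"
  have le_sum: "f i \<le> (\<Sum>i\<in>UNIV. f i)" if "\<And>i. 0 \<le> f i" for f :: "2 \<Rightarrow> real" and i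
    using that by (intro member_le_sum) auto
  have C: "0 \<le> C" "C0 \<le> C" "C4 \<le> C" "C1 i \<le> C" for i
  proof -
    have "0 \<le> (\<Sum>i\<in>UNIV. C1 i)" by (intro sum_nonneg C1(1))
    then show "0 \<le> C" "C0 \<le> C" "C4 \<le> C" "C1 i \<le> C"
      unfolding C_def using C0(1) C4(1) le_sum[of C1 i, OF C1(1)] by linarith+
  qed
  have b': "0 \<le> b'" "b i \<le> b'" for i
    unfolding b'_def by (intro sum_nonneg b(1), rule le_sum[OF b(1)])
  show ?thesis
  proof (rule that[of "C + 2 * b'"])
    fix B u G \<mu> assume e: "eigenfunction \<Omega> p d \<C> B u G \<mu>" and \<mu>: "0 < \<mu>"
    interpret e: eigenfunction \<Omega> p d \<C> B u G \<mu> by (rule e)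
    have "\<mu> * (LINT x|area. m x * (cmod (u x))\<^sup>2) \<le>
        (LINT x|area. k x * (cmod (e.radial_part x))\<^sup>2) + C * sqrt \<mu>"
    proof (rule e.virial_inequality[OF m k grad C(1) _ _ _ \<mu>])
      fix s :: real and x i assume s: "1 / 2 \<le> s" "s \<le> 1"
      have mono: "t \<le> C * (1 - s)" if "t \<le> c * (1 - s)" "c \<le> C" for t c
        using order_trans[OF that(1) mult_right_mono[OF that(2), of "1 - s"]] s by simp
      have "\<bar>m (dil p (1 / s) x) - m x\<bar> \<le> C0 * (1 - s)"
        using C0(2)[OF s, of x] by (simp flip: of_real_diff)
      then show "\<bar>m (dil p (1 / s) x) - m x\<bar> \<le> C * (1 - s)" by (rule mono) (rule C)
      show "cmod (of_real (1 / s) * pd i (\<lambda>x. of_real (m x)) (dil p (1 / s) x) - pd i (\<lambda>x. of_real (m x)) x) \<le> C * (1 - s)"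
        using mono[OF C1(2)[OF s] C(4)] by (simp only: power_one_right)
      have "\<bar>(1 / s) ^ 4 * k (dil p (1 / s) x) - k x\<bar> \<le> C4 * (1 - s)"
        using C4(2)[OF s, of x] by (simp only: of_real_mult[symmetric] of_real_diff[symmetric] norm_of_real)
      then show "\<bar>(1 / s) ^ 4 * k (dil p (1 / s) x) - k x\<bar> \<le> C * (1 - s)" by (rule mono) (rule C)
    qed
    also have "(LINT x|area. k x * (cmod (e.radial_part x))\<^sup>2) \<le>
        \<mu> * (LINT x|area. (k x * sqdist p x) * (cmod (u x))\<^sup>2) + 2 * b' * sqrt \<mu>"
      by (rule e.radial_energy_le[OF k b'(1) order_trans[OF b(2) b'(2)] \<mu>])
    finally have "\<mu> * (LINT x|area. m x * (cmod (u x))\<^sup>2) \<le>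
        \<mu> * (LINT x|area. (k x * sqdist p x) * (cmod (u x))\<^sup>2) + (C + 2 * b') * sqrt \<mu>"
      by (simp add: algebra_simps)
    then show "mass (ball p (\<alpha> * d) \<inter> \<Omega>) u \<le> 1 / (2 - \<alpha>) + (C + 2 * b') / sqrt \<mu>"
      using C(1) b'(1) by (intro e.mass_near_point_le[OF \<alpha> localized_smooth[OF m(1)] localized_smooth[OF n] near lower \<mu>]) auto
  qed
qed

theorem theorem1:
  fixes \<Omega> :: "(real^2) set"
    and \<C> :: "(real^2) list set"
    and B :: "(real^2) \<times> (real^2) \<Rightarrow> boundary_condition"
    and u :: "nat \<Rightarrow> real^2 \<Rightarrow> complex"
    and lam :: "nat \<Rightarrow> real"
    and p0 :: "real^2"
    and F' :: "(real^2) \<times> (real^2)"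
    and d \<alpha> :: real
  assumes domain: "polygonal_domain \<Omega> \<C>"
    and eigen: "\<And>j. eigen_solution \<Omega> \<C> B ((lam j)\<^sup>2) (u j)"
    and normalized: "\<And>j. L2_norm_on \<Omega> (u j) = 1"
    and lam: "filterlim lam at_top sequentially"
    and p0: "p0 \<in> closure \<Omega>"
    and F': "F' \<in> faces \<C>" "p0 \<notin> face_set F'"
    and nearest: "\<And>F. F \<in> faces \<C> \<Longrightarrow> p0 \<notin> face_set F \<Longrightarrow>
                    infdist p0 (face_set F') \<le> infdist p0 (face_set F)"
    and d: "d = infdist p0 (face_set F')"
    and \<alpha>: "0 < \<alpha>" "\<alpha> < 1"
  shows "limsup (\<lambda>j. ereal ((L2_norm_on (ball p0 (\<alpha> * d) \<inter> \<Omega>) (u j))\<^sup>2)) \<le> ereal (1 / (2 - \<alpha>))"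
proof -
  have "closed (face_set F')" "face_set F' \<noteq> {}" by (auto simp: face_set_def)
  then have "0 < d" unfolding d using F'(2) infdist_pos_not_in_closed by blast
  then interpret conic_polygon \<Omega> p0 d \<C>
    by (rule polygonal_domain_conic[OF domain]) (use nearest d in auto)
  obtain K where K: "\<And>B u G \<mu>. eigenfunction \<Omega> p0 d \<C> B u G \<mu> \<Longrightarrow> 0 < \<mu> \<Longrightarrow>
      mass (ball p0 (\<alpha> * d) \<inter> \<Omega>) u \<le> 1 / (2 - \<alpha>) + K / sqrt \<mu>"
    using nonconcentration[OF \<alpha>] by blast
  have bound: "(L2_norm_on (ball p0 (\<alpha> * d) \<inter> \<Omega>) (u j))\<^sup>2 \<le> 1 / (2 - \<alpha>) + K / lam j" if "0 < lam j" for j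
  proof -
    obtain G where "form_domain \<Omega> \<C> B (u j) G"
      "\<And>v H. form_domain \<Omega> \<C> B v H \<Longrightarrow>
           (LINT x|lebesgue_on \<Omega>. (\<Sum>i\<in>UNIV. G x $ i * cnj (H x $ i))) =
           complex_of_real ((lam j)\<^sup>2) * (LINT x|lebesgue_on \<Omega>. u j x * cnj (v x))"
      using eigen[of j] unfolding eigen_solution_def by blast
    moreover have "mass \<Omega> (u j) = 1" using normalized[of j] by (simp add: L2_norm_on_def)
    ultimately have "eigenfunction \<Omega> p0 d \<C> B (u j) G ((lam j)\<^sup>2)"
      by unfold_locales
    from K[OF this] that show ?thesis by (simp add: L2_norm_on_def real_sqrt_abs)
  qed
  have "\<forall>\<^sub>F j in sequentially. 0 < lam j"
    using lam unfolding filterlim_at_top_dense by blast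
  then have "limsup (\<lambda>j. ereal ((L2_norm_on (ball p0 (\<alpha> * d) \<inter> \<Omega>) (u j))\<^sup>2)) \<le>
      limsup (\<lambda>j. ereal (1 / (2 - \<alpha>) + K / lam j))"
    by (intro Limsup_mono) (auto elim!: eventually_mono intro: bound)
  also have "\<dots> = ereal (1 / (2 - \<alpha>))"
  proof (rule lim_imp_Limsup)
    have "(\<lambda>j. K / lam j) \<longlonglongrightarrow> 0"
      by (rule tendsto_divide_0[OF tendsto_const filterlim_mono[OF lam at_top_le_at_infinity order_refl]])
    then have "(\<lambda>j. 1 / (2 - \<alpha>) + K / lam j) \<longlonglongrightarrow> 1 / (2 - \<alpha>) + 0" by (intro tendsto_intros)
    then show "(\<lambda>j. ereal (1 / (2 - \<alpha>) + K / lam j)) \<longlonglongrightarrow> ereal (1 / (2 - \<alpha>))" by simp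
  qed simp
  finally show ?thesis .
qed

end
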